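(* Let $T=\{(s_1,\ldots,s_5)\in(S^1)^5 \mid s_1\cdots s_5=1\}$ act on the Grassmannian $\operatorname{Gr}(2,\mathbb{C}^5)$ of complex $2$-planes in $\mathbb{C}^5$ via the action induced by the diagonal action $(s_1,\ldots,s_5)\cdot(z_1,\ldots,z_5)=(s_1z_1,\ldots,s_5z_5)$ on $\mathbb{C}^5$. Then the orbit space $\operatorname{Gr}(2,\mathbb{C}^5)/T$ has integral homology \[ H_i(\operatorname{Gr}(2,\mathbb{C}^5)/T;\mathbb{Z}) \cong \begin{cases}\mathbb{Z} & i=0,8,\\ \mathbb{Z}/2\mathbb{Z} & i=5,\\ 0 & \text{otherwise.}\end{cases} \]
   Context: The orbit space carries the quotient topology; it is a compact Hausdorff space. *)

theory Defs
  imports "HOL-Analysis.Analysis" "HOL-Homology.Homology"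
begin

definition quotient_topology :: "'a topology \<Rightarrow> ('a \<Rightarrow> 'b) \<Rightarrow> 'b topology" where
  "quotient_topology X f =
     topology (\<lambda>U. U \<subseteq> f ` topspace X \<and> openin X {x \<in> topspace X. f x \<in> U})"

definition cplane :: "complex^5 \<Rightarrow> complex^5 \<Rightarrow> (complex^5) set" where
  "cplane u v = {a *s u + b *s v | a b. True}"

definition cindep2 :: "complex^5 \<Rightarrow> complex^5 \<Rightarrow> bool" where
  "cindep2 u v \<longleftrightarrow> (\<forall>a b::complex. a *s u + b *s v = 0 \<longrightarrow> a = 0 \<and> b = 0)"

definition stiefel25 :: "((complex^5) \<times> (complex^5)) topology" where
  "stiefel25 = subtopology (prod_topology euclidean euclidean) {(u, v). cindep2 u v}"

definition Gr25 :: "(complex^5) set topology" where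
  "Gr25 = quotient_topology stiefel25 (\<lambda>(u, v). cplane u v)"

definition torusT :: "(complex^5) set" where
  "torusT = {s. (\<forall>i. cmod (s $ i) = 1) \<and> (\<Prod>i\<in>UNIV. s $ i) = 1}"

definition tact :: "complex^5 \<Rightarrow> (complex^5) set \<Rightarrow> (complex^5) set" where
  "tact s P = (\<lambda>z. \<chi> i. s $ i * z $ i) ` P"

definition Torbit :: "(complex^5) set \<Rightarrow> (complex^5) set set" where
  "Torbit P = {tact s P | s. s \<in> torusT}"

definition GrT_orbits :: "(complex^5) set set topology" where
  "GrT_orbits = quotient_topology Gr25 Torbit"

end

theory Submission
  imports Defs
begin

text \<open>
  Write the rows of an orthonormal frame of a plane as \<open>u\<close> and \<open>v\<close>.  The columns
  \<open>(u\<^sub>i, v\<^sub>i) \<in> \<complex>\<^sup>2\<close>, taken up to phase, are spinors, that is, vectors \<open>w\<^sub>i\<close> of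
  \<open>\<real>\<^sup>3\<close>; orthonormality says that \<open>\<Sum> w\<^sub>i = 0\<close> and \<open>\<Sum> \<bar>w\<^sub>i\<bar> = 1\<close>, and a change of frame
  rotates all the \<open>w\<^sub>i\<close>.  Dropping \<open>w\<^sub>5\<close>, the orbit space becomes, up to homotopy,
  the space of nonzero quadruples \<open>(a, b, c, d)\<close> of vectors of \<open>\<real>\<^sup>3\<close> modulo \<open>SO(3)\<close>.

  Everything else takes place in this space.  Covering it by \<open>d \<noteq> 0\<close> (contractible) and
  \<open>(a, b, c) \<noteq> 0\<close> shows that it is the cone of the inclusion of the intersection into the latter.
  Repeating the argument, with the component of \<open>b\<close> or \<open>c\<close> perpendicular to \<open>d\<close> in
  place of \<open>d\<close>, ends in punctured Euclidean spaces: the space \<open>(a, b, c) \<noteq> 0\<close> has the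
  homology of \<open>S\<^sup>5\<close>, the intersection has \<open>\<int>\<close> in degrees 5 and 7, and the
  inclusion is multiplication by 2 in degree 5.  The factor 2 comes from the involution \<open>d \<mapsto> - d\<close>, which
  is invisible in the target and exchanges the two halves of a suspension that carries the class in degree 5.
\<close>

section \<open>Homology of open covers with acyclic members\<close>

text \<open>The condition that the phases multiply to 1 does not shrink the orbits: scalars fix
  every plane, and a suitable scalar factor, a fifth root, brings any diagonal matrix of phases into
  \<open>torusT\<close>. This is why the columns may be taken up to independent phases. The obstacle
  is that \<open>SO(3)\<close> does not act freely: rotations about their common line fix a
  quadruple of parallel vectors. So the quotient is not treated as a bundle. Invariant open sets are
  chosen so that the basic pieces either contract modulo rotations or contain two independent
  vectors, whose frame uses up the rotation and leaves a slice. The slices that remain are punctured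
  spaces of dimension 4 and 7. Suspending the first twice gives degree 5, suspending the second once
  gives degree 7, and the last cone raises 7 to 8. All nonzero quadruples replace the compact level
  set because their vectors can be deformed one at a time. The sign decides between 2 and 0:
  changing \<open>d\<close> to \<open>- d\<close> is a product of three reflections on the
  4-dimensional slice, so it acts as -1 there and the two halves of the suspension add up; with the
  sign +1 they would cancel.\<close>

definition acyclic_space :: "'a topology \<Rightarrow> bool" where
  "acyclic_space X \<longleftrightarrow> topspace X \<noteq> {} \<and> (\<forall>p. trivial_group (reduced_homology_group p X))"

lemma contractible_imp_acyclic:
  "\<lbrakk>contractible_space X; topspace X \<noteq> {}\<rbrakk> \<Longrightarrow> acyclic_space X"
  by (simp add: acyclic_space_def trivial_reduced_homology_group_contractible_space)

lemma iso_boundary_trivial: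
  assumes "topspace X \<inter> S \<noteq> {}" "trivial_group (reduced_homology_group p X)"
    "trivial_group (reduced_homology_group (p-1) X)"
  shows "hom_boundary p X S
      \<in> iso (relative_homology_group p X S) (reduced_homology_group (p-1) (subtopology X S))"
  using very_short_exact_sequence
    [of "reduced_homology_group (p - 1) X"
        "reduced_homology_group (p - 1) (subtopology X S)"
        "relative_homology_group p X S"
        "reduced_homology_group p X"
        "hom_induced (p - 1) (subtopology X S) {} X {} id"
        "hom_boundary p X S"
        "hom_induced p X {} X S id"] assms
  by (meson exact_seq_cons_iff homology_exactness_reduced_1 homology_exactness_reduced_2)

lemma iso_pair_trivial:
  assumes "topspace X \<inter> S \<noteq> {}" "trivial_group (reduced_homology_group p (subtopology X S))"
    "trivial_group (reduced_homology_group (p-1) (subtopology X S))"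
  shows "hom_induced p X {} X S id \<in> iso (reduced_homology_group p X) (relative_homology_group p X S)"
  using very_short_exact_sequence
      [of "reduced_homology_group (p - 1) (subtopology X S)"
          "relative_homology_group p X S"
          "reduced_homology_group p X"
          "reduced_homology_group p (subtopology X S)"
          "hom_boundary p X S"
          "hom_induced p X {} X S id"
          "hom_induced p (subtopology X S) {} X {} id"] assms
    by (meson exact_seq_cons_iff homology_exactness_reduced_1 homology_exactness_reduced_3)

lemma iso_pair_acyclic_subspace:
  assumes "acyclic_space (subtopology X S)"
  shows "hom_induced p X {} X S id \<in> iso (reduced_homology_group p X) (relative_homology_group p X S)"
  by (rule iso_pair_trivial) (use assms in \<open>auto simp: acyclic_space_def topspace_subtopology\<close>)

lemma iso_boundary_acyclic_space:
  assumes "acyclic_space X" "topspace X \<inter> S \<noteq> {}"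
  shows "hom_boundary p X S
      \<in> iso (relative_homology_group p X S) (reduced_homology_group (p-1) (subtopology X S))"
  by (rule iso_boundary_trivial) (use assms in \<open>auto simp: acyclic_space_def\<close>)

lemma trivial_group_relative:
  assumes "topspace X \<inter> S \<noteq> {}" "trivial_group (reduced_homology_group p X)"
    "trivial_group (reduced_homology_group (p-1) (subtopology X S))"
  shows "trivial_group (relative_homology_group p X S)"
proof -
  let ?R = "relative_homology_group p X S"
  have 1: "exact_seq([reduced_homology_group(p - 1) (subtopology X S), ?R, reduced_homology_group p X],
                    [hom_boundary p X S, hom_induced p X {} X S id])"
    by (rule homology_exactness_reduced_1 [OF assms(1)])
  then have k: "kernel ?R (reduced_homology_group(p - 1) (subtopology X S)) (hom_boundary p X S)
     = hom_induced p X {} X S id ` carrier (reduced_homology_group p X)"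
    by simp
  have "hom_boundary p X S x = \<one>\<^bsub>reduced_homology_group(p - 1) (subtopology X S)\<^esub>"
    if "x \<in> carrier ?R" for x
    using assms(3) hom_boundary_reduced_hom that unfolding trivial_group_def hom_def by blast
  then have "carrier ?R = hom_induced p X {} X S id ` carrier (reduced_homology_group p X)"
    unfolding k [symmetric] by (auto simp: kernel_def)
  also have "\<dots> = {hom_induced p X {} X S id \<one>\<^bsub>reduced_homology_group p X\<^esub>}"
    using assms(2) by (auto simp: trivial_group_def)
  finally obtain c where "carrier ?R = {c}" by metis
  moreover have "\<one>\<^bsub>?R\<^esub> \<in> carrier ?R"
    by (metis group.is_monoid group_relative_homology_group monoid.one_closed)
  ultimately show ?thesis
    by (auto simp: trivial_group_def)
qed

text \<open>The intersection is nonempty so that the reduced exact sequences of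
  \<open>(X, U)\<close> and \<open>(V, U \<inter> V)\<close> are available.\<close>

locale open_cover =
  fixes X :: "'a topology" and U V :: "'a set"
  assumes openU: "openin X U" and openV: "openin X V" and cover: "topspace X = U \<union> V"
    and meet: "U \<inter> V \<noteq> {}"
begin

lemma sub_meet [simp]:
  "subtopology (subtopology X V) (U \<inter> V) = subtopology X (U \<inter> V)"
  "subtopology (subtopology X U) (U \<inter> V) = subtopology X (U \<inter> V)"
  by (simp_all add: subtopology_subtopology inf.commute Int_assoc inf.left_commute)

lemma excision:
  "hom_induced p (subtopology X V) (U \<inter> V) X U id
     \<in> iso (relative_homology_group p (subtopology X V) (U \<inter> V)) (relative_homology_group p X U)"
proof -
  \<comment> \<open>The excised set is the complement of \<open>V\<close>; it is closed and lies in
    \<open>U\<close>, which is its own interior.\<close>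
  have "closedin X (U - V)"
  proof -
    have "U - V = topspace X - V" using cover by auto
    then show ?thesis using openV by (simp add: closedin_diff openin_closedin_eq)
  qed
  then have "X closure_of (U - V) \<subseteq> X interior_of U"
    using openU by (simp add: closure_of_closedin interior_of_openin)
  from homology_excision_axiom [OF this, of "topspace X" p]
  have *: "hom_induced p (subtopology X (topspace X - (U - V))) (U - (U - V)) (subtopology X (topspace X)) U id
    \<in> iso (relative_homology_group p (subtopology X (topspace X - (U - V))) (U - (U - V)))
      (relative_homology_group p (subtopology X (topspace X)) U)"
    using cover by auto
  moreover have "topspace X - (U - V) = V" "U - (U - V) = U \<inter> V"
    using cover by auto
  ultimately show ?thesis by (simp add: subtopology_topspace)
qed

lemma nonempty_meet: "topspace (subtopology X V) \<inter> (U \<inter> V) \<noteq> {}" "topspace X \<inter> U \<noteq> {}"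
  using cover meet by auto

text \<open>An acyclic \<open>U\<close> counts as a point, so H(X) = H(X, U), and excision moves
  this to \<open>V\<close>: for homology, \<open>X\<close> is the cone of the inclusion of
  \<open>U \<inter> V\<close> into \<open>V\<close>. The next lemmas read off special cases of its
  exact sequence.\<close>

lemma iso_rel:
  assumes "acyclic_space (subtopology X U)"
  shows "reduced_homology_group p X \<cong> relative_homology_group p (subtopology X V) (U \<inter> V)"
  using iso_pair_acyclic_subspace [OF assms, of p] excision [of p]
  by (metis group.iso_sym group_relative_homology_group is_isoI iso_trans)

lemma suspension:
  assumes "acyclic_space (subtopology X U)" "acyclic_space (subtopology X V)"
  shows "reduced_homology_group p X \<cong> reduced_homology_group (p-1) (subtopology X (U \<inter> V))"
  using iso_rel [OF assms(1), of p] iso_boundary_acyclic_space [OF assms(2) nonempty_meet(1), of p]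
  by (metis is_isoI iso_trans sub_meet(1))

lemma suspension_trivial:
  assumes "acyclic_space (subtopology X U)" "trivial_group (reduced_homology_group p (subtopology X V))"
    "trivial_group (reduced_homology_group (p-1) (subtopology X V))"
  shows "reduced_homology_group p X \<cong> reduced_homology_group (p-1) (subtopology X (U \<inter> V))"
  using iso_rel [OF assms(1), of p] iso_boundary_trivial [OF nonempty_meet(1) assms(2,3)]
  by (metis is_isoI iso_trans sub_meet(1))

lemma trivial_cone:
  assumes "acyclic_space (subtopology X U)" "trivial_group (reduced_homology_group p (subtopology X V))"
    "trivial_group (reduced_homology_group (p-1) (subtopology X (U \<inter> V)))"
  shows "trivial_group (reduced_homology_group p X)"
  using iso_rel [OF assms(1), of p] trivial_group_relative [OF nonempty_meet(1) assms(2)] assms(3)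
  by (metis group_reduced_homology_group group_relative_homology_group isomorphic_group_triviality sub_meet(1))

lemma acyclic_union:
  assumes "acyclic_space (subtopology X U)" "acyclic_space (subtopology X V)" "acyclic_space (subtopology X (U \<inter> V))"
  shows "acyclic_space X"
  using assms trivial_cone meet cover unfolding acyclic_space_def by auto

lemma inclusion_compose:
  "hom_induced p X {} X U id (hom_induced p (subtopology X V) {} X {} id x) =
   hom_induced p (subtopology X V) (U \<inter> V) X U id
     (hom_induced p (subtopology X V) {} (subtopology X V) (U \<inter> V) id x)"
  by (simp add: hom_induced_compose')

end

text \<open>Two out of three for isomorphisms. This lemma and the next identify a map through a
  commutative triangle, without inverses.\<close>

lemma iso_cancel_left:
  assumes "t \<in> iso B C" "f \<in> hom A B" "g \<in> iso A C" "\<And>x. x \<in> carrier A \<Longrightarrow> t (f x) = g x"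
  shows "f \<in> iso A B"
proof -
  have "bij_betw t (carrier B) (carrier C)" "bij_betw g (carrier A) (carrier C)"
    "f ` carrier A \<subseteq> carrier B"
    using assms by (auto simp: iso_def hom_def)
  then have "bij_betw f (carrier A) (carrier B)"
    using assms(4) unfolding bij_betw_def inj_on_def
    by (smt (verit, del_insts) image_iff image_subset_iff subsetI subset_antisym)
  then show ?thesis using assms(2) by (simp add: iso_def)
qed

lemma iso_cancel_right:
  assumes "f \<in> iso A B" "t \<in> hom B C" "g \<in> iso A C" "\<And>x. x \<in> carrier A \<Longrightarrow> t (f x) = g x"
  shows "t \<in> iso B C"
proof -
  have "bij_betw f (carrier A) (carrier B)" "bij_betw g (carrier A) (carrier C)"
    using assms by (auto simp: iso_def)
  then have "bij_betw t (carrier B) (carrier C)"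
    using assms(4) unfolding bij_betw_def inj_on_def
    by (smt (verit, del_insts) image_iff image_cong image_image)
  then show ?thesis using assms(2) by (simp add: iso_def)
qed

context open_cover begin

text \<open>Passing to \<open>(X, U)\<close> turns the inclusion into the map from \<open>V\<close>
  to \<open>(V, U \<inter> V)\<close> followed by excision; the former is bijective because the
  intersection has no homology in the two adjacent degrees.\<close>

lemma inclusion_iso:
  assumes "acyclic_space (subtopology X U)" "trivial_group (reduced_homology_group p (subtopology X (U \<inter> V)))"
    "trivial_group (reduced_homology_group (p-1) (subtopology X (U \<inter> V)))"
  shows "hom_induced p (subtopology X V) {} X {} id
     \<in> iso (reduced_homology_group p (subtopology X V)) (reduced_homology_group p X)"
proof (rule iso_cancel_left)
  show "hom_induced p X {} X U id \<in> iso (reduced_homology_group p X) (relative_homology_group p X U)"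
    by (rule iso_pair_acyclic_subspace [OF assms(1)])
  show "hom_induced p (subtopology X V) {} X {} id
    \<in> hom (reduced_homology_group p (subtopology X V)) (reduced_homology_group p X)"
    by (rule hom_induced_reduced_hom)
  show "hom_induced p (subtopology X V) (U \<inter> V) X U id \<circ>
     hom_induced p (subtopology X V) {} (subtopology X V) (U \<inter> V) id
     \<in> iso (reduced_homology_group p (subtopology X V)) (relative_homology_group p X U)"
    by (rule iso_set_trans [OF iso_pair_trivial excision])
       (use assms nonempty_meet in auto)
qed (simp add: inclusion_compose)

end

section \<open>Self-maps acting as -1 on homology\<close>

lemma hom_induced_inv:
  "x \<in> carrier (relative_homology_group p X S) \<Longrightarrow>
   hom_induced p X S Y T f (inv\<^bsub>relative_homology_group p X S\<^esub> x)
   = inv\<^bsub>relative_homology_group p Y T\<^esub> (hom_induced p X S Y T f x)"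
  by (meson group_hom.hom_inv group_hom.intro group_hom_axioms.intro group_relative_homology_group hom_induced_hom)

lemma hom_boundary_inv:
  "x \<in> carrier (relative_homology_group p X S) \<Longrightarrow>
   hom_boundary p X S (inv\<^bsub>relative_homology_group p X S\<^esub> x)
   = inv\<^bsub>homology_group (p-1) (subtopology X S)\<^esub> (hom_boundary p X S x)"
  by (meson group_hom.hom_inv group_hom.intro group_hom_axioms.intro group_relative_homology_group hom_boundary_hom)

text \<open>Only positive degrees occur below, where this group coincides with the reduced
  one.\<close>

definition acts_as_minus_one :: "int \<Rightarrow> 'a topology \<Rightarrow> ('a \<Rightarrow> 'a) \<Rightarrow> bool" where
  "acts_as_minus_one p X s \<longleftrightarrow>
     (\<forall>x \<in> carrier (homology_group p X).
        hom_induced p X {} X {} s x = inv\<^bsub>homology_group p X\<^esub> x)"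

lemma iso_inj: "f \<in> iso A B \<Longrightarrow> x \<in> carrier A \<Longrightarrow> y \<in> carrier A \<Longrightarrow> f x = f y \<Longrightarrow> x = y"
  by (auto simp: iso_def bij_betw_def inj_on_def)

lemma iso_surj: "f \<in> iso A B \<Longrightarrow> y \<in> carrier B \<Longrightarrow> \<exists>x \<in> carrier A. f x = y"
  by (force simp: iso_def bij_betw_def)

lemma minus_one_transfer:
  assumes "continuous_map X X s" "continuous_map Y Y t" "continuous_map X Y f"
    and fs: "\<And>x. x \<in> topspace X \<Longrightarrow> f (s x) = t (f x)"
    and f: "inj_on (hom_induced p X {} Y {} f) (carrier (homology_group p X))"
    and t: "acts_as_minus_one p Y t"
  shows "acts_as_minus_one p X s"
  unfolding acts_as_minus_one_def
proof
  fix x assume x: "x \<in> carrier (homology_group p X)"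
  let ?f = "hom_induced p X {} Y {} f"
  have "?f (hom_induced p X {} X {} s x) = hom_induced p X {} Y {} (f \<circ> s) x"
    using assms by (simp add: hom_induced_compose')
  also have "\<dots> = hom_induced p X {} Y {} (t \<circ> f) x"
    by (rule fun_cong [OF hom_induced_eq]) (simp add: fs)
  also have "\<dots> = hom_induced p Y {} Y {} t (?f x)"
    using assms by (simp add: hom_induced_compose')
  also have "\<dots> = ?f (inv\<^bsub>homology_group p X\<^esub> x)"
    using t x by (simp add: acts_as_minus_one_def hom_induced_carrier hom_induced_inv)
  finally show "hom_induced p X {} X {} s x = inv\<^bsub>homology_group p X\<^esub> x"
    using f x by (meson group.inv_closed group_relative_homology_group hom_induced_carrier inj_onD)
qed

context open_cover begin

text \<open>The isomorphisms H_p(X) = H_p(X, U) = H_p(V, D) = H_{p-1}(D), with D the intersection,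
  are natural for a map that preserves both members, so the sign on D is the sign on
  \<open>X\<close>. The bound on \<open>p\<close> keeps both degrees positive.\<close>

lemma minus_one_suspension:
  assumes "acyclic_space (subtopology X U)" "acyclic_space (subtopology X V)" and p: "p \<ge> 2"
    and s: "continuous_map X X s" "s \<in> U \<rightarrow> U" "s \<in> V \<rightarrow> V"
    and m: "acts_as_minus_one (p-1) (subtopology X (U \<inter> V)) s"
  shows "acts_as_minus_one p X s"
  unfolding acts_as_minus_one_def
proof
  fix z assume z: "z \<in> carrier (homology_group p X)"
  let ?V = "subtopology X V" and ?D = "U \<inter> V"
  let ?j = "hom_induced p X {} X U id" and ?e = "hom_induced p ?V ?D X U id"
  have j: "?j \<in> iso (homology_group p X) (relative_homology_group p X U)"
    using iso_pair_acyclic_subspace [OF assms(1), of p] p by (simp add: un_reduced_homology_group)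
  have d: "hom_boundary p ?V ?D \<in> iso (relative_homology_group p ?V ?D) (homology_group (p-1) (subtopology X ?D))"
    using iso_boundary_acyclic_space [OF assms(2) nonempty_meet(1), of p] p
    by (simp add: un_reduced_homology_group)
  obtain x where x: "x \<in> carrier (relative_homology_group p ?V ?D)" "?e x = ?j z"
    using iso_surj [OF excision [of p]] hom_induced_carrier by metis
  let ?sx = "hom_induced p ?V ?D ?V ?D s x"
  have sV: "continuous_map ?V ?V s"
    using s by (simp add: continuous_map_in_subtopology continuous_map_from_subtopology Pi_iff)
  have sD: "s \<in> ?D \<rightarrow> ?D" using s by auto
  have "hom_boundary p ?V ?D ?sx = hom_induced (p-1) (subtopology ?V ?D) {} (subtopology ?V ?D) {} s (hom_boundary p ?V ?D x)"
    using naturality_hom_induced [OF sV sD, of p] by (metis comp_apply)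
  also have "\<dots> = inv\<^bsub>homology_group (p-1) (subtopology X ?D)\<^esub> (hom_boundary p ?V ?D x)"
    using m unfolding acts_as_minus_one_def sub_meet by (metis hom_boundary_carrier sub_meet(1))
  also have "\<dots> = hom_boundary p ?V ?D (inv\<^bsub>relative_homology_group p ?V ?D\<^esub> x)"
    using hom_boundary_inv [OF x(1)] by simp
  finally have sx: "?sx = inv\<^bsub>relative_homology_group p ?V ?D\<^esub> x"
    using iso_inj [OF d] by (simp add: hom_induced_carrier x)
  have "?j (hom_induced p X {} X {} s z) = hom_induced p X {} X U s z"
    using s by (simp add: hom_induced_compose')
  also have "\<dots> = hom_induced p X U X U s (?j z)"
    using s by (simp add: hom_induced_compose')
  also have "\<dots> = hom_induced p ?V ?D X U s x"
    unfolding x(2) [symmetric] using s by (simp add: hom_induced_compose' Pi_iff)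
  also have "\<dots> = ?e ?sx"
    using s sV sD by (subst hom_induced_compose') auto
  also have "\<dots> = ?j (inv\<^bsub>homology_group p X\<^esub> z)"
    using x z by (simp add: sx hom_induced_inv)
  finally show "hom_induced p X {} X {} s z = inv\<^bsub>homology_group p X\<^esub> z"
    using iso_inj [OF j] z by (simp add: hom_induced_carrier)
qed

text \<open>A Mayer-Vietoris splitting of \<open>z\<close>, read modulo the intersection. Excision
  supplies \<open>x\<close>; the difference of \<open>z\<close> and \<open>x\<close> dies in
  \<open>(X, U)\<close>, hence comes from \<open>(U, U \<inter> V)\<close> by the exact sequence of
  the triple. The boundaries cancel because an absolute class has trivial boundary.\<close>

lemma decompose:
  fixes p z
  defines "B \<equiv> homology_group (p-1) (subtopology X (U \<inter> V))"
  assumes z: "z \<in> carrier (homology_group p X)"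
  obtains x y where "x \<in> carrier (relative_homology_group p (subtopology X V) (U \<inter> V))"
    "y \<in> carrier (relative_homology_group p (subtopology X U) (U \<inter> V))"
    "hom_induced p X {} X (U \<inter> V) id z =
       hom_induced p (subtopology X V) (U \<inter> V) X (U \<inter> V) id x
       \<otimes>\<^bsub>relative_homology_group p X (U \<inter> V)\<^esub> hom_induced p (subtopology X U) (U \<inter> V) X (U \<inter> V) id y"
    "hom_boundary p (subtopology X U) (U \<inter> V) y = inv\<^bsub>B\<^esub> (hom_boundary p (subtopology X V) (U \<inter> V) x)"
    "hom_induced p (subtopology X V) (U \<inter> V) X U id x = hom_induced p X {} X U id z"
proof -
  let ?D = "U \<inter> V"
  let ?R = "relative_homology_group p X ?D"
  let ?RV = "relative_homology_group p (subtopology X V) ?D"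
  let ?RU = "relative_homology_group p (subtopology X U) ?D"
  let ?j = "hom_induced p X {} X ?D id z"
  let ?kV = "hom_induced p (subtopology X V) ?D X ?D id"
  let ?kU = "hom_induced p (subtopology X U) ?D X ?D id"
  let ?m = "hom_induced p X ?D X U id"
  interpret R: comm_group ?R by (rule abelian_relative_homology_group)
  interpret B: comm_group B unfolding B_def by (rule abelian_relative_homology_group)
  interpret m: group_hom ?R "relative_homology_group p X U" ?m
    by (simp add: group_hom_def group_hom_axioms_def hom_induced_hom)
  obtain x where x: "x \<in> carrier ?RV"
    "hom_induced p (subtopology X V) ?D X U id x = hom_induced p X {} X U id z"
    using iso_surj [OF excision [of p]] hom_induced_carrier by metis
  have c: "?j \<in> carrier ?R" "?kV x \<in> carrier ?R" by (simp_all add: hom_induced_carrier)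
  have "?m ?j = hom_induced p X {} X U id z" by (simp add: hom_induced_compose')
  moreover have "?m (?kV x) = hom_induced p X {} X U id z"
    using x by (simp add: hom_induced_compose')
  ultimately have "?m (inv\<^bsub>?R\<^esub> (?kV x) \<otimes>\<^bsub>?R\<^esub> ?j) = \<one>\<^bsub>relative_homology_group p X U\<^esub>"
    using c by (simp add: m.H.l_inv hom_induced_carrier)
  then have "inv\<^bsub>?R\<^esub> (?kV x) \<otimes>\<^bsub>?R\<^esub> ?j \<in> kernel ?R (relative_homology_group p X U) ?m"
    using c by (simp add: kernel_def)
  moreover have "kernel ?R (relative_homology_group p X U) ?m = ?kU ` carrier ?RU"
    using homology_exactness_triple_3 [of "?D" U p X] by simp
  ultimately obtain y where y: "y \<in> carrier ?RU" "?kU y = inv\<^bsub>?R\<^esub> (?kV x) \<otimes>\<^bsub>?R\<^esub> ?j"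
    by auto
  have jeq: "?j = ?kV x \<otimes>\<^bsub>?R\<^esub> ?kU y"
    unfolding y(2) using c by (simp add: R.m_assoc [symmetric])
  \<comment> \<open>Boundaries taken in \<open>U\<close> or \<open>V\<close> and boundaries taken in
    \<open>X\<close> land in the same group; naturality along the inclusion identifies them.\<close>
  have bnat: "hom_boundary p X ?D (hom_induced p (subtopology X W) ?D X ?D id w) =
      hom_boundary p (subtopology X W) ?D w" if "W = U \<or> W = V" for W w
  proof -
    have "subtopology (subtopology X W) ?D = subtopology X ?D" using that sub_meet by auto
    then have "hom_boundary p X ?D (hom_induced p (subtopology X W) ?D X ?D id w) =
      hom_induced (p-1) (subtopology X ?D) {} (subtopology X ?D) {} id (hom_boundary p (subtopology X W) ?D w)"
      using naturality_hom_induced [of "subtopology X W" X id ?D ?D p] by (auto simp: fun_eq_iff)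
    also have "\<dots> = hom_boundary p (subtopology X W) ?D w"
      using that sub_meet by (metis hom_boundary_carrier hom_induced_id)
    finally show ?thesis .
  qed
  have "hom_boundary p X ?D ?j = \<one>\<^bsub>B\<^esub>"
  proof -
    have "?j \<in> hom_induced p X {} X ?D id ` carrier (homology_group p X)" using z by auto
    then have "?j \<in> kernel ?R B (hom_boundary p X ?D)"
      using homology_exactness_axiom_1 [of p X ?D] unfolding B_def by simp
    then show ?thesis by (simp add: kernel_def)
  qed
  moreover have "hom_boundary p X ?D (?kV x \<otimes>\<^bsub>?R\<^esub> ?kU y)
    = hom_boundary p (subtopology X V) ?D x \<otimes>\<^bsub>B\<^esub> hom_boundary p (subtopology X U) ?D y"
    using hom_mult [OF hom_boundary_hom [of p X ?D]] bnat [of V x] bnat [of U y] unfolding B_def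
    by (simp add: hom_induced_carrier)
  moreover have "hom_boundary p (subtopology X V) ?D x \<in> carrier B" "hom_boundary p (subtopology X U) ?D y \<in> carrier B"
    unfolding B_def by (metis hom_boundary_carrier sub_meet)+
  ultimately have "hom_boundary p (subtopology X U) ?D y = inv\<^bsub>B\<^esub> (hom_boundary p (subtopology X V) ?D x)"
    using jeq by (metis B.inv_unique' B.m_comm)
  then show ?thesis by (rule that [OF x(1) y(1) jeq _ x(2)])
qed

text \<open>The halves \<open>x\<close> and \<open>y\<close> of \<open>z\<close> change places. The
  image of \<open>y\<close> lies over \<open>V\<close> and keeps its boundary, the negative of that
  of \<open>x\<close>; so it is the inverse of \<open>x\<close>. The image of \<open>x\<close> lies
  in \<open>U\<close> and vanishes in \<open>(X, U)\<close>, where the classes of \<open>X\<close>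
  are detected.\<close>

lemma minus_one_swap:
  assumes "acyclic_space (subtopology X U)" "acyclic_space (subtopology X V)" and p: "p \<ge> 2"
    and s: "continuous_map X X s" "s \<in> U \<rightarrow> V" "s \<in> V \<rightarrow> U"
    and m: "\<And>x. x \<in> carrier (homology_group (p-1) (subtopology X (U \<inter> V))) \<Longrightarrow>
       hom_induced (p-1) (subtopology X (U \<inter> V)) {} (subtopology X (U \<inter> V)) {} s x = x"
  shows "acts_as_minus_one p X s"
  unfolding acts_as_minus_one_def
proof
  fix z assume z: "z \<in> carrier (homology_group p X)"
  let ?V = "subtopology X V" and ?U = "subtopology X U" and ?D = "U \<inter> V"
  let ?R = "relative_homology_group p X ?D"
  let ?j = "hom_induced p X {} X U id" and ?e = "hom_induced p ?V ?D X U id"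
  have j: "?j \<in> iso (homology_group p X) (relative_homology_group p X U)"
    using iso_pair_acyclic_subspace [OF assms(1), of p] p by (simp add: un_reduced_homology_group)
  have d: "hom_boundary p ?V ?D \<in> iso (relative_homology_group p ?V ?D) (homology_group (p-1) (subtopology X ?D))"
    using iso_boundary_acyclic_space [OF assms(2) nonempty_meet(1), of p] p
    by (simp add: un_reduced_homology_group)
  obtain x y where x: "x \<in> carrier (relative_homology_group p ?V ?D)"
    and y: "y \<in> carrier (relative_homology_group p ?U ?D)"
    and xy: "hom_induced p X {} X ?D id z =
       hom_induced p ?V ?D X ?D id x \<otimes>\<^bsub>?R\<^esub> hom_induced p ?U ?D X ?D id y"
    "hom_boundary p ?U ?D y = inv\<^bsub>homology_group (p-1) (subtopology X ?D)\<^esub> (hom_boundary p ?V ?D x)"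
    "?e x = ?j z"
    by (rule decompose [OF z])
  let ?sy = "hom_induced p ?U ?D ?V ?D s y"
  have sV: "continuous_map ?U ?V s" "continuous_map ?V ?U s"
    using s by (simp_all add: continuous_map_in_subtopology continuous_map_from_subtopology Pi_iff)
  have sD: "s \<in> ?D \<rightarrow> ?D" using s by auto
  have "hom_boundary p ?V ?D ?sy = hom_induced (p-1) (subtopology ?U ?D) {} (subtopology ?V ?D) {} s (hom_boundary p ?U ?D y)"
    using naturality_hom_induced [OF sV(1) sD, of p] by (metis comp_apply)
  also have "\<dots> = hom_boundary p ?U ?D y"
    using m unfolding sub_meet by (metis hom_boundary_carrier sub_meet(2))
  also have "\<dots> = hom_boundary p ?V ?D (inv\<^bsub>relative_homology_group p ?V ?D\<^esub> x)"
    using hom_boundary_inv [OF x] xy by simp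
  finally have sy: "?sy = inv\<^bsub>relative_homology_group p ?V ?D\<^esub> x"
    using iso_inj [OF d] by (simp add: hom_induced_carrier x)
  let ?sU = "hom_induced p X ?D X U s"
  have "?j (hom_induced p X {} X {} s z) = hom_induced p X {} X U s z"
    using s by (simp add: hom_induced_compose')
  also have "\<dots> = ?sU (hom_induced p X {} X ?D id z)"
    using s sD by (subst hom_induced_compose') auto
  also have "\<dots> = ?sU (hom_induced p ?V ?D X ?D id x)
      \<otimes>\<^bsub>relative_homology_group p X U\<^esub> ?sU (hom_induced p ?U ?D X ?D id y)"
    unfolding xy(1) by (rule hom_mult [OF hom_induced_hom]) (simp_all add: hom_induced_carrier)
  \<comment> \<open>This class factors through the pair \<open>(U, U)\<close>, whose homology is
    trivial.\<close>
  also have "?sU (hom_induced p ?V ?D X ?D id x) = \<one>\<^bsub>relative_homology_group p X U\<^esub>"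
  proof -
    have "?sU (hom_induced p ?V ?D X ?D id x) = hom_induced p ?V ?D X U s x"
      using s sD by (subst hom_induced_compose') auto
    also have "\<dots> = hom_induced p ?U U X U id (hom_induced p ?V ?D ?U U s x)"
      using s sV sD by (subst hom_induced_compose') auto
    also have "\<dots> = \<one>\<^bsub>relative_homology_group p X U\<^esub>"
    proof -
      have "trivial_group (relative_homology_group p ?U U)"
        by (metis cover inf.absorb_iff2 inf_commute subtopology_topspace sup_ge1
            topspace_subtopology trivial_relative_homology_group_topspace)
      then have "hom_induced p ?V ?D ?U U s x = \<one>\<^bsub>relative_homology_group p ?U U\<^esub>"
        by (metis hom_induced_carrier singletonD trivial_group_def)
      then show ?thesis
        by (simp add: hom_one [OF hom_induced_hom])
    qed
    finally show ?thesis .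
  qed
  also have "\<one>\<^bsub>relative_homology_group p X U\<^esub> \<otimes>\<^bsub>relative_homology_group p X U\<^esub> ?sU (hom_induced p ?U ?D X ?D id y)
      = ?sU (hom_induced p ?U ?D X ?D id y)"
    by (metis (no_types, lifting) group.is_monoid group_relative_homology_group hom_induced_carrier monoid.l_one)
  also have "\<dots> = hom_induced p ?U ?D X U s y"
    using s sD by (subst hom_induced_compose') auto
  also have "\<dots> = ?e ?sy"
    using s sV sD by (subst hom_induced_compose') auto
  also have "\<dots> = ?j (inv\<^bsub>homology_group p X\<^esub> z)"
    using x z xy by (simp add: sy hom_induced_inv)
  finally show "hom_induced p X {} X {} s z = inv\<^bsub>homology_group p X\<^esub> z"
    by (rule iso_inj [OF j hom_induced_carrier, rotated]) (simp add: z)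
qed

text \<open>A cycle of \<^term>\<open>X\<close> splits into a chain in \<^term>\<open>V\<close> and one in \<^term>\<open>U\<close> with opposite
  boundaries.  As \<^term>\<open>s\<close> reverses the sign of the boundary, the second one is the mirror image of
  the first, and both contribute the same class to \<^term>\<open>(Y, Z)\<close>.\<close>

lemma doubling:
  assumes "acyclic_space (subtopology X U)" "acyclic_space (subtopology X V)" and p: "p \<ge> 2"
    and s: "continuous_map X X s" "s \<in> V \<rightarrow> U" "s \<in> U \<inter> V \<rightarrow> U \<inter> V"
    and m: "acts_as_minus_one (p-1) (subtopology X (U \<inter> V)) s"
    and Y: "continuous_map X Y id" "U \<inter> V \<subseteq> Z"
    and sY: "hom_induced p X (U \<inter> V) Y Z s = hom_induced p X (U \<inter> V) Y Z id"
    and phi: "hom_induced p (subtopology X V) (U \<inter> V) Y Z id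
       \<in> iso (relative_homology_group p (subtopology X V) (U \<inter> V)) (relative_homology_group p Y Z)"
  shows "(\<lambda>z. hom_induced p Y {} Y Z id (hom_induced p X {} Y {} id z)) ` carrier (homology_group p X)
    = (\<lambda>y. y \<otimes>\<^bsub>relative_homology_group p Y Z\<^esub> y) ` carrier (relative_homology_group p Y Z)"
proof -
  let ?V = "subtopology X V" and ?U = "subtopology X U" and ?D = "U \<inter> V"
  let ?R = "relative_homology_group p X ?D" and ?Y = "relative_homology_group p Y Z"
  let ?j = "hom_induced p X {} X U id" and ?e = "hom_induced p ?V ?D X U id"
  let ?phi = "hom_induced p ?V ?D Y Z id"
  let ?f = "\<lambda>z. hom_induced p Y {} Y Z id (hom_induced p X {} Y {} id z)"
  have j: "?j \<in> iso (homology_group p X) (relative_homology_group p X U)"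
    using iso_pair_acyclic_subspace [OF assms(1), of p] p by (simp add: un_reduced_homology_group)
  have d: "hom_boundary p ?U ?D \<in> iso (relative_homology_group p ?U ?D) (homology_group (p-1) (subtopology X ?D))"
    using iso_boundary_acyclic_space [OF assms(1), of ?D p] nonempty_meet cover meet p
    by (simp add: un_reduced_homology_group)
  have sV: "continuous_map ?V ?U s"
    using s by (simp_all add: continuous_map_in_subtopology continuous_map_from_subtopology Pi_iff)
  have sX: "continuous_map ?V X s" using s by (simp add: continuous_map_from_subtopology)
  have iY: "continuous_map ?V Y id" "continuous_map ?U Y id"
    using Y(1) by (simp_all add: continuous_map_from_subtopology)
  have key: "?f z = ?phi x \<otimes>\<^bsub>?Y\<^esub> ?phi x"
    if z: "z \<in> carrier (homology_group p X)" and x: "x \<in> carrier (relative_homology_group p ?V ?D)"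
      and ex: "?e x = ?j z" for z x
  proof -
    obtain x' y where x': "x' \<in> carrier (relative_homology_group p ?V ?D)"
      and y: "y \<in> carrier (relative_homology_group p ?U ?D)"
      and xy: "hom_induced p X {} X ?D id z =
         hom_induced p ?V ?D X ?D id x' \<otimes>\<^bsub>?R\<^esub> hom_induced p ?U ?D X ?D id y"
      "hom_boundary p ?U ?D y = inv\<^bsub>homology_group (p-1) (subtopology X ?D)\<^esub> (hom_boundary p ?V ?D x')"
      "?e x' = ?j z"
      by (rule decompose [OF z])
    \<comment> \<open>Excision is injective, so the splitting uses the prescribed \<open>x\<close>.
      This matters for the second inclusion, where \<open>x\<close> comes first and \<open>z\<close>
      is built from it.\<close>
    have "x' = x" using iso_inj [OF excision] x x' ex xy(3) by metis
    let ?sx = "hom_induced p ?V ?D ?U ?D s x"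
    have "hom_boundary p ?U ?D ?sx = hom_induced (p-1) (subtopology ?V ?D) {} (subtopology ?U ?D) {} s (hom_boundary p ?V ?D x)"
      using naturality_hom_induced [OF sV s(3), of p] by (metis comp_apply)
    also have "\<dots> = hom_boundary p ?U ?D y"
      using m xy(2) \<open>x' = x\<close> unfolding acts_as_minus_one_def sub_meet by (metis hom_boundary_carrier sub_meet(1))
    finally have sx: "?sx = y"
      using iso_inj [OF d] by (simp add: hom_induced_carrier y)
    let ?i = "hom_induced p X ?D Y Z id"
    have "?f z = ?i (hom_induced p X {} X ?D id z)"
      using Y by (subst (1 2) hom_induced_compose') auto
    also have "\<dots> = ?i (hom_induced p ?V ?D X ?D id x) \<otimes>\<^bsub>?Y\<^esub> ?i (hom_induced p ?U ?D X ?D id y)"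
      unfolding xy(1) \<open>x' = x\<close> by (rule hom_mult [OF hom_induced_hom]) (simp_all add: hom_induced_carrier)
    also have "?i (hom_induced p ?V ?D X ?D id x) = ?phi x"
      using Y by (subst hom_induced_compose') auto
    also have "?i (hom_induced p ?U ?D X ?D id y) = hom_induced p ?V ?D Y Z s x"
      unfolding sx [symmetric] using Y s sV sX iY by (subst (1 2) hom_induced_compose') auto
    also have "\<dots> = hom_induced p X ?D Y Z s (hom_induced p ?V ?D X ?D id x)"
      using Y s continuous_map_compose [OF s(1) Y(1)] by (subst hom_induced_compose') auto
    also have "\<dots> = ?phi x"
      unfolding sY using Y by (subst hom_induced_compose') auto
    finally show ?thesis .
  qed
  show ?thesis
  proof safe
    fix z assume z: "z \<in> carrier (homology_group p X)"
    obtain x where "x \<in> carrier (relative_homology_group p ?V ?D)" "?e x = ?j z"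
      using iso_surj [OF excision [of p]] hom_induced_carrier by metis
    from key [OF z this] show "?f z \<in> (\<lambda>y. y \<otimes>\<^bsub>?Y\<^esub> y) ` carrier ?Y"
      by (simp add: hom_induced_carrier)
  next
    fix y assume "y \<in> carrier ?Y"
    then obtain x where x: "x \<in> carrier (relative_homology_group p ?V ?D)" "?phi x = y"
      using iso_surj [OF phi] by metis
    obtain z where z: "z \<in> carrier (homology_group p X)" "?j z = ?e x"
      using iso_surj [OF j] hom_induced_carrier by metis
    show "y \<otimes>\<^bsub>?Y\<^esub> y \<in> ?f ` carrier (homology_group p X)"
      using key [OF z(1) x(1)] z x(2) by (metis image_eqI)
  qed
qed

end

section \<open>Orbits of the rotation group on quadruples of vectors\<close>

text \<open>An orthogonal map preserves cross products exactly when its determinant is 1, so this is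
  \<open>SO(3)\<close>, in a form that makes the equivariance of \<open>cross3\<close>
  immediate.\<close>

definition rot3 :: "(real^3 \<Rightarrow> real^3) set" where
  "rot3 = {f. orthogonal_transformation f \<and> (\<forall>x y. f (cross3 x y) = cross3 (f x) (f y))}"

lemma rot3_id: "id \<in> rot3"
  by (simp add: rot3_def id_def orthogonal_transformation_id)

lemma rot3_comp: "f \<in> rot3 \<Longrightarrow> g \<in> rot3 \<Longrightarrow> f \<circ> g \<in> rot3"
  by (simp add: rot3_def orthogonal_transformation_compose)

lemma rot3_inv:
  assumes "f \<in> rot3" shows "inv_into UNIV f \<in> rot3" "inv_into UNIV f (f x) = x" "f (inv_into UNIV f x) = x"
proof -
  have f: "orthogonal_transformation f" and b: "bij f"
    using assms orthogonal_transformation_bij by (auto simp: rot3_def)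
  show *: "inv_into UNIV f (f x) = x" "f (inv_into UNIV f x) = x" for x
    using b by (simp_all add: bij_is_inj bij_is_surj surj_f_inv_f)
  have "inv_into UNIV f (cross3 x y) = cross3 (inv_into UNIV f x) (inv_into UNIV f y)" for x y
    by (metis (mono_tags, lifting) * assms mem_Collect_eq rot3_def)
  then show "inv_into UNIV f \<in> rot3"
    using f by (simp add: rot3_def orthogonal_transformation_inv)
qed

lemma rot3_simps:
  assumes "f \<in> rot3"
  shows "f (x + y) = f x + f y" "f (x - y) = f x - f y" "f (r *\<^sub>R x) = r *\<^sub>R f x" "f 0 = 0" "f (- x) = - f x"
    "f x \<bullet> f y = x \<bullet> y" "norm (f x) = norm x" "f (cross3 x y) = cross3 (f x) (f y)"
    "f x = 0 \<longleftrightarrow> x = 0"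
proof -
  have *: "orthogonal_transformation f" "linear f"
    using assms by (auto simp: rot3_def orthogonal_transformation_def)
  show "f (x + y) = f x + f y" "f (x - y) = f x - f y" "f (r *\<^sub>R x) = r *\<^sub>R f x" "f 0 = 0" "f (- x) = - f x"
    using * by (simp_all add: linear_add linear_diff linear_cmul linear_0 linear_neg)
  show "f x \<bullet> f y = x \<bullet> y" "norm (f x) = norm x"
    using * by (auto simp: orthogonal_transformation_def orthogonal_transformation_norm)
  then show "f x = 0 \<longleftrightarrow> x = 0"
    using \<open>f 0 = 0\<close> orthogonal_transformation_norm[OF *(1), of x] by (metis norm_eq_zero)
  show "f (cross3 x y) = cross3 (f x) (f y)"
    using assms by (simp add: rot3_def)
qed

abbreviation e1 :: "real^3" where "e1 \<equiv> axis 1 1"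
abbreviation e2 :: "real^3" where "e2 \<equiv> axis 2 1"
abbreviation e3 :: "real^3" where "e3 \<equiv> axis 3 1"

lemma basis3: "x = x$1 *\<^sub>R e1 + x$2 *\<^sub>R e2 + x$3 *\<^sub>R e3" for x :: "real^3"
  by (simp add: vec_eq_iff axis_def forall_3)

lemma basis3_inner [simp]:
  "e1 \<bullet> e1 = 1" "e2 \<bullet> e2 = 1" "e3 \<bullet> e3 = 1" "e1 \<bullet> e2 = 0" "e1 \<bullet> e3 = 0" "e2 \<bullet> e1 = 0"
  "e2 \<bullet> e3 = 0" "e3 \<bullet> e1 = 0" "e3 \<bullet> e2 = 0"
  by (simp_all add: inner_axis_axis)

text \<open>The linear map with columns \<open>u\<close>, \<open>v\<close>,
  \<open>cross3 u v\<close> is a rotation: the inner products and the cross products of these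
  columns are those of the standard basis.\<close>

lemma rot3_to_frame:
  assumes "norm u = 1" "norm v = 1" "u \<bullet> v = 0"
  obtains g where "g \<in> rot3" "g e1 = u" "g e2 = v" "g e3 = cross3 u v"
proof -
  define w where "w = cross3 u v"
  define g where "g x = x$1 *\<^sub>R u + x$2 *\<^sub>R v + x$3 *\<^sub>R w" for x :: "real^3"
  have uv: "u \<bullet> u = 1" "v \<bullet> v = 1" "v \<bullet> u = 0"
    using assms by (simp_all add: dot_square_norm inner_commute)
  have w: "u \<bullet> w = 0" "w \<bullet> u = 0" "v \<bullet> w = 0" "w \<bullet> v = 0"
    by (simp_all add: w_def dot_cross_self)
  have "w \<bullet> w = 1" using uv assms by (simp add: w_def dot_cross)
  have vw: "cross3 v w = u" "cross3 w u = v"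
    using uv assms by (simp_all add: w_def Lagrange cross_skew [of "cross3 u v"])
  have vw': "cross3 w v = - u" "cross3 u w = - v" "cross3 v u = - w" "cross3 u v = w"
    using vw by (metis cross_skew, metis cross_skew, metis cross_skew w_def, simp add: w_def)
  have "linear g"
    by (rule linearI) (simp_all add: g_def algebra_simps)
  moreover have "g x \<bullet> g y = x \<bullet> y" for x y
  proof -
    have "x \<bullet> y = x$1 * y$1 + x$2 * y$2 + x$3 * y$3" by (simp add: inner_vec_def sum_3)
    then show ?thesis
      using uv w \<open>w \<bullet> w = 1\<close> assms(3) by (simp add: g_def inner_add_left inner_add_right)
  qed
  moreover have "g (cross3 x y) = cross3 (g x) (g y)" for x y
    by (simp add: g_def cross_components cross_add_left cross_add_right cross_mult_left
        cross_mult_right vw vw') (simp add: algebra_simps)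
  ultimately have "g \<in> rot3" by (simp add: rot3_def orthogonal_transformation_def)
  moreover have "g e1 = u" "g e2 = v" "g e3 = w" by (simp_all add: g_def axis_def)
  ultimately show thesis using that w_def by simp
qed

lemma rot3_from_frame:
  assumes "norm u = 1" "norm v = 1" "u \<bullet> v = 0"
  obtains f where "f \<in> rot3" "f u = e1" "f v = e2" "f (cross3 u v) = e3"
    "\<And>x. f x = vector [x \<bullet> u, x \<bullet> v, x \<bullet> cross3 u v]"
proof -
  obtain g where g: "g \<in> rot3" "g e1 = u" "g e2 = v" "g e3 = cross3 u v"
    by (rule rot3_to_frame [OF assms])
  have *: "inv_into UNIV g u = e1" "inv_into UNIV g v = e2" "inv_into UNIV g (cross3 u v) = e3"
    using rot3_inv(2) [OF g(1)] g by metis+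
  have "inv_into UNIV g x = vector [x \<bullet> u, x \<bullet> v, x \<bullet> cross3 u v]" for x
  proof -
    have "inv_into UNIV g x \<bullet> e1 = x \<bullet> u" "inv_into UNIV g x \<bullet> e2 = x \<bullet> v" "inv_into UNIV g x \<bullet> e3 = x \<bullet> cross3 u v"
      using rot3_simps(6) [OF rot3_inv(1) [OF g(1)]] * by metis+
    then show ?thesis by (simp add: vec_eq_iff forall_3 inner_axis)
  qed
  then show thesis using that rot3_inv(1) [OF g(1)] * by blast
qed

lemma orthogonal_unit_exists:
  fixes v :: "real^3"
  obtains u :: "real^3" where "norm u = 1" "u \<bullet> v = 0"
proof -
  obtain x where "x \<noteq> 0" "orthogonal v x"
    using orthogonal_to_vector_exists [of v] by auto
  then show thesis
    using that [of "x /\<^sub>R norm x"] by (simp add: orthogonal_def inner_commute)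
qed

text \<open>For a unit vector \<open>u\<close> orthogonal to \<open>v\<close> the triple
  \<open>u\<close>, \<open>cross3 v u\<close>, \<open>v\<close> is positively oriented, so the
  rotation that straightens its first two vectors takes \<open>v\<close> to
  \<open>e3\<close>.\<close>

lemma rot3_unit:
  assumes "norm v = 1"
  obtains f where "f \<in> rot3" "f v = e3"
proof -
  obtain u where u: "norm u = 1" "u \<bullet> v = 0" by (rule orthogonal_unit_exists)
  have "norm (cross3 v u) = 1"
    using norm_cross [of v u] u assms norm_ge_zero [of "cross3 v u"]
    by (simp add: inner_commute power2_eq_1_iff)
  moreover have "cross3 u (cross3 v u) = v"
    using u by (simp add: Lagrange dot_square_norm)
  ultimately show thesis
    using rot3_from_frame [of u "cross3 v u"] u that by (metis dot_cross_self(2))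
qed

section \<open>Spaces of orbits, and the descent of maps and homotopies to them\<close>

type_synonym quad = "(real^3) \<times> (real^3) \<times> (real^3) \<times> (real^3)"

fun act :: "(real^3 \<Rightarrow> real^3) \<Rightarrow> quad \<Rightarrow> quad" where
  "act f (a, b, c, d) = (f a, f b, f c, f d)"

definition orb :: "quad \<Rightarrow> quad set" where
  "orb w = {act f w | f. f \<in> rot3}"

definition orbit_space :: "quad set topology" where
  "orbit_space = quotient_topology euclidean orb"

definition invariant :: "quad set \<Rightarrow> bool" where
  "invariant S \<longleftrightarrow> (\<forall>f \<in> rot3. \<forall>w \<in> S. act f w \<in> S)"

text \<open>Subspaces of one global orbit space are used instead of a separate quotient of each
  \<open>S\<close>, so that inclusions of orbit spaces are literally \<open>id\<close> and open
  covers consist of subsets.\<close>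

definition Q :: "quad set \<Rightarrow> quad set topology" where
  "Q S = subtopology orbit_space (orb ` S)"

lemma act_act: "act f (act g w) = act (f \<circ> g) w"
  by (cases w) auto

lemma act_id [simp]: "act id w = w"
  by (cases w) auto

lemma orb_eq_iff: "orb w = orb w' \<longleftrightarrow> (\<exists>f \<in> rot3. w' = act f w)"
proof
  assume "orb w = orb w'"
  moreover have "w' \<in> orb w'" using rot3_id act_id unfolding orb_def by (metis (mono_tags, lifting) mem_Collect_eq)
  ultimately show "\<exists>f \<in> rot3. w' = act f w" by (auto simp: orb_def)
next
  assume "\<exists>f \<in> rot3. w' = act f w"
  then obtain f where f: "f \<in> rot3" "w' = act f w" by auto
  have "act h w \<in> orb w'" if "h \<in> rot3" for h
  proof -
    have "act h w = act (h \<circ> inv_into UNIV f) w'"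
      using rot3_inv [OF f(1)] by (cases w) (auto simp: f)
    then show ?thesis using that rot3_comp rot3_inv(1) [OF f(1)] unfolding orb_def by blast
  qed
  moreover have "act h w' \<in> orb w" if "h \<in> rot3" for h
    using that f rot3_comp unfolding orb_def f act_act by blast
  ultimately show "orb w = orb w'" unfolding orb_def by blast
qed

lemma orb_act [simp]: "f \<in> rot3 \<Longrightarrow> orb (act f w) = orb w"
  using orb_eq_iff by metis

lemma orb_in_imageD: "invariant S \<Longrightarrow> orb w \<in> orb ` S \<Longrightarrow> w \<in> S"
proof -
  assume S: "invariant S" and "orb w \<in> orb ` S"
  then obtain w' where "w' \<in> S" "orb w' = orb w" by auto
  then obtain f where "f \<in> rot3" "w = act f w'" by (auto simp: orb_eq_iff)
  then show "w \<in> S" using S \<open>w' \<in> S\<close> by (auto simp: invariant_def)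
qed

lemma orb_in_image: "invariant S \<Longrightarrow> orb w \<in> orb ` S \<longleftrightarrow> w \<in> S"
  using orb_in_imageD by blast

lemma istopology_quotient:
  "istopology (\<lambda>U. U \<subseteq> f ` topspace X \<and> openin X {x \<in> topspace X. f x \<in> U})"
proof -
  have "{x \<in> topspace X. f x \<in> S \<inter> T} = {x \<in> topspace X. f x \<in> S} \<inter> {x \<in> topspace X. f x \<in> T}" for S T
    by auto
  moreover have "{x \<in> topspace X. f x \<in> \<Union>K} = (\<Union>S\<in>K. {x \<in> topspace X. f x \<in> S})" for K
    by auto
  ultimately show ?thesis
    unfolding istopology_def by auto
qed

lemma openin_quotient_topology:
  "openin (quotient_topology X f) U \<longleftrightarrow> U \<subseteq> f ` topspace X \<and> openin X {x \<in> topspace X. f x \<in> U}"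
  unfolding quotient_topology_def by (simp add: istopology_quotient topology_inverse')

lemma topspace_quotient_topology: "topspace (quotient_topology X f) = f ` topspace X"
proof -
  have "openin (quotient_topology X f) (f ` topspace X)"
    by (auto simp: openin_quotient_topology intro: back_subst [of "openin X", OF openin_topspace])
  then show ?thesis
    by (meson openin_quotient_topology openin_subset openin_topspace subset_antisym)
qed

lemma quotient_map_quotient_topology: "quotient_map X (quotient_topology X f) f"
  by (auto simp: quotient_map_def topspace_quotient_topology openin_quotient_topology)

lemma homeomorphism_act:
  assumes "f \<in> rot3" "open S" shows "open {w. act f w \<in> S}"
proof -
  have "continuous_on UNIV f"
    using assms(1) by (metis (mono_tags, lifting) linear_continuous_on linear_conv_bounded_linear
        mem_Collect_eq orthogonal_transformation_linear rot3_def)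
  then have c: "continuous_on UNIV (\<lambda>w. f (g w))" if "continuous_on UNIV g" for g :: "quad \<Rightarrow> real^3"
    using continuous_on_compose2 [of UNIV f UNIV g] that by simp
  have "continuous_on UNIV (\<lambda>w::quad. (f (fst w), f (fst (snd w)), f (fst (snd (snd w))), f (snd (snd (snd w)))))"
    by (intro continuous_on_Pair c continuous_on_fst continuous_on_snd continuous_on_id)
  moreover have "act f = (\<lambda>w. (f (fst w), f (fst (snd w)), f (fst (snd (snd w))), f (snd (snd (snd w)))))"
    by (simp add: fun_eq_iff)
  ultimately have "continuous_on UNIV (act f)" by metis
  from open_vimage [OF assms(2) this] show ?thesis unfolding vimage_def .
qed

text \<open>The saturation of an open set is the union of its translates. Openness is what makes
  \<open>orb\<close> restrict to a quotient map on every invariant set.\<close>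

lemma open_map_orb: "open_map euclidean orbit_space orb"
proof -
  have "open {w. orb w \<in> orb ` S}" if "open S" for S
  proof -
    have "{w. orb w \<in> orb ` S} = (\<Union>f \<in> rot3. {w. act f w \<in> S})"
      unfolding image_iff orb_eq_iff by auto
    then show ?thesis using homeomorphism_act that by (auto intro!: open_UN)
  qed
  then show ?thesis
    by (auto simp: open_map_def orbit_space_def openin_quotient_topology)
qed

lemma topspace_orbit_space [simp]: "topspace orbit_space = range orb"
  by (simp add: orbit_space_def topspace_quotient_topology)

lemma topspace_Q [simp]: "topspace (Q S) = orb ` S"
  by (auto simp: Q_def topspace_subtopology)

lemma openin_orb_image: "open S \<Longrightarrow> openin orbit_space (orb ` S)"
  using open_map_orb by (simp add: open_map_def)

lemma openin_Q: "open S \<Longrightarrow> S \<subseteq> T \<Longrightarrow> openin (Q T) (orb ` S)"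
  unfolding Q_def using openin_orb_image by (metis image_mono inf.absorb_iff1 openin_subtopology)

lemma subtopology_Q: "S \<subseteq> T \<Longrightarrow> subtopology (Q T) (orb ` S) = Q S"
  unfolding Q_def subtopology_subtopology by (simp add: image_mono inf.absorb2)

lemma orb_image_Int: "invariant S \<Longrightarrow> invariant T \<Longrightarrow> orb ` S \<inter> orb ` T = orb ` (S \<inter> T)"
proof (intro equalityI)
  assume S: "invariant S" and T: "invariant T"
  show "orb ` S \<inter> orb ` T \<subseteq> orb ` (S \<inter> T)"
  proof
    fix x assume x: "x \<in> orb ` S \<inter> orb ` T"
    then obtain w where w: "w \<in> S" "x = orb w" by blast
    then have "w \<in> T" using orb_in_imageD [OF T, of w] x by blast
    then show "x \<in> orb ` (S \<inter> T)" using w by blast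
  qed
qed blast

lemma quotient_map_orb:
  assumes "invariant S" shows "quotient_map (top_of_set S) (Q S) orb"
proof (rule continuous_open_imp_quotient_map)
  have "continuous_map euclidean orbit_space orb"
    unfolding orbit_space_def by (rule quotient_imp_continuous_map [OF quotient_map_quotient_topology])
  then show "continuous_map (top_of_set S) (Q S) orb"
    unfolding Q_def by (auto simp: continuous_map_in_subtopology continuous_map_from_subtopology)
  have "{w \<in> topspace euclidean. orb w \<in> orb ` S} = S"
    using orb_in_image [OF assms] by auto
  then show "open_map (top_of_set S) (Q S) orb"
    unfolding Q_def by (rule open_map_restriction [OF open_map_orb])
qed auto

lemma continuous_map_orb: "invariant S \<Longrightarrow> continuous_map (top_of_set S) (Q S) orb"
  by (simp add: quotient_imp_continuous_map quotient_map_orb)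

text \<open>An arbitrary section of \<open>orb\<close>, with no continuity claimed. It only serves
  to write down descended maps: for an invariant \<open>k\<close> the value \<open>k (rep x)\<close>
  does not depend on the choice, and continuity comes from the quotient map.\<close>

definition rep :: "quad set \<Rightarrow> quad" where "rep x = (SOME w. orb w = x)"

lemma orb_rep: "orb (rep (orb w)) = orb w"
  unfolding rep_def by (rule someI) (rule refl)

lemma rep_orb: obtains f where "f \<in> rot3" "rep (orb w) = act f w"
  using orb_rep orb_eq_iff by metis

lemma continuous_map_descend:
  assumes "invariant S" "continuous_map (top_of_set S) Y k"
    and "\<And>f w. f \<in> rot3 \<Longrightarrow> w \<in> S \<Longrightarrow> k (act f w) = k w"
  shows "continuous_map (Q S) Y (\<lambda>x. k (rep x))"
proof (rule continuous_compose_quotient_map [OF quotient_map_orb [OF assms(1)]])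
  show "continuous_map (top_of_set S) Y ((\<lambda>x. k (rep x)) \<circ> orb)"
    by (rule continuous_map_eq [OF assms(2)]) (metis assms(3) comp_apply rep_orb topspace_euclidean_subtopology)
qed

text \<open>The unit interval is locally compact and Hausdorff, so its product with
  \<open>orb\<close> is again a quotient map and homotopies descend. Equivariance is required only
  up to orbits, which admits homotopies through normal forms in fixed coordinates; \<open>A\<close>
  and \<open>B\<close> provide the version for pairs.\<close>

lemma homotopic_orb:
  fixes h :: "real \<times> quad \<Rightarrow> quad"
  assumes S: "invariant S" "A \<subseteq> S" and T: "invariant T"
    and h: "continuous_on ({0..1} \<times> S) h" "\<And>t w. t \<in> {0..1} \<Longrightarrow> w \<in> S \<Longrightarrow> h (t, w) \<in> T"
    and hA: "\<And>t w. t \<in> {0..1} \<Longrightarrow> w \<in> A \<Longrightarrow> h (t, w) \<in> B"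
    and equi: "\<And>t f w. t \<in> {0..1} \<Longrightarrow> f \<in> rot3 \<Longrightarrow> w \<in> S \<Longrightarrow> orb (h (t, act f w)) = orb (h (t, w))"
    and F0: "\<And>w. w \<in> S \<Longrightarrow> F0 (orb w) = orb (h (0, w))"
    and F1: "\<And>w. w \<in> S \<Longrightarrow> F1 (orb w) = orb (h (1, w))"
  shows "homotopic_with (\<lambda>f. f \<in> orb ` A \<rightarrow> orb ` B) (Q S) (Q T) F0 F1"
proof -
  let ?I = "top_of_set {0..1::real}"
  let ?k = "\<lambda>(t::real, x). orb (h (t, rep x))"
  have k: "?k (t, orb w) = orb (h (t, w))" if "t \<in> {0..1}" "w \<in> S" for t w
    using equi [OF that(1) _ that(2)] rep_orb by (metis case_prod_conv)
  have "quotient_map (prod_topology ?I (top_of_set S)) (prod_topology ?I (Q S)) (\<lambda>(t, w). (t, orb w))"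
    by (rule quotient_map_prod_right [OF _ _ quotient_map_orb [OF S(1)]])
      (simp_all add: Hausdorff_space_subtopology compact_imp_locally_compact_space compact_space_subtopology)
  moreover have "continuous_map (prod_topology ?I (top_of_set S)) (Q T) (?k \<circ> (\<lambda>(t, w). (t, orb w)))"
  proof (rule continuous_map_eq)
    have "continuous_map (top_of_set ({0..1} \<times> S)) (top_of_set T) h"
      using h by (auto simp: continuous_map_in_subtopology)
    then have "continuous_map (top_of_set ({0..1} \<times> S)) (Q T) (orb \<circ> h)"
      by (rule continuous_map_compose [OF _ continuous_map_orb [OF T]])
    note oh = this
    have eq: "prod_topology ?I (top_of_set S) = top_of_set ({0..1} \<times> S)"
      by (simp add: prod_topology_subtopology subtopology_subtopology Times_Int_Times)
    show "continuous_map (prod_topology ?I (top_of_set S)) (Q T) (orb \<circ> h)"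
      unfolding eq by (rule oh)
    fix x assume "x \<in> topspace (prod_topology ?I (top_of_set S))"
    then show "(orb \<circ> h) x = (?k \<circ> (\<lambda>(t, w). (t, orb w))) x"
      using k by auto
  qed
  ultimately have c: "continuous_map (prod_topology ?I (Q S)) (Q T) ?k"
    by (rule continuous_compose_quotient_map)
  show ?thesis
  proof (subst homotopic_with)
    fix f g :: "quad set \<Rightarrow> quad set" assume "\<And>x. x \<in> topspace (Q S) \<Longrightarrow> f x = g x"
    then have "f x = g x" if "x \<in> orb ` A" for x using that S(2) by auto
    then show "(f \<in> orb ` A \<rightarrow> orb ` B) = (g \<in> orb ` A \<rightarrow> orb ` B)"
      by (auto simp: Pi_iff)
  next
    show "\<exists>k. continuous_map (prod_topology ?I (Q S)) (Q T) k \<and>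
      (\<forall>x\<in>topspace (Q S). k (0, x) = F0 x) \<and> (\<forall>x\<in>topspace (Q S). k (1, x) = F1 x) \<and>
      (\<forall>t\<in>{0..1}. (\<lambda>x. k (t, x)) \<in> orb ` A \<rightarrow> orb ` B)"
    proof (intro exI [of _ ?k] conjI c ballI funcsetI)
      fix x assume "x \<in> topspace (Q S)"
      then obtain w where w: "w \<in> S" "x = orb w" by auto
      show "?k (0, x) = F0 x" "?k (1, x) = F1 x"
        unfolding w(2) F0 [OF w(1)] F1 [OF w(1)] by (rule k; simp add: w(1))+
    next
      fix t :: real and x assume t: "t \<in> {0..1}" and "x \<in> orb ` A"
      then obtain w where w: "w \<in> A" "x = orb w" by auto
      have "?k (t, x) = orb (h (t, w))"
        unfolding w(2) by (rule k [OF t]) (use w(1) S(2) in auto)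
      then show "?k (t, x) \<in> orb ` B" using hA [OF t w(1)] by simp
    qed
  qed
qed

lemma contractible_orb:
  fixes h :: "real \<times> quad \<Rightarrow> quad"
  assumes S: "invariant S"
    and h: "continuous_on ({0..1} \<times> S) h" "\<And>t w. t \<in> {0..1} \<Longrightarrow> w \<in> S \<Longrightarrow> h (t, w) \<in> S"
    and equi: "\<And>t f w. t \<in> {0..1} \<Longrightarrow> f \<in> rot3 \<Longrightarrow> w \<in> S \<Longrightarrow> orb (h (t, act f w)) = orb (h (t, w))"
    and h0: "\<And>w. w \<in> S \<Longrightarrow> orb (h (0, w)) = orb w"
    and h1: "\<And>w. w \<in> S \<Longrightarrow> orb (h (1, w)) = c"
  shows "contractible_space (Q S)"
proof -
  have "homotopic_with (\<lambda>f. f \<in> orb ` {} \<rightarrow> orb ` {}) (Q S) (Q S) id (\<lambda>x. c)"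
    by (rule homotopic_orb [OF S _ S h]) (use equi h0 h1 in auto)
  then show ?thesis unfolding contractible_space_def by auto
qed

section \<open>Contractions of sets of orbits\<close>

text \<open>The component of \<open>b\<close> perpendicular to \<open>d\<close> is multiplied by \<open>d \<bullet> d\<close> to avoid a division.\<close>

definition perp :: "real^3 \<Rightarrow> real^3 \<Rightarrow> real^3" where
  "perp b d = (d \<bullet> d) *\<^sub>R b - (b \<bullet> d) *\<^sub>R d"

lemma perp_inner [simp]: "perp b d \<bullet> d = 0" "d \<bullet> perp b d = 0"
  by (simp_all add: perp_def inner_diff_left inner_diff_right inner_commute)

lemma perp_add: "perp (b + c) d = perp b d + perp c d"
  and perp_scale: "perp (r *\<^sub>R b) d = r *\<^sub>R perp b d"
  and perp_scale_right: "perp b (r *\<^sub>R d) = r\<^sup>2 *\<^sub>R perp b d"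
  by (simp_all add: perp_def algebra_simps power2_eq_square inner_add_left)

lemma perp_self [simp]: "perp (r *\<^sub>R d) d = 0" "perp d d = 0" "perp 0 d = 0" "perp b 0 = 0" "perp b (- d) = perp b d"
  by (simp_all add: perp_def)

lemma perp_orthogonal: "b \<bullet> d = 0 \<Longrightarrow> perp b d = (d \<bullet> d) *\<^sub>R b"
  by (simp add: perp_def)

lemma rot3_perp: "f \<in> rot3 \<Longrightarrow> f (perp b d) = perp (f b) (f d)"
  by (simp add: perp_def rot3_simps)

lemma rot3_sgn: "f \<in> rot3 \<Longrightarrow> f (sgn b) = sgn (f b)"
  by (simp add: sgn_div_norm rot3_simps)

lemma rot3_inner_sgn: "f \<in> rot3 \<Longrightarrow> f a \<bullet> sgn (f d) = a \<bullet> sgn d"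
  by (simp add: sgn_div_norm rot3_simps)

lemma rot3_rejection:
  assumes "f \<in> rot3"
  shows "norm (f a - (a \<bullet> sgn d) *\<^sub>R sgn (f d)) = norm (a - (a \<bullet> sgn d) *\<^sub>R sgn d)"
proof -
  have "f a - (a \<bullet> sgn d) *\<^sub>R sgn (f d) = f (a - (a \<bullet> sgn d) *\<^sub>R sgn d)"
    unfolding rot3_simps(2,3) [OF assms] rot3_sgn [OF assms] ..
  then show ?thesis by (simp add: rot3_simps(7) [OF assms])
qed

lemmas equivariant = rot3_simps rot3_perp rot3_sgn rot3_inner_sgn

lemma sgn_inner:
  fixes d :: "'a :: real_inner"
  shows "sgn d \<bullet> d = norm d" "b \<bullet> sgn d = (b \<bullet> d) / norm d"
  by (cases "d = 0"; simp add: sgn_div_norm dot_square_norm power2_eq_square divide_inverse)+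

text \<open>Normalisation moves a vector only along its ray, which preserves nonvanishing and signs
  during the deformations below.\<close>

lemma sgn_segment:
  fixes d :: "'a :: real_normed_vector"
  assumes "d \<noteq> 0" "t \<in> {0..1::real}"
  obtains k where "k > 0" "(1 - t) *\<^sub>R d + t *\<^sub>R sgn d = k *\<^sub>R d"
proof
  have "(1 - t) + t / norm d > 0"
    using assms by (cases "t = 0") (auto simp: add_nonneg_pos)
  then show "(1 - t) + t / norm d > 0" .
  show "(1 - t) *\<^sub>R d + t *\<^sub>R sgn d = ((1 - t) + t / norm d) *\<^sub>R d"
    by (simp add: sgn_div_norm algebra_simps divide_inverse)
qed

text \<open>\<open>perp\<close> ignores multiples of \<open>d\<close> in its first argument and is
  quadratic in the second, so the whole path consists of positive multiples of
  \<open>perp c d\<close>. The free \<open>r\<close> serves the retractions that keep a component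
  along \<open>d\<close>.\<close>

lemma perp_segment:
  assumes "perp c d \<noteq> 0" "t \<in> {0..1}"
  shows "perp ((1 - t) *\<^sub>R c + t *\<^sub>R (sgn (perp c d) + r *\<^sub>R d)) ((1 - t) *\<^sub>R d + t *\<^sub>R sgn d) \<noteq> 0"
proof -
  have d: "d \<noteq> 0" using assms by auto
  obtain k where k: "k > 0" "(1 - t) *\<^sub>R d + t *\<^sub>R sgn d = k *\<^sub>R d"
    by (rule sgn_segment [OF d assms(2)])
  let ?p = "perp c d"
  have "perp (sgn ?p) d = (d \<bullet> d) *\<^sub>R sgn ?p"
    by (rule perp_orthogonal) (simp add: sgn_div_norm)
  then have "perp ((1 - t) *\<^sub>R c + t *\<^sub>R (sgn ?p + r *\<^sub>R d)) (k *\<^sub>R d)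
     = k\<^sup>2 *\<^sub>R ((1 - t) *\<^sub>R ?p + (t * (d \<bullet> d)) *\<^sub>R sgn ?p)"
    by (simp add: perp_add perp_scale perp_scale_right)
  also have "\<dots> = (k\<^sup>2 * ((1 - t) + t * (d \<bullet> d) / norm ?p)) *\<^sub>R ?p"
    by (simp add: sgn_div_norm algebra_simps divide_inverse)
  finally have eq: "perp ((1 - t) *\<^sub>R c + t *\<^sub>R (sgn ?p + r *\<^sub>R d)) ((1 - t) *\<^sub>R d + t *\<^sub>R sgn d)
      = (k\<^sup>2 * ((1 - t) + t * (d \<bullet> d) / norm ?p)) *\<^sub>R ?p"
    unfolding k(2) .
  have "(1 - t) + t * (d \<bullet> d) / norm ?p > 0"
    using assms d by (cases "t = 0") (auto intro!: add_nonneg_pos divide_pos_pos)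
  then show ?thesis using eq k assms(1) by simp
qed

lemma perp_segment0:
  assumes "perp c d \<noteq> 0" "t \<in> {0..1}"
  shows "perp ((1 - t) *\<^sub>R c + t *\<^sub>R sgn (perp c d)) ((1 - t) *\<^sub>R d + t *\<^sub>R sgn d) \<noteq> 0"
  using perp_segment [OF assms, of 0] by simp

lemma sgn_segment_nonzero:
  fixes d :: "'a :: real_normed_vector"
  assumes "d \<noteq> 0" "t \<in> {0..1::real}"
  shows "(1 - t) *\<^sub>R d + t *\<^sub>R sgn d \<noteq> 0"
  using sgn_segment [OF assms] assms by (metis less_irrefl scale_eq_0_iff)

lemma orb_frame:
  assumes "norm u = 1" "norm v = 1" "u \<bullet> v = 0"
  shows "\<exists>f \<in> rot3. f u = e1 \<and> f v = e2"
  using rot3_from_frame [OF assms] by metis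

text \<open>Rotations about an axis bring every vector into a fixed closed half-plane bounded by
  that axis. The normal form depends only on the height along the axis and the distance from it, so
  it stays continuous where \<open>a\<close> is parallel to \<open>n\<close>, although the rotation
  is then not determined.\<close>

lemma rot3_halfplane:
  assumes "norm n = 1"
  obtains f where "f \<in> rot3" "f n = e3" "f a = norm (a - (a \<bullet> n) *\<^sub>R n) *\<^sub>R e1 + (a \<bullet> n) *\<^sub>R e3"
proof (cases "a - (a \<bullet> n) *\<^sub>R n = 0")
  case True
  obtain f where f: "f \<in> rot3" "f n = e3" by (rule rot3_unit [OF assms])
  have "f a = f ((a \<bullet> n) *\<^sub>R n)" using True by simp
  then show thesis using that [OF f] True f by (simp add: rot3_simps)
next
  case False
  define u where "u = sgn (a - (a \<bullet> n) *\<^sub>R n)"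
  have u: "norm u = 1" "u \<bullet> n = 0" "n \<bullet> u = 0"
    using False assms by (simp_all add: u_def norm_sgn sgn_div_norm inner_diff_left inner_diff_right
        dot_square_norm inner_commute)
  have nu: "norm (cross3 n u) = 1"
    using norm_cross [of n u] u assms norm_ge_zero [of "cross3 n u"] by (simp add: power2_eq_1_iff)
  have "cross3 u (cross3 n u) = n"
    using u by (simp add: Lagrange dot_square_norm)
  then obtain f where f: "f \<in> rot3" "f u = e1" "f n = e3"
    using rot3_from_frame [OF u(1) nu] by (metis dot_cross_self(2))
  have "a = norm (a - (a \<bullet> n) *\<^sub>R n) *\<^sub>R u + (a \<bullet> n) *\<^sub>R n"
    using False by (simp add: u_def sgn_div_norm)
  then have "f a = norm (a - (a \<bullet> n) *\<^sub>R n) *\<^sub>R e1 + (a \<bullet> n) *\<^sub>R e3"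
    using f rot3_simps(1,3) [OF f(1)] by metis
  then show thesis using that f by blast
qed

text \<open>An equivariant deformation is followed by one through normal forms, glued where their
  orbits agree. The intermediate map \<open>F\<close> is well defined on orbits because
  \<open>h\<close> is equivariant.\<close>

lemma contractible_orb2:
  fixes h k :: "real \<times> quad \<Rightarrow> quad"
  assumes S: "invariant S"
    and h: "continuous_on ({0..1} \<times> S) h" "\<And>t w. t \<in> {0..1} \<Longrightarrow> w \<in> S \<Longrightarrow> h (t, w) \<in> S"
      "\<And>t f w. f \<in> rot3 \<Longrightarrow> h (t, act f w) = act f (h (t, w))"
      "\<And>w. w \<in> S \<Longrightarrow> orb (h (0, w)) = orb w"
      "\<And>w. w \<in> S \<Longrightarrow> orb (h (1, w)) = orb (k (0, w))"
    and k: "continuous_on ({0..1} \<times> S) k" "\<And>t w. t \<in> {0..1} \<Longrightarrow> w \<in> S \<Longrightarrow> k (t, w) \<in> S"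
      "\<And>t f w. t \<in> {0..1} \<Longrightarrow> f \<in> rot3 \<Longrightarrow> w \<in> S \<Longrightarrow> orb (k (t, act f w)) = orb (k (t, w))"
      "\<And>w. w \<in> S \<Longrightarrow> orb (k (1, w)) = c"
  shows "contractible_space (Q S)"
proof -
  define F where "F x = orb (h (1, rep x))" for x
  have F: "F (orb w) = orb (h (1, w))" if "w \<in> S" for w
    using h(3) [of _ 1 w] rep_orb [of w] unfolding F_def by (metis orb_act)
  have "homotopic_with (\<lambda>f. f \<in> orb ` {} \<rightarrow> orb ` {}) (Q S) (Q S) id F"
    by (rule homotopic_orb [OF S _ S h(1,2)]) (use h F in auto)
  moreover have "homotopic_with (\<lambda>f. f \<in> orb ` {} \<rightarrow> orb ` {}) (Q S) (Q S) F (\<lambda>x. c)"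
    by (rule homotopic_orb [OF S _ S k(1,2)]) (use h k F in auto)
  ultimately show ?thesis
    unfolding contractible_space_def using homotopic_with_trans by fastforce
qed

text \<open>The open sets of the successive covers: \<open>U\<^sub>4 \<union> V\<^sub>4\<close> are all nonzero quadruples,
  \<open>A\<^sub>3 \<union> B\<^sub>3 = U\<^sub>4 \<inter> V\<^sub>4\<close>, \<open>Neg \<union> Pos = B\<^sub>3\<close>, \<open>A\<^sub>2 \<union> B\<^sub>2 = Neg \<inter> Pos\<close>, and on the other side
  \<open>V\<^sub>3 \<union> U\<^sub>3 = V\<^sub>4\<close>, \<open>U\<^sub>2 \<union> V\<^sub>2 = V\<^sub>3\<close>.\<close>

definition U4 :: "quad set" where "U4 = {(a, b, c, d). d \<noteq> 0}"
definition U3 :: "quad set" where "U3 = {(a, b, c, d). c \<noteq> 0}"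
definition U2 :: "quad set" where "U2 = {(a, b, c, d). b \<noteq> 0}"
definition V2 :: "quad set" where "V2 = {(a, b, c, d). a \<noteq> 0}"
definition V3 :: "quad set" where "V3 = {(a, b, c, d). a \<noteq> 0 \<or> b \<noteq> 0}"
definition V4 :: "quad set" where "V4 = {(a, b, c, d). a \<noteq> 0 \<or> b \<noteq> 0 \<or> c \<noteq> 0}"
definition A3 :: "quad set" where "A3 = {(a, b, c, d). perp c d \<noteq> 0}"
definition B3 :: "quad set" where "B3 = {(a, b, c, d). d \<noteq> 0 \<and> (a \<noteq> 0 \<or> b \<noteq> 0 \<or> c \<bullet> d \<noteq> 0)}"
definition Pos :: "quad set" where "Pos = {(a, b, c, d). d \<noteq> 0 \<and> (a \<noteq> 0 \<or> b \<noteq> 0 \<or> c \<bullet> d > 0)}"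
definition Neg :: "quad set" where "Neg = {(a, b, c, d). d \<noteq> 0 \<and> (a \<noteq> 0 \<or> b \<noteq> 0 \<or> c \<bullet> d < 0)}"
text \<open>A common part of \<open>Pos\<close> and \<open>U3\<close>, through which the pairs
  \<open>(Pos, Neg \<inter> Pos)\<close> and \<open>(U3, V3 \<inter> U3)\<close> are
  compared.\<close>

definition Pos0 :: "quad set" where "Pos0 = {(a, b, c, d). c \<bullet> d > 0}"
definition A2 :: "quad set" where "A2 = {(a, b, c, d). perp b d \<noteq> 0}"
definition B2 :: "quad set" where "B2 = {(a, b, c, d). d \<noteq> 0 \<and> (a \<noteq> 0 \<or> b \<bullet> d \<noteq> 0)}"

lemmas set_defs = U4_def U3_def U2_def V2_def V3_def V4_def A3_def B3_def Pos_def Neg_def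
  Pos0_def A2_def B2_def

lemma invariant_sets [simp]:
  "invariant U4" "invariant U3" "invariant U2" "invariant V2" "invariant V3" "invariant V4"
  "invariant A3" "invariant B3" "invariant Pos" "invariant Neg" "invariant Pos0"
  "invariant A2" "invariant B2"
  by (auto simp: invariant_def set_defs equivariant simp flip: rot3_perp)

lemma invariant_Int [simp]: "invariant S \<Longrightarrow> invariant T \<Longrightarrow> invariant (S \<inter> T)"
  and invariant_Un [simp]: "invariant S \<Longrightarrow> invariant T \<Longrightarrow> invariant (S \<union> T)"
  by (auto simp: invariant_def)

lemma equivariant_orb:
  "(\<And>a b c d. h (t, f a, f b, f c, f d) = act f (h (t, a, b, c, d))) \<Longrightarrow> f \<in> rot3 \<Longrightarrow>
    orb (h (t, act f w)) = orb (h (t, w))"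
  by (cases w) simp

lemma act_components [simp]:
  "fst (act f w) = f (fst w)" "fst (snd (act f w)) = f (fst (snd w))"
  "fst (snd (snd (act f w))) = f (fst (snd (snd w)))" "snd (snd (snd (act f w))) = f (snd (snd (snd w)))"
  by (cases w; simp)+

lemma contractible_orb_eq:
  fixes h :: "real \<times> quad \<Rightarrow> quad"
  assumes S: "invariant S"
    and h: "continuous_on ({0..1} \<times> S) h" "\<And>t w. t \<in> {0..1} \<Longrightarrow> w \<in> S \<Longrightarrow> h (t, w) \<in> S"
    and equi: "\<And>t f w. f \<in> rot3 \<Longrightarrow> h (t, act f w) = act f (h (t, w))"
    and h0: "\<And>w. h (0, w) = w"
    and h1: "\<And>w. w \<in> S \<Longrightarrow> orb (h (1, w)) = c"
  shows "contractible_space (Q S)"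
  by (rule contractible_orb [OF S h]) (use equi h0 h1 in auto)

lemma orb_unit_cases:
  assumes "v \<noteq> 0"
  shows "orb (0, 0, 0, sgn v) = orb (0, 0, 0, e3)" "orb (0, 0, sgn v, 0) = orb (0, 0, e3, 0)"
    "orb (0, sgn v, 0, 0) = orb (0, e3, 0, 0)" "orb (sgn v, 0, 0, 0) = orb (e3, 0, 0, 0)"
    "orb (0, 0, r *\<^sub>R sgn v, sgn v) = orb (0, 0, r *\<^sub>R e3, e3)"
proof -
  obtain f where "f \<in> rot3" "f (sgn v) = e3"
    using rot3_unit [of "sgn v"] assms by (auto simp: norm_sgn)
  then show "orb (0, 0, 0, sgn v) = orb (0, 0, 0, e3)" "orb (0, 0, sgn v, 0) = orb (0, 0, e3, 0)"
    "orb (0, sgn v, 0, 0) = orb (0, e3, 0, 0)" "orb (sgn v, 0, 0, 0) = orb (e3, 0, 0, 0)"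
    "orb (0, 0, r *\<^sub>R sgn v, sgn v) = orb (0, 0, r *\<^sub>R e3, e3)"
    unfolding orb_eq_iff by (auto intro!: bexI [of _ f] simp: rot3_simps)
qed

lemma orb_pair_cases:
  assumes "perp c d \<noteq> 0"
  shows "orb (0, 0, sgn (perp c d), sgn d) = orb (0, 0, e1, e2)"
    "orb (0, sgn (perp c d), 0, sgn d) = orb (0, e1, 0, e2)"
proof -
  have "d \<noteq> 0" using assms by auto
  then obtain f where "f \<in> rot3" "f (sgn (perp c d)) = e1" "f (sgn d) = e2"
    using orb_frame [of "sgn (perp c d)" "sgn d"] assms by (auto simp: norm_sgn sgn_div_norm [of d] sgn_div_norm [of "perp c d"])
  then show "orb (0, 0, sgn (perp c d), sgn d) = orb (0, 0, e1, e2)"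
    "orb (0, sgn (perp c d), 0, sgn d) = orb (0, e1, 0, e2)"
    unfolding orb_eq_iff by (auto intro!: bexI [of _ f] simp: rot3_simps)
qed

lemma continuous_on_perp [continuous_intros]:
  "continuous_on S f \<Longrightarrow> continuous_on S g \<Longrightarrow> continuous_on S (\<lambda>x. perp (f x) (g x))"
  unfolding perp_def by (intro continuous_intros)

text \<open>All vectors but \<open>d\<close> are scaled to 0 and \<open>d\<close> is normalised; the
  end points form one orbit because rotations are transitive on unit vectors. The next three proofs
  do the same with another vector.\<close>

lemma contractible_U4: "contractible_space (Q U4)"
proof (rule contractible_orb_eq [OF invariant_sets(1),where c = "orb (0, 0, 0, e3)" and
      h = "\<lambda>(t, a, b, c, d). ((1 - t) *\<^sub>R a, (1 - t) *\<^sub>R b, (1 - t) *\<^sub>R c, (1 - t) *\<^sub>R d + t *\<^sub>R sgn d)"])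
qed (auto simp: case_prod_unfold set_defs sgn_segment_nonzero orb_unit_cases equivariant
      intro!: continuous_intros)

lemma contractible_U3: "contractible_space (Q U3)"
proof (rule contractible_orb_eq [OF invariant_sets(2),where c = "orb (0, 0, e3, 0)" and
      h = "\<lambda>(t, a, b, c, d). ((1 - t) *\<^sub>R a, (1 - t) *\<^sub>R b, (1 - t) *\<^sub>R c + t *\<^sub>R sgn c, (1 - t) *\<^sub>R d)"])
qed (auto simp: case_prod_unfold set_defs sgn_segment_nonzero orb_unit_cases equivariant
      intro!: continuous_intros)

lemma contractible_U2: "contractible_space (Q U2)"
proof (rule contractible_orb_eq [OF invariant_sets(3),where c = "orb (0, e3, 0, 0)" and
      h = "\<lambda>(t, a, b, c, d). ((1 - t) *\<^sub>R a, (1 - t) *\<^sub>R b + t *\<^sub>R sgn b, (1 - t) *\<^sub>R c, (1 - t) *\<^sub>R d)"])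
qed (auto simp: case_prod_unfold set_defs sgn_segment_nonzero orb_unit_cases equivariant
      intro!: continuous_intros)

lemma contractible_V2: "contractible_space (Q V2)"
proof (rule contractible_orb_eq [OF invariant_sets(4),where c = "orb (e3, 0, 0, 0)" and
      h = "\<lambda>(t, a, b, c, d). ((1 - t) *\<^sub>R a + t *\<^sub>R sgn a, (1 - t) *\<^sub>R b, (1 - t) *\<^sub>R c, (1 - t) *\<^sub>R d)"])
qed (auto simp: case_prod_unfold set_defs sgn_segment_nonzero orb_unit_cases equivariant
      intro!: continuous_intros)

text \<open>Here the end points are orthonormal pairs, on which rotations are again
  transitive.\<close>

lemma contractible_A3: "contractible_space (Q A3)"
proof (rule contractible_orb_eq [OF invariant_sets(7),where c = "orb (0, 0, e1, e2)" and
      h = "\<lambda>(t, a, b, c, d). ((1 - t) *\<^sub>R a, (1 - t) *\<^sub>R b, (1 - t) *\<^sub>R c + t *\<^sub>R sgn (perp c d),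
         (1 - t) *\<^sub>R d + t *\<^sub>R sgn d)"])
qed (auto simp: case_prod_unfold set_defs perp_segment0 orb_pair_cases equivariant
      intro!: continuous_intros)

lemma contractible_A2: "contractible_space (Q A2)"
proof (rule contractible_orb_eq [OF invariant_sets(12),where c = "orb (0, e1, 0, e2)" and
      h = "\<lambda>(t, a, b, c, d). ((1 - t) *\<^sub>R a, (1 - t) *\<^sub>R b + t *\<^sub>R sgn (perp b d), (1 - t) *\<^sub>R c,
         (1 - t) *\<^sub>R d + t *\<^sub>R sgn d)"])
qed (auto simp: case_prod_unfold set_defs perp_segment0 orb_pair_cases equivariant
      intro!: continuous_intros)

lemma inner_segment:
  fixes c d :: "real^3"
  assumes "d \<noteq> 0" "t \<in> {0..1}"
  obtains k where "k > 0" "((1 - t) *\<^sub>R c + (t * r) *\<^sub>R sgn d) \<bullet> ((1 - t) *\<^sub>R d + t *\<^sub>R sgn d)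
     = k * ((1 - t) * (c \<bullet> d) + t * r * norm d)"
proof -
  obtain k where k: "k > 0" "(1 - t) *\<^sub>R d + t *\<^sub>R sgn d = k *\<^sub>R d"
    by (rule sgn_segment [OF assms])
  have "sgn d \<bullet> d = norm d"
    using assms by (simp add: sgn_div_norm dot_square_norm power2_eq_square)
  then show thesis
    by (intro that [OF k(1)]) (simp add: k(2) inner_add_left)
qed

lemma pos_segment:
  fixes x y :: real
  assumes "x > 0" "y > 0" "0 \<le> t" "t \<le> 1"
  shows "(1 - t) * x + t * y > 0"
  using assms by (cases "t = 1") (auto simp: add_pos_nonneg)

text \<open>The vector \<open>c\<close> is pushed to the multiple \<open>r\<close> of the unit
  vector along \<open>d\<close>, where \<open>r\<close> is a sign: 1 for \<open>Pos\<close> and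
  \<open>Pos0\<close>, -1 for \<open>Neg\<close>. The hypothesis \<open>step\<close> is what these
  sets share: before \<open>t = 1\<close> a nonzero \<open>a\<close> or \<open>b\<close> stays
  nonzero, and at \<open>t = 1\<close> the sign of \<open>c \<bullet> d\<close> is the right
  one.\<close>

lemma contractible_half:
  fixes r :: real
  assumes inv: "invariant S" and r: "r * r = 1"
    and d: "\<And>a b c d. (a, b, c, d) \<in> S \<Longrightarrow> d \<noteq> 0"
    and step: "\<And>a b c d c' d' t. (a, b, c, d) \<in> S \<Longrightarrow> 0 \<le> t \<Longrightarrow> t \<le> 1 \<Longrightarrow> d' \<noteq> 0 \<Longrightarrow>
      (r * (c \<bullet> d) > 0 \<or> t = 1 \<Longrightarrow> r * (c' \<bullet> d') > 0) \<Longrightarrow> ((1 - t) *\<^sub>R a, (1 - t) *\<^sub>R b, c', d') \<in> S"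
  shows "contractible_space (Q S)"
proof (rule contractible_orb_eq [OF inv, where c = "orb (0, 0, r *\<^sub>R e3, e3)" and
      h = "\<lambda>(t, a, b, c, d). ((1 - t) *\<^sub>R a, (1 - t) *\<^sub>R b, (1 - t) *\<^sub>R c + (t * r) *\<^sub>R sgn d,
         (1 - t) *\<^sub>R d + t *\<^sub>R sgn d)"])
  fix t :: real and w assume t: "t \<in> {0..1}" and w: "w \<in> S"
  obtain a b c d where [simp]: "w = (a, b, c, d)" by (cases w)
  have d0: "d \<noteq> 0" using w d by simp
  let ?c = "(1 - t) *\<^sub>R c + (t * r) *\<^sub>R sgn d" and ?d = "(1 - t) *\<^sub>R d + t *\<^sub>R sgn d"
  obtain k where k: "k > 0" "?c \<bullet> ?d = k * ((1 - t) * (c \<bullet> d) + t * r * norm d)"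
    by (rule inner_segment [OF d0 t])
  have "r * (?c \<bullet> ?d) = k * ((1 - t) * (r * (c \<bullet> d)) + t * (r * r * norm d))"
    unfolding k(2) by (simp add: algebra_simps)
  then have eq: "r * (?c \<bullet> ?d) = k * ((1 - t) * (r * (c \<bullet> d)) + t * norm d)"
    by (simp only: r mult_1)
  have "r * (?c \<bullet> ?d) > 0" if "r * (c \<bullet> d) > 0 \<or> t = 1"
    unfolding eq
  proof (rule mult_pos_pos [OF k(1)])
    show "(1 - t) * (r * (c \<bullet> d)) + t * norm d > 0"
      using that t d0 pos_segment [of "r * (c \<bullet> d)" "norm d" t] by (cases "t = 1") simp_all
  qed
  then show "(case (t, w) of (t, a, b, c, d) \<Rightarrow> ((1 - t) *\<^sub>R a, (1 - t) *\<^sub>R b,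
     (1 - t) *\<^sub>R c + (t * r) *\<^sub>R sgn d, (1 - t) *\<^sub>R d + t *\<^sub>R sgn d)) \<in> S"
    using w t sgn_segment_nonzero [OF d0 t] by (auto intro: step)
next
  have nz: "snd (snd (snd w)) \<noteq> 0" if "w \<in> S" for w using that d by (metis prod.collapse)
  then show "continuous_on ({0..1} \<times> S) (\<lambda>(t, a, b, c, d). ((1 - t) *\<^sub>R a, (1 - t) *\<^sub>R b,
     (1 - t) *\<^sub>R c + (t * r) *\<^sub>R sgn d, (1 - t) *\<^sub>R d + t *\<^sub>R sgn d))"
    unfolding case_prod_unfold by (intro continuous_intros) auto
  show "orb (case (1, w) of (t, a, b, c, d) \<Rightarrow> ((1 - t) *\<^sub>R a, (1 - t) *\<^sub>R b,
     (1 - t) *\<^sub>R c + (t * r) *\<^sub>R sgn d, (1 - t) *\<^sub>R d + t *\<^sub>R sgn d)) = orb (0, 0, r *\<^sub>R e3, e3)"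
    if "w \<in> S" for w
    using nz [OF that] by (simp add: case_prod_unfold orb_unit_cases)
qed (auto simp: case_prod_unfold equivariant)

lemma contractible_Pos: "contractible_space (Q Pos)"
  by (rule contractible_half [OF invariant_sets(9), of 1]) (auto simp: Pos_def)

lemma contractible_Neg: "contractible_space (Q Neg)"
  by (rule contractible_half [OF invariant_sets(10), of "-1"]) (auto simp: Neg_def)

lemma contractible_Pos0: "contractible_space (Q Pos0)"
  by (rule contractible_half [OF invariant_sets(11), of 1]) (auto simp: Pos0_def)

lemma halfplane_segment_nonzero:
  assumes "0 < t" "t \<le> 1"
  shows "((1 - t) * norm (x :: real^3) + t) *\<^sub>R e1 + s *\<^sub>R e3 \<noteq> 0"
proof
  assume "((1 - t) * norm x + t) *\<^sub>R e1 + s *\<^sub>R e3 = 0"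
  then have "(((1 - t) * norm x + t) *\<^sub>R e1 + s *\<^sub>R e3) \<bullet> e1 = 0" by simp
  then have "(1 - t) * norm x + t = 0" by (simp add: inner_add_left)
  moreover have "(1 - t) * norm x \<ge> 0" using assms by simp
  ultimately show False using assms by linarith
qed

text \<open>First \<open>b\<close> is projected to the axis \<open>d\<close> and \<open>c\<close> is
  scaled away. Modulo rotations there remain a point of the half-plane for \<open>a\<close> and one
  number each for \<open>b\<close> and \<open>d\<close>. The half-plane is convex, so
  \<open>a\<close> moves straight to \<open>e1\<close> while \<open>b\<close> goes to 0; the
  \<open>e1\<close> component is positive for \<open>t > 0\<close>, which keeps the path in
  \<open>B2\<close>.\<close>

lemma contractible_B2: "contractible_space (Q B2)"
proof -
  let ?h = "\<lambda>(t, a, b, c, d). (a, (1 - t) *\<^sub>R b + (t * (b \<bullet> sgn d)) *\<^sub>R sgn d, (1 - t) *\<^sub>R c, d)"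
  let ?k = "\<lambda>(t, a, b, c, d). (((1 - t) * norm (a - (a \<bullet> sgn d) *\<^sub>R sgn d) + t) *\<^sub>R e1 + ((1 - t) * (a \<bullet> sgn d)) *\<^sub>R e3,
    ((1 - t) * (b \<bullet> sgn d)) *\<^sub>R e3, 0, ((1 - t) * norm d + t) *\<^sub>R e3)"
  show ?thesis
  proof (rule contractible_orb2 [OF invariant_sets(13), where c = "orb (e1, 0, 0, e3)" and h = ?h and k = ?k])
    fix t :: real and w assume t: "t \<in> {0..1}" and w: "w \<in> B2"
    obtain a b c d where [simp]: "w = (a, b, c, d)" by (cases w)
    let ?n = "sgn d"
    have d: "d \<noteq> 0" and nd: "norm ?n = 1" using w by (auto simp: B2_def norm_sgn)
    have *: "(b \<bullet> ?n) * (?n \<bullet> d) = b \<bullet> d"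
      using d by (simp add: sgn_inner)
    have "((1 - t) *\<^sub>R b + (t * (b \<bullet> ?n)) *\<^sub>R ?n) \<bullet> d = (1 - t) * (b \<bullet> d) + t * ((b \<bullet> ?n) * (?n \<bullet> d))"
      by (simp add: inner_add_left)
    also have "\<dots> = b \<bullet> d" unfolding * by (simp add: algebra_simps)
    finally show "?h (t, w) \<in> B2"
      using w by (simp add: B2_def)
    obtain f where f: "f \<in> rot3" "f ?n = e3"
       "f a = norm (a - (a \<bullet> ?n) *\<^sub>R ?n) *\<^sub>R e1 + (a \<bullet> ?n) *\<^sub>R e3"
      by (rule rot3_halfplane [OF nd])
    have p: "(1 - t) * norm d + t > 0" using d t by (cases "t = 0") (auto simp: add_nonneg_pos)
    have "((1 - t) * norm (a - (a \<bullet> ?n) *\<^sub>R ?n) + t) *\<^sub>R e1 + ((1 - t) * (a \<bullet> ?n)) *\<^sub>R e3 \<noteq> 0" if "t > 0"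
      by (rule halfplane_segment_nonzero) (use that t in auto)
    moreover have "norm (a - (a \<bullet> ?n) *\<^sub>R ?n) *\<^sub>R e1 + (a \<bullet> ?n) *\<^sub>R e3 \<noteq> 0 \<or> b \<bullet> ?n \<noteq> 0"
    proof -
      have "a \<noteq> 0 \<or> b \<bullet> d \<noteq> 0" using w by (simp add: B2_def)
      then have "a \<noteq> 0 \<or> b \<bullet> ?n \<noteq> 0" by (metis * mult_zero_left)
      then show ?thesis unfolding f(3) [symmetric] rot3_simps(9) [OF f(1)] .
    qed
    ultimately show "?k (t, w) \<in> B2"
      using p t by (cases "t = 0") (auto simp: B2_def axis_eq_0_iff)
  next
    fix w assume w: "w \<in> B2"
    obtain a b c d where [simp]: "w = (a, b, c, d)" by (cases w)
    let ?n = "sgn d"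
    have d: "d \<noteq> 0" and nd: "norm ?n = 1" using w by (auto simp: B2_def norm_sgn)
    obtain f where f: "f \<in> rot3" "f ?n = e3"
       "f a = norm (a - (a \<bullet> ?n) *\<^sub>R ?n) *\<^sub>R e1 + (a \<bullet> ?n) *\<^sub>R e3"
      by (rule rot3_halfplane [OF nd])
    have "d = norm d *\<^sub>R ?n" using d by (simp add: sgn_div_norm)
    then have "f d = norm d *\<^sub>R e3" using f rot3_simps(3) [OF f(1)] by metis
    then show "orb (?h (1, w)) = orb (?k (0, w))"
      unfolding orb_eq_iff using f by (intro bexI [OF _ f(1)]) (simp add: rot3_simps)
  next
    fix t :: real and f w assume "f \<in> rot3"
    then show "orb (?k (t, act f w)) = orb (?k (t, w))"
      by (cases w) (simp add: rot3_rejection rot3_inner_sgn rot3_simps(7))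
  qed (auto simp: case_prod_unfold set_defs equivariant intro!: continuous_intros)
qed

text \<open>The same argument with \<open>a\<close> as the axis and \<open>b\<close> in the
  half-plane.\<close>

lemma contractible_U2_V2: "contractible_space (Q (U2 \<inter> V2))"
proof -
  let ?h = "\<lambda>(t, a, b, c, d). (a, b, (1 - t) *\<^sub>R c, (1 - t) *\<^sub>R d)"
  let ?k = "\<lambda>(t, a, b, c, d). (((1 - t) * norm a + t) *\<^sub>R e3,
    ((1 - t) * norm (b - (b \<bullet> sgn a) *\<^sub>R sgn a) + t) *\<^sub>R e1 + ((1 - t) * (b \<bullet> sgn a)) *\<^sub>R e3, 0, 0)"
  show ?thesis
  proof (rule contractible_orb2 [OF invariant_Int [OF invariant_sets(3,4)], where c = "orb (e3, e1, 0, 0)" and h = ?h and k = ?k])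
    fix t :: real and w assume t: "t \<in> {0..1}" and w: "w \<in> U2 \<inter> V2"
    obtain a b c d where [simp]: "w = (a, b, c, d)" by (cases w)
    let ?n = "sgn a"
    have a: "a \<noteq> 0" and na: "norm ?n = 1" and b: "b \<noteq> 0" using w by (auto simp: set_defs norm_sgn)
    show "?h (t, w) \<in> U2 \<inter> V2"
      using w by (simp add: set_defs)
    obtain f where f: "f \<in> rot3" "f ?n = e3"
       "f b = norm (b - (b \<bullet> ?n) *\<^sub>R ?n) *\<^sub>R e1 + (b \<bullet> ?n) *\<^sub>R e3"
      by (rule rot3_halfplane [OF na])
    have p: "(1 - t) * norm a + t > 0" using a t by (cases "t = 0") (auto simp: add_nonneg_pos)
    have "((1 - t) * norm (b - (b \<bullet> ?n) *\<^sub>R ?n) + t) *\<^sub>R e1 + ((1 - t) * (b \<bullet> ?n)) *\<^sub>R e3 \<noteq> 0" if "t > 0"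
      by (rule halfplane_segment_nonzero) (use that t in auto)
    moreover have "norm (b - (b \<bullet> ?n) *\<^sub>R ?n) *\<^sub>R e1 + (b \<bullet> ?n) *\<^sub>R e3 \<noteq> 0"
      unfolding f(3) [symmetric] rot3_simps(9) [OF f(1)] by (rule b)
    ultimately show "?k (t, w) \<in> U2 \<inter> V2"
      using p t by (cases "t = 0") (auto simp: set_defs axis_eq_0_iff)
  next
    fix w assume w: "w \<in> U2 \<inter> V2"
    obtain a b c d where [simp]: "w = (a, b, c, d)" by (cases w)
    let ?n = "sgn a"
    have a: "a \<noteq> 0" and na: "norm ?n = 1" using w by (auto simp: set_defs norm_sgn)
    obtain f where f: "f \<in> rot3" "f ?n = e3"
       "f b = norm (b - (b \<bullet> ?n) *\<^sub>R ?n) *\<^sub>R e1 + (b \<bullet> ?n) *\<^sub>R e3"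
      by (rule rot3_halfplane [OF na])
    have "a = norm a *\<^sub>R ?n" using a by (simp add: sgn_div_norm)
    then have "f a = norm a *\<^sub>R e3" using f rot3_simps(3) [OF f(1)] by metis
    then show "orb (?h (1, w)) = orb (?k (0, w))"
      unfolding orb_eq_iff using f by (intro bexI [OF _ f(1)]) (simp add: rot3_simps)
  next
    fix t :: real and f w assume "f \<in> rot3"
    then show "orb (?k (t, act f w)) = orb (?k (t, w))"
      by (cases w) (simp add: rot3_rejection rot3_inner_sgn rot3_simps(7))
  qed (auto simp: case_prod_unfold set_defs equivariant intro!: continuous_intros)
qed

section \<open>Homotopy equivalences with punctured Euclidean spaces\<close>

lemma homology_punctured:
  fixes p :: int
  defines "P \<equiv> top_of_set (UNIV - {0} :: 'a :: euclidean_space set)"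
  shows "p = int DIM('a) - 1 \<Longrightarrow> reduced_homology_group p P \<cong> integer_group"
    and "p \<noteq> int DIM('a) - 1 \<Longrightarrow> trivial_group (reduced_homology_group p P)"
proof -
  define n where "n = DIM('a) - 1"
  have n: "int n = int DIM('a) - 1" by (simp add: n_def of_nat_diff DIM_positive Suc_leI)
  obtain f :: "(nat \<Rightarrow> real) \<Rightarrow> 'a" and g where
    "homeomorphic_maps (nsphere n) (top_of_set (sphere 0 1 \<inter> span Basis)) f g"
    using homeomorphic_maps_nsphere_euclidean_sphere [OF independent_Basis orthogonal_Basis refl]
    unfolding n_def by (metis DIM_positive norm_Basis not_gr_zero)
  then have 1: "nsphere n homeomorphic_space top_of_set (sphere (0::'a) 1)"
    by (auto simp: homeomorphic_space_def)
  have "sphere (0::'a) 1 homotopy_eqv (UNIV - {0} :: 'a set)"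
    using homotopy_eqv_rel_frontier_punctured_affine_hull [of "cball (0::'a) 1" 0]
    by (simp add: rel_frontier_nonempty_interior affine_hull_nonempty_interior rel_interior_nonempty_interior)
  then have 2: "P homotopy_equivalent_space nsphere n"
    unfolding P_def using 1 by (metis homeomorphic_imp_homotopy_equivalent_space homeomorphic_space_sym
        homotopy_eqv_trans homotopy_equivalent_space_sym)
  have iso: "reduced_homology_group p P \<cong> reduced_homology_group p (nsphere n)"
    by (rule homotopy_equivalent_space_imp_isomorphic_reduced_homology_groups [OF 2])
  show "p = int DIM('a) - 1 \<Longrightarrow> reduced_homology_group p P \<cong> integer_group"
    using iso reduced_homology_group_nsphere(1) [of n] n by (metis iso_trans)
  show "p \<noteq> int DIM('a) - 1 \<Longrightarrow> trivial_group (reduced_homology_group p P)"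
    using iso reduced_homology_group_nsphere(2) [of p n] n
    by (metis group_reduced_homology_group isomorphic_group_triviality)
qed

text \<open>The complements of the two closed halves of the last axis are starlike and exchanged by
  the reflection. On their intersection \<open>x\<close> is nonzero, so the last coordinate can be
  scaled through 0 and the reflection is homotopic to the identity; \<open>minus_one_swap\<close>
  gives the sign.\<close>

lemma minus_one_reflection:
  fixes p :: int
  assumes p: "p \<ge> 2"
  shows "acts_as_minus_one p (top_of_set (UNIV - {0 :: 'a :: euclidean_space \<times> real})) (\<lambda>(x, r). (x, - r))"
proof -
  define U where "U = {z :: 'a \<times> real. fst z \<noteq> 0 \<or> snd z < 0}"
  define V where "V = {z :: 'a \<times> real. fst z \<noteq> 0 \<or> snd z > 0}"
  let ?X = "top_of_set (UNIV - {0 :: 'a \<times> real})" and ?s = "\<lambda>(x::'a, r::real). (x, - r)"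
  have UV: "U = - (fst -` {0}) \<union> snd -` {..<0}" "V = - (fst -` {0}) \<union> snd -` {0<..}"
    by (auto simp: U_def V_def)
  have o: "open U" "open V"
    unfolding UV by (auto intro!: open_Un open_vimage closed_vimage continuous_intros simp: open_Compl)
  have sub: "subtopology ?X U = top_of_set U" "subtopology ?X V = top_of_set V"
    "subtopology ?X (U \<inter> V) = top_of_set (U \<inter> V)"
    by (auto simp: subtopology_subtopology U_def V_def zero_prod_def intro!: arg_cong [of _ _ top_of_set])
  obtain b :: 'a where b: "b \<in> Basis" by (meson ex_in_conv nonempty_Basis)
  then have "b \<noteq> 0" by (rule nonzero_Basis)
  interpret open_cover ?X U V
  proof
    show "openin ?X U" "openin ?X V"
      using o by (auto intro!: open_subset simp: U_def V_def)
    show "topspace ?X = U \<union> V" by (auto simp: U_def V_def zero_prod_def)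
    have "(b, 0) \<in> U \<inter> V" using \<open>b \<noteq> 0\<close> by (simp add: U_def V_def)
    then show "U \<inter> V \<noteq> {}" by blast
  qed
  \<comment> \<open>The centre \<open>(0, s)\<close> lies on the open half-axis contained in the
    set; \<open>s = -1\<close> gives \<open>U\<close> and \<open>s = 1\<close> gives
    \<open>V\<close>.\<close>
  have star: "starlike {z :: 'a \<times> real. fst z \<noteq> 0 \<or> s * snd z > 0}" (is "starlike ?W") if "s * s = 1" for s
  proof -
    have "closed_segment (0, s) w \<subseteq> ?W" if w: "w \<in> ?W" for w
    proof
      fix z assume "z \<in> closed_segment (0, s) w"
      then obtain t where t: "0 \<le> t" "t \<le> 1" "z = (1 - t) *\<^sub>R (0, s) + t *\<^sub>R w"
        by (auto simp: in_segment)
      have "s * snd z = (1 - t) * (s * s) + t * (s * snd w)" by (simp add: t(3) algebra_simps)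
      then have "s * snd z > 0" if "t = 0 \<or> s * snd w > 0"
        unfolding \<open>s * s = 1\<close> using that t pos_segment [of 1 "s * snd w" t] by auto
      then show "z \<in> ?W" using w t by auto
    qed
    moreover have "(0, s) \<in> ?W" using that by simp
    ultimately show ?thesis unfolding starlike_def by blast
  qed
  have sl: "starlike U" "starlike V"
    using star [of "-1"] star [of 1] by (simp_all add: U_def V_def)
  show ?thesis
  proof (rule minus_one_swap [OF _ _ p])
    have ne: "U \<noteq> {}" "V \<noteq> {}" using meet by auto
    show "acyclic_space (subtopology ?X U)" "acyclic_space (subtopology ?X V)"
      unfolding sub using sl ne by (auto intro!: contractible_imp_acyclic starlike_imp_contractible)
    show "continuous_map ?X ?X ?s"
      by (auto simp: case_prod_unfold zero_prod_def prod_eq_iff intro!: continuous_intros)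
    show "?s \<in> U \<rightarrow> V" "?s \<in> V \<rightarrow> U" by (auto simp: U_def V_def)
    fix x assume x: "x \<in> carrier (homology_group (p-1) (subtopology ?X (U \<inter> V)))"
    have UV: "U \<inter> V = {z. fst z \<noteq> 0}" by (auto simp: U_def V_def)
    have "homotopic_with (\<lambda>_. True) (top_of_set (U \<inter> V)) (top_of_set (U \<inter> V)) ?s id"
      unfolding homotopic_with_def
    proof (intro exI conjI)
      show "continuous_map (prod_topology (top_of_set {0..1}) (top_of_set (U \<inter> V))) (top_of_set (U \<inter> V))
         (\<lambda>(t, x, r). (x, (2 * t - 1) * r))"
        unfolding prod_topology_subtopology
        by (auto simp: UV case_prod_unfold subtopology_subtopology Times_Int_Times intro!: continuous_intros)
    qed auto
    then have "hom_induced (p-1) (top_of_set (U \<inter> V)) {} (top_of_set (U \<inter> V)) {} ?s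
      = hom_induced (p-1) (top_of_set (U \<inter> V)) {} (top_of_set (U \<inter> V)) {} id"
      by (rule homology_homotopy_empty)
    then show "hom_induced (p-1) (subtopology ?X (U \<inter> V)) {} (subtopology ?X (U \<inter> V)) {} ?s x = x"
      using x unfolding sub by (simp add: hom_induced_id)
  qed
qed

text \<open>\<open>k\<close> is a system of invariant coordinates, \<open>i\<close> a slice on which
  they are inverted, and \<open>h\<close> moves each point into the orbit of its slice point. The
  explicit \<open>k\<close> matters, because the effect of a sign change of \<open>d\<close> is
  later computed in these coordinates.\<close>

lemma retract_equivalence:
  fixes k :: "quad \<Rightarrow> 'b :: euclidean_space" and i :: "'b \<Rightarrow> quad" and h :: "real \<times> quad \<Rightarrow> quad"
  assumes S: "invariant S"
    and k: "continuous_on S k" "\<And>w. w \<in> S \<Longrightarrow> k w \<in> T" "\<And>f w. f \<in> rot3 \<Longrightarrow> w \<in> S \<Longrightarrow> k (act f w) = k w"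
    and i: "continuous_on T i" "\<And>x. x \<in> T \<Longrightarrow> i x \<in> S" "\<And>x. x \<in> T \<Longrightarrow> k (i x) = x"
    and h: "continuous_on ({0..1} \<times> S) h" "\<And>t w. t \<in> {0..1} \<Longrightarrow> w \<in> S \<Longrightarrow> h (t, w) \<in> S"
      "\<And>t f w. f \<in> rot3 \<Longrightarrow> h (t, act f w) = act f (h (t, w))"
      "\<And>w. h (0, w) = w" "\<And>w. w \<in> S \<Longrightarrow> orb (h (1, w)) = orb (i (k w))"
  shows "continuous_map (Q S) (top_of_set T) (\<lambda>x. k (rep x))"
    and "hom_induced p (Q S) {} (top_of_set T) {} (\<lambda>x. k (rep x))
      \<in> iso (reduced_homology_group p (Q S)) (reduced_homology_group p (top_of_set T))"
proof -
  have kr: "k (rep (orb w)) = k w" if "w \<in> S" for w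
    using rep_orb k(3) that by metis
  show c: "continuous_map (Q S) (top_of_set T) (\<lambda>x. k (rep x))"
    by (rule continuous_map_descend [OF S _ k(3)]) (use k in auto)
  have ci: "continuous_map (top_of_set T) (Q S) (orb \<circ> i)"
    by (rule continuous_map_compose [OF _ continuous_map_orb [OF S]]) (use i in auto)
  have "homotopic_with (\<lambda>f. f \<in> orb ` {} \<rightarrow> orb ` {}) (Q S) (Q S) id ((orb \<circ> i) \<circ> (\<lambda>x. k (rep x)))"
    by (rule homotopic_orb [OF S _ S h(1,2)]) (use h kr in auto)
  then have "homotopic_with (\<lambda>f. True) (Q S) (Q S) ((orb \<circ> i) \<circ> (\<lambda>x. k (rep x))) id"
    by (simp add: homotopic_with_symD)
  moreover have "homotopic_with (\<lambda>f. True) (top_of_set T) (top_of_set T) ((\<lambda>x. k (rep x)) \<circ> (orb \<circ> i)) id"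
    by (rule homotopic_with_equal) (use i kr continuous_map_compose [OF ci c] in auto)
  ultimately show "hom_induced p (Q S) {} (top_of_set T) {} (\<lambda>x. k (rep x))
      \<in> iso (reduced_homology_group p (Q S)) (reduced_homology_group p (top_of_set T))"
    by (rule homotopy_equivalence_reduced_homology_group_isomorphism [OF c ci])
qed

text \<open>For orthonormal \<open>n1\<close> and \<open>n3\<close> this is the rotation taking
  \<open>n1\<close> to \<open>e1\<close> and \<open>n3\<close> to \<open>e3\<close>, written by
  inner products so that it is visibly continuous in all arguments.\<close>

definition coords :: "real^3 \<Rightarrow> real^3 \<Rightarrow> real^3 \<Rightarrow> real^3" where
  "coords n1 n3 x = (x \<bullet> n1) *\<^sub>R e1 + (x \<bullet> cross3 n3 n1) *\<^sub>R e2 + (x \<bullet> n3) *\<^sub>R e3"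

lemma coords_rot3:
  assumes "norm n1 = 1" "norm n3 = 1" "n1 \<bullet> n3 = 0"
  shows "coords n1 n3 \<in> rot3" "coords n1 n3 n1 = e1" "coords n1 n3 n3 = e3"
proof -
  have n2: "norm (cross3 n3 n1) = 1"
    using norm_cross [of n3 n1] assms norm_ge_zero [of "cross3 n3 n1"] by (simp add: power2_eq_1_iff inner_commute)
  have n3: "cross3 n1 (cross3 n3 n1) = n3"
    using assms by (simp add: Lagrange dot_square_norm)
  obtain f where f: "f \<in> rot3" "f n1 = e1" "f n3 = e3"
    "\<And>x. f x = vector [x \<bullet> n1, x \<bullet> cross3 n3 n1, x \<bullet> n3]"
    using rot3_from_frame [OF assms(1) n2 dot_cross_self(2)] n3 by metis
  have "f = coords n1 n3"
    by (rule ext) (simp add: f(4) coords_def vec_eq_iff forall_3 axis_def)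
  with f show "coords n1 n3 \<in> rot3" "coords n1 n3 n1 = e1" "coords n1 n3 n3 = e3" by auto
qed

lemma coords_equivariant: "f \<in> rot3 \<Longrightarrow> coords (f n1) (f n3) (f x) = coords n1 n3 x"
  by (simp add: coords_def rot3_simps(6) rot3_simps(8) [symmetric])

lemma coords_standard [simp]: "coords e1 e3 x = x"
  unfolding coords_def cross_basis by (simp add: inner_axis basis3 [symmetric])

lemma continuous_on_coords [continuous_intros]:
  fixes f g h :: "'a :: t2_space \<Rightarrow> real^3"
  shows "continuous_on S f \<Longrightarrow> continuous_on S g \<Longrightarrow> continuous_on S h \<Longrightarrow> continuous_on S (\<lambda>x. coords (f x) (g x) (h x))"
  unfolding coords_def by (intro continuous_intros continuous_on_cross; assumption)

lemma frame_perp: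
  assumes "perp b d \<noteq> 0"
  shows "norm (sgn (perp b d)) = 1" "norm (sgn d) = 1" "sgn (perp b d) \<bullet> sgn d = 0"
proof -
  have "d \<noteq> 0" using assms by auto
  then show "norm (sgn (perp b d)) = 1" "norm (sgn d) = 1" "sgn (perp b d) \<bullet> sgn d = 0"
    using assms by (simp_all add: norm_sgn) (simp add: sgn_div_norm)
qed

lemma perp_e: "perp (e1 + r *\<^sub>R e3) e3 = e1"
  by (simp add: perp_add) (simp add: perp_def)

text \<open>On \<open>A2\<close> the vectors \<open>b\<close> and \<open>d\<close> are independent,
  and putting them into standard position uses up the rotation. Up to homotopy there remain the
  coordinates of \<open>a\<close> and the height of \<open>b\<close> along \<open>d\<close>;
  \<open>B2\<close> says that these four numbers are not all 0.\<close>

definition k2 :: "quad \<Rightarrow> (real^3) \<times> real" where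
  "k2 = (\<lambda>(a, b, c, d). (coords (sgn (perp b d)) (sgn d) a, b \<bullet> sgn d))"

lemma inner_segment2:
  assumes "d \<noteq> 0" "t \<in> {0..1}" "u \<bullet> d = 0"
  obtains k where "k > 0" "((1 - t) *\<^sub>R b + t *\<^sub>R (u + (b \<bullet> sgn d) *\<^sub>R sgn d)) \<bullet> ((1 - t) *\<^sub>R d + t *\<^sub>R sgn d)
     = k * (b \<bullet> d)"
proof -
  obtain k where k: "k > 0" "(1 - t) *\<^sub>R d + t *\<^sub>R sgn d = k *\<^sub>R d"
    by (rule sgn_segment [OF assms(1,2)])
  have "(b \<bullet> sgn d) * (sgn d \<bullet> d) = b \<bullet> d" using assms(1) by (simp add: sgn_inner)
  then have "((1 - t) *\<^sub>R b + t *\<^sub>R (u + (b \<bullet> sgn d) *\<^sub>R sgn d)) \<bullet> d = b \<bullet> d"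
    by (simp add: inner_add_left assms(3)) (simp add: algebra_simps)
  then show thesis by (intro that [OF k(1)]) (simp add: k(2))
qed

lemma perp_segment_sgn:
  assumes "perp c d \<noteq> 0" "t \<in> {0..1}"
  shows "perp ((1 - t) *\<^sub>R c + t *\<^sub>R (sgn (perp c d) + r *\<^sub>R sgn d)) ((1 - t) *\<^sub>R d + t *\<^sub>R sgn d) \<noteq> 0"
  using perp_segment [OF assms, of "r / norm d"] by (simp add: sgn_div_norm divide_inverse)

text \<open>On the slice \<open>d\<close> is \<open>e3\<close>, \<open>b\<close> is
  \<open>e1\<close> plus a multiple of \<open>e3\<close>, and \<open>c\<close> is 0. The deformation
  normalises \<open>d\<close> and the part of \<open>b\<close> perpendicular to it, and keeps the
  height of \<open>b\<close>.\<close>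

lemma A2_B2_retract:
  shows continuous_k2: "continuous_map (Q (A2 \<inter> B2)) (top_of_set (UNIV - {0})) (\<lambda>x. k2 (rep x))"
    and iso_k2: "hom_induced p (Q (A2 \<inter> B2)) {} (top_of_set (UNIV - {0})) {} (\<lambda>x. k2 (rep x))
      \<in> iso (reduced_homology_group p (Q (A2 \<inter> B2))) (reduced_homology_group p (top_of_set (UNIV - {0})))"
proof -
  let ?S = "A2 \<inter> B2" and ?T = "UNIV - {0} :: ((real^3) \<times> real) set"
  let ?h = "\<lambda>(t, a, b, c, d). (a, (1 - t) *\<^sub>R b + t *\<^sub>R (sgn (perp b d) + (b \<bullet> sgn d) *\<^sub>R sgn d),
     (1 - t) *\<^sub>R c, (1 - t) *\<^sub>R d + t *\<^sub>R sgn d)"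
  let ?i = "\<lambda>(x :: real^3, r :: real). (x, e1 + r *\<^sub>R e3, 0 :: real^3, e3)"
  have inv: "invariant ?S" by simp
  have kc: "continuous_on ?S k2"
    unfolding k2_def by (auto simp: case_prod_unfold set_defs intro!: continuous_intros)
  have kT: "k2 w \<in> ?T" if "w \<in> ?S" for w
  proof -
    obtain a b c d where [simp]: "w = (a, b, c, d)" by (cases w)
    have p: "perp b d \<noteq> 0" "d \<noteq> 0" and ab: "a \<noteq> 0 \<or> b \<bullet> d \<noteq> 0" using that by (auto simp: set_defs)
    then show ?thesis
      using rot3_simps(9) [OF coords_rot3(1) [OF frame_perp [OF p(1)]]]
      by (auto simp: k2_def zero_prod_def sgn_inner)
  qed
  have ki: "k2 (act f w) = k2 w" if "f \<in> rot3" for f w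
    using that by (cases w) (simp add: k2_def rot3_perp [symmetric] rot3_sgn [symmetric] coords_equivariant rot3_simps(6))
  have ic: "continuous_on ?T ?i" by (auto simp: case_prod_unfold intro!: continuous_intros)
  have iS: "?i x \<in> ?S" if "x \<in> ?T" for x
    using that by (cases x) (auto simp: set_defs perp_e inner_add_left zero_prod_def axis_eq_0_iff)
  have kix: "k2 (?i x) = x" for x
    by (cases x) (simp add: k2_def perp_e sgn_div_norm inner_add_left)
  have hc: "continuous_on ({0..1} \<times> ?S) ?h"
    by (auto simp: case_prod_unfold set_defs intro!: continuous_intros)
  have hS: "?h (t, w) \<in> ?S" if t: "t \<in> {0..1}" and w: "w \<in> ?S" for t w
  proof -
    obtain a b c d where [simp]: "w = (a, b, c, d)" by (cases w)
    have p: "perp b d \<noteq> 0" "d \<noteq> 0" and ab: "a \<noteq> 0 \<or> b \<bullet> d \<noteq> 0" using w by (auto simp: set_defs)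
    have "sgn (perp b d) \<bullet> d = 0" by (simp add: sgn_div_norm)
    then obtain k where "k > 0" "((1 - t) *\<^sub>R b + t *\<^sub>R (sgn (perp b d) + (b \<bullet> sgn d) *\<^sub>R sgn d)) \<bullet> ((1 - t) *\<^sub>R d + t *\<^sub>R sgn d)
     = k * (b \<bullet> d)"
      using inner_segment2 [OF p(2) t] by metis
    then show ?thesis
      using ab perp_segment_sgn [OF p(1) t] sgn_segment_nonzero [OF p(2) t] by (auto simp: set_defs)
  qed
  have he: "?h (t, act f w) = act f (?h (t, w))" if "f \<in> rot3" for t f w
    using that by (cases w) (simp add: equivariant)
  have h1: "orb (?h (1, w)) = orb (?i (k2 w))" if "w \<in> ?S" for w
  proof -
    obtain a b c d where [simp]: "w = (a, b, c, d)" by (cases w)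
    have p: "perp b d \<noteq> 0" using that by (auto simp: set_defs)
    note f = coords_rot3 [OF frame_perp [OF p]]
    show ?thesis
      unfolding orb_eq_iff
      by (rule bexI [OF _ f(1)]) (simp add: k2_def rot3_simps(1,3,4) [OF f(1)] f)
  qed
  show "continuous_map (Q ?S) (top_of_set ?T) (\<lambda>x. k2 (rep x))"
    by (rule retract_equivalence(1) [OF inv kc kT ki ic iS kix hc hS he _ h1]) auto
  show "hom_induced p (Q ?S) {} (top_of_set ?T) {} (\<lambda>x. k2 (rep x))
      \<in> iso (reduced_homology_group p (Q ?S)) (reduced_homology_group p (top_of_set ?T))"
    by (rule retract_equivalence(2) [OF inv kc kT ki ic iS kix hc hS he _ h1]) auto
qed

definition k3 :: "quad \<Rightarrow> (real^3) \<times> (real^3) \<times> real" where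
  "k3 = (\<lambda>(a, b, c, d). (coords (sgn (perp c d)) (sgn d) a, coords (sgn (perp c d)) (sgn d) b, c \<bullet> sgn d))"

text \<open>As for \<open>k2\<close>, with \<open>c\<close> in the role of \<open>b\<close>; now
  \<open>a\<close> and \<open>b\<close> are both free, which gives seven coordinates.\<close>

lemma iso_k3: "hom_induced p (Q (A3 \<inter> B3)) {} (top_of_set (UNIV - {0})) {} (\<lambda>x. k3 (rep x))
      \<in> iso (reduced_homology_group p (Q (A3 \<inter> B3))) (reduced_homology_group p (top_of_set (UNIV - {0})))"
proof -
  let ?S = "A3 \<inter> B3" and ?T = "UNIV - {0} :: ((real^3) \<times> (real^3) \<times> real) set"
  let ?h = "\<lambda>(t, a, b, c, d). (a, b, (1 - t) *\<^sub>R c + t *\<^sub>R (sgn (perp c d) + (c \<bullet> sgn d) *\<^sub>R sgn d),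
     (1 - t) *\<^sub>R d + t *\<^sub>R sgn d)"
  let ?i = "\<lambda>(x :: real^3, y :: real^3, r :: real). (x, y, e1 + r *\<^sub>R e3, e3)"
  have inv: "invariant ?S" by simp
  have kc: "continuous_on ?S k3"
    unfolding k3_def by (auto simp: case_prod_unfold set_defs intro!: continuous_intros)
  have kT: "k3 w \<in> ?T" if "w \<in> ?S" for w
  proof -
    obtain a b c d where [simp]: "w = (a, b, c, d)" by (cases w)
    have p: "perp c d \<noteq> 0" "d \<noteq> 0" and ab: "a \<noteq> 0 \<or> b \<noteq> 0 \<or> c \<bullet> d \<noteq> 0" using that by (auto simp: set_defs)
    then show ?thesis
      using rot3_simps(9) [OF coords_rot3(1) [OF frame_perp [OF p(1)]]]
      by (auto simp: k3_def zero_prod_def sgn_inner)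
  qed
  have ki: "k3 (act f w) = k3 w" if "f \<in> rot3" for f w
    using that by (cases w) (simp add: k3_def rot3_perp [symmetric] rot3_sgn [symmetric] coords_equivariant rot3_simps(6))
  have ic: "continuous_on ?T ?i" by (auto simp: case_prod_unfold intro!: continuous_intros)
  have iS: "?i x \<in> ?S" if "x \<in> ?T" for x
    using that by (cases x) (auto simp: set_defs perp_e inner_add_left zero_prod_def axis_eq_0_iff)
  have kix: "k3 (?i x) = x" for x
    by (cases x) (simp add: k3_def perp_e sgn_div_norm inner_add_left)
  have hc: "continuous_on ({0..1} \<times> ?S) ?h"
    by (auto simp: case_prod_unfold set_defs intro!: continuous_intros)
  have hS: "?h (t, w) \<in> ?S" if t: "t \<in> {0..1}" and w: "w \<in> ?S" for t w
  proof -
    obtain a b c d where [simp]: "w = (a, b, c, d)" by (cases w)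
    have p: "perp c d \<noteq> 0" "d \<noteq> 0" and ab: "a \<noteq> 0 \<or> b \<noteq> 0 \<or> c \<bullet> d \<noteq> 0" using w by (auto simp: set_defs)
    have "sgn (perp c d) \<bullet> d = 0" by (simp add: sgn_div_norm)
    then obtain k where "k > 0" "((1 - t) *\<^sub>R c + t *\<^sub>R (sgn (perp c d) + (c \<bullet> sgn d) *\<^sub>R sgn d)) \<bullet> ((1 - t) *\<^sub>R d + t *\<^sub>R sgn d)
     = k * (c \<bullet> d)"
      using inner_segment2 [OF p(2) t] by metis
    then show ?thesis
      using ab perp_segment_sgn [OF p(1) t] sgn_segment_nonzero [OF p(2) t] by (auto simp: set_defs)
  qed
  have he: "?h (t, act f w) = act f (?h (t, w))" if "f \<in> rot3" for t f w
    using that by (cases w) (simp add: equivariant)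
  have h1: "orb (?h (1, w)) = orb (?i (k3 w))" if "w \<in> ?S" for w
  proof -
    obtain a b c d where [simp]: "w = (a, b, c, d)" by (cases w)
    have p: "perp c d \<noteq> 0" using that by (auto simp: set_defs)
    note f = coords_rot3 [OF frame_perp [OF p]]
    show ?thesis
      unfolding orb_eq_iff
      by (rule bexI [OF _ f(1)]) (simp add: k3_def rot3_simps(1,3,4) [OF f(1)] f)
  qed
  show ?thesis
    by (rule retract_equivalence(2) [OF inv kc kT ki ic iS kix hc hS he _ h1]) auto
qed

section \<open>Equivariant maps and deformations between sets of orbits\<close>

lemma homotopic_orb_eq:
  fixes h :: "real \<times> quad \<Rightarrow> quad"
  assumes S: "invariant S" and T: "invariant T"
    and h: "continuous_on ({0..1} \<times> S) h" "\<And>t w. t \<in> {0..1} \<Longrightarrow> w \<in> S \<Longrightarrow> h (t, w) \<in> T"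
    and equi: "\<And>t f w. f \<in> rot3 \<Longrightarrow> h (t, act f w) = act f (h (t, w))"
    and F0: "\<And>w. w \<in> S \<Longrightarrow> F0 (orb w) = orb (h (0, w))"
    and F1: "\<And>w. w \<in> S \<Longrightarrow> F1 (orb w) = orb (h (1, w))"
  shows "homotopic_with (\<lambda>_. True) (Q S) (Q T) F0 F1"
  using homotopic_orb [OF S empty_subsetI T h, of "{}" F0 F1] equi F0 F1 by simp

definition orb_map :: "(quad \<Rightarrow> quad) \<Rightarrow> quad set \<Rightarrow> quad set" where
  "orb_map g x = orb (g (rep x))"

lemma orb_map_orb: "(\<And>f w. f \<in> rot3 \<Longrightarrow> g (act f w) = act f (g w)) \<Longrightarrow> orb_map g (orb w) = orb (g w)"
  unfolding orb_map_def using rep_orb [of w] orb_act by metis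

lemma continuous_orb_map:
  assumes "invariant S" "invariant T" "continuous_on S g" "\<And>w. w \<in> S \<Longrightarrow> g w \<in> T"
    and "\<And>f w. f \<in> rot3 \<Longrightarrow> g (act f w) = act f (g w)"
  shows "continuous_map (Q S) (Q T) (orb_map g)"
  unfolding orb_map_def
proof (rule continuous_map_descend [OF assms(1), where k = "\<lambda>w. orb (g w)"])
  have "continuous_map (top_of_set S) (Q T) (orb \<circ> g)"
    by (rule continuous_map_compose [OF _ continuous_map_orb [OF assms(2)]]) (use assms in auto)
  then show "continuous_map (top_of_set S) (Q T) (\<lambda>w. orb (g w))" by (simp add: o_def)
qed (use assms in simp)

lemma continuous_map_Q_id: "S \<subseteq> T \<Longrightarrow> continuous_map (Q S) (Q T) id"
  using subtopology_Q [of S T] continuous_map_from_subtopology continuous_map_id by metis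

lemma iso_orb_inclusion:
  fixes h :: "real \<times> quad \<Rightarrow> quad"
  assumes ST: "S \<subseteq> T" "invariant S" "invariant T"
    and g: "continuous_on T g" "\<And>w. w \<in> T \<Longrightarrow> g w \<in> S" "\<And>f w. f \<in> rot3 \<Longrightarrow> g (act f w) = act f (g w)"
    and h: "continuous_on ({0..1} \<times> T) h" "\<And>t w. t \<in> {0..1} \<Longrightarrow> w \<in> T \<Longrightarrow> h (t, w) \<in> T"
      "\<And>t w. t \<in> {0..1} \<Longrightarrow> w \<in> S \<Longrightarrow> h (t, w) \<in> S"
      "\<And>t f w. f \<in> rot3 \<Longrightarrow> h (t, act f w) = act f (h (t, w))"
      "\<And>w. h (0, w) = w" "\<And>w. h (1, w) = g w"
  shows "hom_induced p (Q S) {} (Q T) {} id \<in> iso (reduced_homology_group p (Q S)) (reduced_homology_group p (Q T))"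
proof (rule homotopy_equivalence_reduced_homology_group_isomorphism)
  show "continuous_map (Q S) (Q T) id" using ST continuous_map_Q_id by simp
  show "continuous_map (Q T) (Q S) (orb_map g)"
    by (rule continuous_orb_map) (use assms in auto)
  have "homotopic_with (\<lambda>_. True) (Q S) (Q S) id (orb_map g)"
    by (rule homotopic_orb_eq [of _ _ h])
      (use assms orb_map_orb [of g] in \<open>auto intro: continuous_on_subset [OF h(1)]\<close>)
  then show "homotopic_with (\<lambda>_. True) (Q S) (Q S) (orb_map g \<circ> id) id"
    by (simp add: homotopic_with_symD)
  have "homotopic_with (\<lambda>_. True) (Q T) (Q T) id (orb_map g)"
    by (rule homotopic_orb_eq [of _ _ h]) (use assms orb_map_orb [of g] in auto)
  then show "homotopic_with (\<lambda>_. True) (Q T) (Q T) (id \<circ> orb_map g) id"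
    by (simp add: homotopic_with_symD)
qed

lemma pos_segment_inner:
  fixes c d :: "real^3"
  assumes "c \<bullet> d > 0" "0 \<le> t" "t \<le> 1"
  shows "(1 - t) * (c \<bullet> d) + t * (d \<bullet> d) > 0" "(1 - t) * (c \<bullet> d) + t * (c \<bullet> c) > 0"
  using assms by (auto intro!: pos_segment)

text \<open>In \<open>Pos \<inter> Neg\<close> the two signs of \<open>c \<bullet> d\<close> exclude
  each other, so \<open>a\<close> or \<open>b\<close> is nonzero and \<open>c\<close> is
  unrestricted; it can move straight to \<open>d\<close>, where \<open>c \<bullet> d\<close> is
  positive.\<close>

lemma iso_Pos0_V3:
  "hom_induced p (Q (Pos0 \<inter> V3)) {} (Q (Pos \<inter> Neg)) {} id
    \<in> iso (reduced_homology_group p (Q (Pos0 \<inter> V3))) (reduced_homology_group p (Q (Pos \<inter> Neg)))"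
  by (rule iso_orb_inclusion [OF _ invariant_Int [OF invariant_sets(11,5)] invariant_Int [OF invariant_sets(9,10)], where g = "\<lambda>(a, b, c, d). (a, b, d, d)" and
        h = "\<lambda>(t, a, b, c, d). (a, b, (1 - t) *\<^sub>R c + t *\<^sub>R d, d)"])
    (auto simp: case_prod_unfold set_defs equivariant inner_add_left pos_segment_inner intro!: continuous_intros)

text \<open>Here it is \<open>d\<close> that is unrestricted in the larger set, and it moves to
  \<open>c\<close>.\<close>

lemma iso_Pos0_U3:
  "hom_induced p (Q (Pos0 \<inter> V3)) {} (Q (U3 \<inter> V3)) {} id
    \<in> iso (reduced_homology_group p (Q (Pos0 \<inter> V3))) (reduced_homology_group p (Q (U3 \<inter> V3)))"
  by (rule iso_orb_inclusion [OF _ invariant_Int [OF invariant_sets(11,5)] invariant_Int [OF invariant_sets(2,5)], where g = "\<lambda>(a, b, c, d). (a, b, c, c)" and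
        h = "\<lambda>(t, a, b, c, d). (a, b, c, (1 - t) *\<^sub>R d + t *\<^sub>R c)"])
    (auto simp: case_prod_unfold set_defs equivariant inner_add_right pos_segment_inner intro!: continuous_intros)

section \<open>The homology of the orbit space\<close>

text \<open>Invariance makes images under \<open>orb\<close> commute with intersections, so the two
  members of the cover meet in the orbit space of \<open>S \<inter> T\<close>.\<close>

locale orb_cover =
  fixes S T :: "quad set"
  assumes op: "open S" "open T" and inv: "invariant S" "invariant T" and ne: "S \<inter> T \<noteq> {}"
begin

lemma orb_Int: "orb ` S \<inter> orb ` T = orb ` (S \<inter> T)"
  by (rule orb_image_Int [OF inv])

sublocale cov: open_cover "Q (S \<union> T)" "orb ` S" "orb ` T"
  using openin_Q [OF op(1), of "S \<union> T"] openin_Q [OF op(2), of "S \<union> T"] ne orb_Int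
  by unfold_locales (auto simp: image_Un)

lemma sub_eqs: "subtopology (Q (S \<union> T)) (orb ` S) = Q S" "subtopology (Q (S \<union> T)) (orb ` T) = Q T"
  "subtopology (Q (S \<union> T)) (orb ` S \<inter> orb ` T) = Q (S \<inter> T)"
  "subtopology (Q S) (orb ` S \<inter> orb ` T) = Q (S \<inter> T)"
  "subtopology (Q T) (orb ` S \<inter> orb ` T) = Q (S \<inter> T)"
  unfolding orb_Int by (rule subtopology_Q; blast)+

lemmas excision = cov.excision [unfolded sub_eqs]
  and iso_rel = cov.iso_rel [unfolded sub_eqs]
  and suspension = cov.suspension [unfolded sub_eqs]
  and suspension_trivial = cov.suspension_trivial [unfolded sub_eqs]
  and trivial_cone = cov.trivial_cone [unfolded sub_eqs]
  and acyclic_union = cov.acyclic_union [unfolded sub_eqs]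
  and inclusion_iso = cov.inclusion_iso [unfolded sub_eqs]
  and minus_one_suspension = cov.minus_one_suspension [unfolded sub_eqs]
  and doubling = cov.doubling [unfolded sub_eqs]

end

lemma open_sets [simp]:
  "open U4" "open U3" "open U2" "open V2" "open V3" "open V4"
  "open A3" "open B3" "open Pos" "open Neg" "open Pos0"
  "open A2" "open B2"
  unfolding set_defs case_prod_unfold
  by (intro open_Collect_conj open_Collect_disj open_Collect_neq open_Collect_less continuous_intros)+

lemma e_perp [simp]: "perp e1 e3 = e1" "perp e2 e3 = e2" "e1 \<noteq> 0" "e2 \<noteq> 0" "e3 \<noteq> 0"
  by (simp_all add: perp_def axis_eq_0_iff)

lemma cover_unions: "A2 \<union> B2 = Pos \<inter> Neg" "Neg \<union> Pos = B3" "A3 \<union> B3 = U4 \<inter> V4" "U2 \<union> V2 = V3"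
  "V3 \<union> U3 = V4" "U4 \<union> V4 = UNIV - {0}"
proof -
  \<comment> \<open>A vector with no part perpendicular to \<open>d\<close> and none along
    \<open>d\<close> vanishes.\<close>
  have perp: "b = 0" if "perp b d = 0" "b \<bullet> d = 0" "d \<noteq> 0" for b d
    using that by (simp add: perp_orthogonal)
  then show "A2 \<union> B2 = Pos \<inter> Neg" "A3 \<union> B3 = U4 \<inter> V4"
    by (auto simp: set_defs)
  show "Neg \<union> Pos = B3" "U2 \<union> V2 = V3" "V3 \<union> U3 = V4" "U4 \<union> V4 = UNIV - {0}"
    by (auto simp: set_defs zero_prod_def)
qed

interpretation c2: orb_cover A2 B2
proof
  have "(0, e1 + e3, 0, e3) \<in> A2 \<inter> B2" by (simp add: set_defs perp_add inner_add_left)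
  then show "A2 \<inter> B2 \<noteq> {}" by blast
qed simp_all

interpretation cN: orb_cover Neg Pos
proof
  have "(e1, 0, 0, e3) \<in> Neg \<inter> Pos" by (simp add: set_defs)
  then show "Neg \<inter> Pos \<noteq> {}" by blast
qed simp_all

interpretation c3: orb_cover A3 B3
proof
  have "(0, 0, e1 + e3, e3) \<in> A3 \<inter> B3" by (simp add: set_defs perp_add inner_add_left)
  then show "A3 \<inter> B3 \<noteq> {}" by blast
qed simp_all

interpretation cV3: orb_cover U2 V2
proof
  have "(e1, e1, 0, 0) \<in> U2 \<inter> V2" by (simp add: set_defs)
  then show "U2 \<inter> V2 \<noteq> {}" by blast
qed simp_all

interpretation cV4: orb_cover V3 U3
proof
  have "(e1, e1, e1, 0) \<in> V3 \<inter> U3" by (simp add: set_defs)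
  then show "V3 \<inter> U3 \<noteq> {}" by blast
qed simp_all

interpretation cX: orb_cover U4 V4
proof
  have "(e1, e1, e1, e1) \<in> U4 \<inter> V4" by (simp add: set_defs)
  then show "U4 \<inter> V4 \<noteq> {}" by blast
qed simp_all

lemma acyclic_sets [simp]:
  "acyclic_space (Q U4)" "acyclic_space (Q U3)" "acyclic_space (Q U2)" "acyclic_space (Q V2)" "acyclic_space (Q (U2 \<inter> V2))"
  "acyclic_space (Q A3)" "acyclic_space (Q Pos)" "acyclic_space (Q Neg)" "acyclic_space (Q Pos0)" "acyclic_space (Q A2)" "acyclic_space (Q B2)"
proof -
  have "(0, 0, e3, e3) \<in> Pos0" by (simp add: set_defs)
  then have "Pos0 \<noteq> {}" by blast
  then show "acyclic_space (Q U4)" "acyclic_space (Q U3)" "acyclic_space (Q U2)" "acyclic_space (Q V2)" "acyclic_space (Q (U2 \<inter> V2))"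
    "acyclic_space (Q A3)" "acyclic_space (Q Pos)" "acyclic_space (Q Neg)" "acyclic_space (Q Pos0)" "acyclic_space (Q A2)" "acyclic_space (Q B2)"
    using cX.ne cV4.ne cV3.ne c3.ne cN.ne c2.ne
    by (auto intro!: contractible_imp_acyclic contractible_U4 contractible_U3 contractible_U2 contractible_V2
        contractible_U2_V2 contractible_A3 contractible_Pos contractible_Neg contractible_Pos0
        contractible_A2 contractible_B2)
qed

section \<open>Homology of the pieces of the covers\<close>

definition sphere_like :: "int \<Rightarrow> 'a topology \<Rightarrow> bool" where
  "sphere_like n X \<longleftrightarrow> reduced_homology_group n X \<cong> integer_group \<and>
     (\<forall>p. p \<noteq> n \<longrightarrow> trivial_group (reduced_homology_group p X))"

lemma sphere_like_transfer:
  assumes "sphere_like n Y" "\<And>p. reduced_homology_group p X \<cong> reduced_homology_group (p - k) Y"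
  shows "sphere_like (n + k) X"
proof -
  have "reduced_homology_group (n + k) X \<cong> integer_group"
    using assms(1) assms(2) [of "n + k"] unfolding sphere_like_def by (metis add_diff_cancel_right' iso_trans)
  moreover have "trivial_group (reduced_homology_group p X)" if "p \<noteq> n + k" for p
    using assms(1) assms(2) [of p] that unfolding sphere_like_def
    by (metis diff_add_cancel group_reduced_homology_group isomorphic_group_triviality)
  ultimately show ?thesis by (simp add: sphere_like_def)
qed

lemma sphere_like_punctured:
  "sphere_like (int DIM('a) - 1) (top_of_set (UNIV - {0} :: 'a :: euclidean_space set))"
  using homology_punctured unfolding sphere_like_def by blast

text \<open>The slices have dimensions 4 and 7, whence the degrees 3 here and 6 in the next
  lemma.\<close>

lemma sphere_like_A2_B2: "sphere_like 3 (Q (A2 \<inter> B2))"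
proof -
  have "sphere_like 3 (top_of_set (UNIV - {0} :: ((real^3) \<times> real) set))"
    using sphere_like_punctured [where 'a = "(real^3) \<times> real"] by simp
  from sphere_like_transfer [OF this, of "Q (A2 \<inter> B2)" 0] show ?thesis
    using is_isoI [OF iso_k2] by simp
qed

lemma sphere_like_A3_B3: "sphere_like 6 (Q (A3 \<inter> B3))"
proof -
  have "sphere_like 6 (top_of_set (UNIV - {0} :: ((real^3) \<times> (real^3) \<times> real) set))"
    using sphere_like_punctured [where 'a = "(real^3) \<times> (real^3) \<times> real"] by simp
  from sphere_like_transfer [OF this, of "Q (A3 \<inter> B3)" 0] show ?thesis
    using is_isoI [OF iso_k3] by simp
qed

text \<open>Both members of the cover are acyclic, so the union is a suspension for homology; the
  same holds for \<open>B3\<close> below.\<close>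

lemma sphere_like_Pos_Neg: "sphere_like 4 (Q (Pos \<inter> Neg))"
  using sphere_like_transfer [OF sphere_like_A2_B2, of "Q (A2 \<union> B2)" 1] c2.suspension
  by (simp add: cover_unions)

lemma sphere_like_B3: "sphere_like 5 (Q B3)"
  using sphere_like_transfer [OF sphere_like_Pos_Neg, of "Q (Neg \<union> Pos)" 1] cN.suspension
  by (simp add: cover_unions Int_commute)

lemma acyclic_V3 [simp]: "acyclic_space (Q V3)"
  using cV3.acyclic_union by (simp add: cover_unions)

text \<open>In acyclic spaces the boundary identifies relative groups with those of the subspaces
  one degree lower, and it is natural.\<close>

lemma pair_iso_acyclic:
  assumes "acyclic_space X" "acyclic_space Y" "topspace X \<inter> S \<noteq> {}" "topspace Y \<inter> T \<noteq> {}"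
    and f: "continuous_map X Y f" "f \<in> S \<rightarrow> T"
    and iso: "hom_induced (p-1) (subtopology X S) {} (subtopology Y T) {} f
      \<in> iso (reduced_homology_group (p-1) (subtopology X S)) (reduced_homology_group (p-1) (subtopology Y T))"
  shows "hom_induced p X S Y T f \<in> iso (relative_homology_group p X S) (relative_homology_group p Y T)"
proof (rule iso_cancel_left)
  show "hom_boundary p Y T \<in> iso (relative_homology_group p Y T) (reduced_homology_group (p-1) (subtopology Y T))"
    by (rule iso_boundary_acyclic_space [OF assms(2,4)])
  show "hom_induced p X S Y T f \<in> hom (relative_homology_group p X S) (relative_homology_group p Y T)"
    by (rule hom_induced_hom)
  show "hom_induced (p-1) (subtopology X S) {} (subtopology Y T) {} f \<circ> hom_boundary p X S
    \<in> iso (relative_homology_group p X S) (reduced_homology_group (p-1) (subtopology Y T))"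
    by (rule iso_set_trans [OF iso_boundary_acyclic_space [OF assms(1,3)] iso])
qed (use naturality_hom_induced [OF f, of p] in \<open>simp add: fun_eq_iff\<close>)

lemma pair_iso_orb:
  assumes "acyclic_space (Q S)" "acyclic_space (Q T)" "A \<subseteq> S" "B \<subseteq> T" "S \<subseteq> T" "A \<subseteq> B" "A \<noteq> {}"
    and "hom_induced (p-1) (Q A) {} (Q B) {} id
      \<in> iso (reduced_homology_group (p-1) (Q A)) (reduced_homology_group (p-1) (Q B))"
  shows "hom_induced p (Q S) (orb ` A) (Q T) (orb ` B) id
    \<in> iso (relative_homology_group p (Q S) (orb ` A)) (relative_homology_group p (Q T) (orb ` B))"
proof (rule pair_iso_acyclic)
  obtain w where "w \<in> A" using assms by blast
  then have "orb w \<in> orb ` S \<inter> orb ` A" "orb w \<in> orb ` T \<inter> orb ` B" using assms by auto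
  then show "topspace (Q S) \<inter> orb ` A \<noteq> {}" "topspace (Q T) \<inter> orb ` B \<noteq> {}"
    unfolding topspace_Q by blast+
qed (use assms in \<open>auto simp: continuous_map_Q_id subtopology_Q\<close>)

text \<open>The isomorphism required by \<open>doubling\<close>. Both pairs are compared with
  \<open>(Pos0, Pos0 \<inter> V3)\<close>: it includes into \<open>(Pos, Neg \<inter> Pos)\<close>
  and into \<open>(U3, V3 \<inter> U3)\<close>, each time between acyclic spaces with equivalent
  subspaces, and the last pair excises into \<open>(V4, V3)\<close>.\<close>

lemma phi_iso:
  "hom_induced p (Q Pos) (orb ` Neg \<inter> orb ` Pos) (Q V4) (orb ` V3) id
     \<in> iso (relative_homology_group p (Q Pos) (orb ` Neg \<inter> orb ` Pos)) (relative_homology_group p (Q V4) (orb ` V3))"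
proof (rule iso_cancel_right)
  let ?A = "Pos0 \<inter> V3"
  have sub: "Pos0 \<subseteq> Pos" "?A \<subseteq> Neg \<inter> Pos" "Pos0 \<subseteq> U3" "?A \<subseteq> V3 \<inter> U3" by (auto simp: set_defs)
  have ne: "?A \<noteq> {}"
  proof -
    have "(e1, 0, e3, e3) \<in> ?A" by (simp add: set_defs)
    then show ?thesis by blast
  qed
  show "hom_induced p (Q Pos0) (orb ` ?A) (Q Pos) (orb ` Neg \<inter> orb ` Pos) id
    \<in> iso (relative_homology_group p (Q Pos0) (orb ` ?A)) (relative_homology_group p (Q Pos) (orb ` Neg \<inter> orb ` Pos))"
    unfolding cN.orb_Int
    by (rule pair_iso_orb) (use sub ne iso_Pos0_V3 in \<open>auto simp: Int_commute\<close>)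
  show "hom_induced p (Q Pos) (orb ` Neg \<inter> orb ` Pos) (Q V4) (orb ` V3) id
    \<in> hom (relative_homology_group p (Q Pos) (orb ` Neg \<inter> orb ` Pos)) (relative_homology_group p (Q V4) (orb ` V3))"
    by (rule hom_induced_hom)
  have "hom_induced p (Q Pos0) (orb ` ?A) (Q U3) (orb ` V3 \<inter> orb ` U3) id
    \<in> iso (relative_homology_group p (Q Pos0) (orb ` ?A)) (relative_homology_group p (Q U3) (orb ` V3 \<inter> orb ` U3))"
    unfolding cV4.orb_Int
    by (rule pair_iso_orb) (use sub ne iso_Pos0_U3 in \<open>auto simp: Int_commute\<close>)
  from iso_set_trans [OF this cV4.excision]
  show "hom_induced p (Q U3) (orb ` V3 \<inter> orb ` U3) (Q V4) (orb ` V3) id \<circ>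
      hom_induced p (Q Pos0) (orb ` ?A) (Q U3) (orb ` V3 \<inter> orb ` U3) id
    \<in> iso (relative_homology_group p (Q Pos0) (orb ` ?A)) (relative_homology_group p (Q V4) (orb ` V3))"
    by (simp add: cover_unions)
  have maps: "id \<in> orb ` ?A \<rightarrow> orb ` Neg \<inter> orb ` Pos" "id \<in> orb ` ?A \<rightarrow> orb ` V3 \<inter> orb ` U3"
    "id \<in> orb ` Neg \<inter> orb ` Pos \<rightarrow> orb ` V3" "id \<in> orb ` V3 \<inter> orb ` U3 \<rightarrow> orb ` V3"
  proof -
    have "Neg \<inter> Pos \<subseteq> V3" by (auto simp: set_defs)
    then show "id \<in> orb ` Neg \<inter> orb ` Pos \<rightarrow> orb ` V3" unfolding cN.orb_Int by auto
  qed (use sub in auto)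
  have c: "continuous_map (Q Pos0) (Q Pos) id" "continuous_map (Q Pos) (Q V4) id"
    "continuous_map (Q Pos0) (Q U3) id" "continuous_map (Q U3) (Q V4) id"
    by (auto intro!: continuous_map_Q_id simp: set_defs)
  fix x
  show "hom_induced p (Q Pos) (orb ` Neg \<inter> orb ` Pos) (Q V4) (orb ` V3) id
     (hom_induced p (Q Pos0) (orb ` ?A) (Q Pos) (orb ` Neg \<inter> orb ` Pos) id x) =
    (hom_induced p (Q U3) (orb ` V3 \<inter> orb ` U3) (Q V4) (orb ` V3) id \<circ>
      hom_induced p (Q Pos0) (orb ` ?A) (Q U3) (orb ` V3 \<inter> orb ` U3) id) x"
    using c maps by (simp add: hom_induced_compose')
qed

lemma rel_iso_V4:
  "hom_induced p (Q V4) {} (Q V4) (orb ` V3) id \<in> iso (reduced_homology_group p (Q V4)) (relative_homology_group p (Q V4) (orb ` V3))"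
  by (rule iso_pair_acyclic_subspace) (simp add: subtopology_Q set_defs [symmetric] cover_unions(5) [symmetric])

text \<open>As \<open>V3\<close> is acyclic, the homology of \<open>V4\<close> is that of
  \<open>(V4, V3)\<close>; \<open>phi_iso\<close> carries it to
  \<open>(Pos, Neg \<inter> Pos)\<close>, and the boundary carries it on to
  \<open>Pos \<inter> Neg\<close>.\<close>

lemma sphere_like_V4: "sphere_like 5 (Q V4)"
proof -
  have "reduced_homology_group p (Q V4) \<cong> reduced_homology_group (p - 1) (Q (Pos \<inter> Neg))" for p
  proof -
    have "reduced_homology_group p (Q V4) \<cong> relative_homology_group p (Q V4) (orb ` V3)"
      by (rule is_isoI [OF rel_iso_V4])
    also have "\<dots> \<cong> relative_homology_group p (Q Pos) (orb ` Neg \<inter> orb ` Pos)"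
      by (rule group.iso_sym [OF _ is_isoI [OF phi_iso]]) simp
    also have "\<dots> \<cong> reduced_homology_group (p - 1) (Q (Pos \<inter> Neg))"
    proof -
      have "topspace (Q Pos) \<inter> (orb ` Neg \<inter> orb ` Pos) \<noteq> {}"
        using cN.ne cN.orb_Int by auto
      from is_isoI [OF iso_boundary_acyclic_space [OF _ this, of p]] show ?thesis
        by (simp add: cN.sub_eqs Int_commute)
    qed
    finally show ?thesis .
  qed
  from sphere_like_transfer [OF sphere_like_Pos_Neg this] show ?thesis by simp
qed

section \<open>The sign change of \<open>d\<close> and the factor 2\<close>

definition flip4 :: "quad \<Rightarrow> quad" where "flip4 = (\<lambda>(a, b, c, d). (a, b, c, - d))"

lemma flip4_act: "f \<in> rot3 \<Longrightarrow> flip4 (act f w) = act f (flip4 w)"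
  by (cases w) (simp add: flip4_def rot3_simps)

lemma continuous_flip4: "continuous_on S flip4"
  by (auto simp: flip4_def case_prod_unfold intro!: continuous_intros)

lemma flip4_sets: "w \<in> A2 \<Longrightarrow> flip4 w \<in> A2" "w \<in> B2 \<Longrightarrow> flip4 w \<in> B2" "w \<in> Pos \<Longrightarrow> flip4 w \<in> Neg"
  "w \<in> Neg \<Longrightarrow> flip4 w \<in> Pos" "w \<in> B3 \<Longrightarrow> flip4 w \<in> B3"
  by (auto simp: set_defs flip4_def)

abbreviation "flip \<equiv> orb_map flip4"

lemma flip_orb [simp]: "flip (orb w) = orb (flip4 w)"
  using flip4_act by (rule orb_map_orb)

lemma continuous_flip: "invariant S \<Longrightarrow> (\<And>w. w \<in> S \<Longrightarrow> flip4 w \<in> S) \<Longrightarrow> continuous_map (Q S) (Q S) flip"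
  by (rule continuous_orb_map) (auto simp: continuous_flip4 flip4_act)

lemma minus_one_homotopic:
  assumes "homotopic_with (\<lambda>_. True) X X s t" "acts_as_minus_one p X t"
  shows "acts_as_minus_one p X s"
  using assms homology_homotopy_empty [OF assms(1), of p] by (simp add: acts_as_minus_one_def)

text \<open>A half-turn in the plane of the second and third coordinates, reached through the angles
  \<open>pi * t\<close>, absorbs two of the three reflections.\<close>

lemma minus_one_three_reflections:
  assumes "p \<ge> 2"
  shows "acts_as_minus_one p (top_of_set (UNIV - {0}))
    (\<lambda>(x :: real^3, r :: real). ((x $ 1) *\<^sub>R e1 - (x $ 2) *\<^sub>R e2 - (x $ 3) *\<^sub>R e3, - r))" (is "acts_as_minus_one p ?X ?s")
proof (rule minus_one_homotopic [OF _ minus_one_reflection [OF assms]])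
  define h :: "real \<times> (real^3) \<times> real \<Rightarrow> (real^3) \<times> real" where
    "h = (\<lambda>(t, x, r). ((x $ 1) *\<^sub>R e1 + (x $ 2 * cos (pi * t) - x $ 3 * sin (pi * t)) *\<^sub>R e2
       + (x $ 2 * sin (pi * t) + x $ 3 * cos (pi * t)) *\<^sub>R e3, - r))"
  \<comment> \<open>Rotating the plane preserves the norm, so the homotopy avoids 0.\<close>
  have rotation: "(x\<^sup>2 + y\<^sup>2) * (s\<^sup>2 + c\<^sup>2) = (x * c - y * s)\<^sup>2 + (x * s + y * c)\<^sup>2" for x y s c :: real
    by (simp add: power2_eq_square algebra_simps)
  have nz: "h (t, z) \<noteq> 0" if "z \<noteq> 0" for t z
  proof
    obtain x r where [simp]: "z = (x, r)" by (cases z)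
    assume "h (t, z) = 0"
    then have 0: "(x $ 1) *\<^sub>R e1 + (x $ 2 * cos (pi * t) - x $ 3 * sin (pi * t)) *\<^sub>R e2
       + (x $ 2 * sin (pi * t) + x $ 3 * cos (pi * t)) *\<^sub>R e3 = 0" "r = 0"
      by (auto simp: h_def zero_prod_def)
    then have x: "x $ 1 = 0" "x $ 2 * cos (pi * t) - x $ 3 * sin (pi * t) = 0"
      "x $ 2 * sin (pi * t) + x $ 3 * cos (pi * t) = 0"
      by (simp_all add: vec_eq_iff forall_3 axis_def)
    have "(x $ 2)\<^sup>2 + (x $ 3)\<^sup>2 = ((x $ 2)\<^sup>2 + (x $ 3)\<^sup>2) * ((sin (pi * t))\<^sup>2 + (cos (pi * t))\<^sup>2)"
      by simp
    also have "\<dots> = (x $ 2 * cos (pi * t) - x $ 3 * sin (pi * t))\<^sup>2 + (x $ 2 * sin (pi * t) + x $ 3 * cos (pi * t))\<^sup>2"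
      by (rule rotation)
    also have "\<dots> = 0" using x by simp
    finally have "x $ 2 = 0" "x $ 3 = 0" by (simp_all add: sum_power2_eq_zero_iff)
    then have "x = 0" using x by (simp add: vec_eq_iff forall_3)
    then show False using that 0 by (simp add: zero_prod_def)
  qed
  have "homotopic_with (\<lambda>_. True) ?X ?X (\<lambda>(x, r). (x, - r)) ?s"
    unfolding homotopic_with_def
  proof (intro exI conjI)
    have "continuous_on ({0..1} \<times> (UNIV - {0})) h"
      unfolding h_def case_prod_unfold by (intro continuous_intros)
    then show "continuous_map (prod_topology (top_of_set {0..1}) ?X) ?X h"
      unfolding prod_topology_subtopology using nz
      by (auto simp: subtopology_subtopology Times_Int_Times)
    show "\<forall>z. h (0, z) = (case z of (x, r) \<Rightarrow> (x, - r))"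
      by (auto simp: h_def basis3 [symmetric])
  qed (auto simp: h_def)
  then show "homotopic_with (\<lambda>_. True) ?X ?X ?s (\<lambda>(x, r). (x, - r))"
    by (rule homotopic_with_symD)
qed

text \<open>Replacing \<open>d\<close> by \<open>- d\<close> keeps \<open>perp b d\<close>. In the
  frame of \<open>k2\<close> the first axis therefore stays, the second and third are reversed, and
  the height of \<open>b\<close> changes sign: three reflections in four coordinates.\<close>

lemma minus_one_A2_B2: "acts_as_minus_one 3 (Q (A2 \<inter> B2)) flip"
proof (rule minus_one_transfer)
  let ?X = "top_of_set (UNIV - {0 :: (real^3) \<times> real})"
  let ?s = "\<lambda>(x :: real^3, r :: real). ((x $ 1) *\<^sub>R e1 - (x $ 2) *\<^sub>R e2 - (x $ 3) *\<^sub>R e3, - r)"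
  show "continuous_map (Q (A2 \<inter> B2)) (Q (A2 \<inter> B2)) flip"
    by (rule continuous_flip) (auto simp: flip4_sets)
  have "?s z \<noteq> 0" if "z \<noteq> 0" for z
  proof
    assume "?s z = 0"
    then have "fst z $ 1 = 0" "fst z $ 2 = 0" "fst z $ 3 = 0" "snd z = 0"
      by (auto simp: case_prod_unfold zero_prod_def vec_eq_iff forall_3 axis_def)
    then show False using that by (simp add: prod_eq_iff vec_eq_iff forall_3)
  qed
  moreover have "continuous_on (UNIV - {0}) ?s"
    unfolding case_prod_unfold by (intro continuous_intros)
  ultimately show "continuous_map ?X ?X ?s" by auto
  show "continuous_map (Q (A2 \<inter> B2)) ?X (\<lambda>x. k2 (rep x))" by (rule continuous_k2)
  show "inj_on (hom_induced 3 (Q (A2 \<inter> B2)) {} ?X {} (\<lambda>x. k2 (rep x))) (carrier (homology_group 3 (Q (A2 \<inter> B2))))"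
    using iso_k2 [of 3] by (simp add: un_reduced_homology_group iso_def bij_betw_def)
  show "acts_as_minus_one 3 ?X ?s" by (rule minus_one_three_reflections) simp
  fix x assume "x \<in> topspace (Q (A2 \<inter> B2))"
  then obtain w where w: "x = orb w" by auto
  have k2: "k2 (rep (orb w)) = k2 w" for w
  proof -
    obtain f where "f \<in> rot3" "rep (orb w) = act f w" by (rule rep_orb)
    then show ?thesis
      by (cases w) (simp add: k2_def rot3_perp [symmetric] rot3_sgn [symmetric] coords_equivariant rot3_simps(6))
  qed
  obtain a b c d where [simp]: "w = (a, b, c, d)" by (cases w)
  show "k2 (rep (flip x)) = ?s (k2 (rep x))"
    unfolding w flip_orb k2
    by (simp add: flip4_def k2_def coords_def sgn_minus) (simp add: vec_eq_iff forall_3 axis_def)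
qed

text \<open>The sign change preserves \<open>A2\<close> and \<open>B2\<close> separately, so its
  sign passes to their suspension.\<close>

lemma minus_one_Pos_Neg: "acts_as_minus_one 4 (Q (Pos \<inter> Neg)) flip"
proof -
  have "continuous_map (Q (A2 \<union> B2)) (Q (A2 \<union> B2)) flip"
    by (rule continuous_flip) (auto simp: flip4_sets)
  moreover have "flip \<in> orb ` A2 \<rightarrow> orb ` A2" "flip \<in> orb ` B2 \<rightarrow> orb ` B2"
    using flip4_sets by auto
  ultimately show ?thesis
    using c2.minus_one_suspension [of 4 flip] minus_one_A2_B2 by (simp add: cover_unions)
qed

text \<open>\<open>doubling\<close> is applied to \<open>B3\<close>, covered by \<open>Neg\<close>
  and \<open>Pos\<close>, which the sign change exchanges. The squares it produces in H_5(V4, V3)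
  are pulled back to H_5(V4), which is possible because \<open>V3\<close> is acyclic.\<close>

lemma image_B3_V4:
  "hom_induced 5 (Q B3) {} (Q V4) {} id ` carrier (homology_group 5 (Q B3))
    = (\<lambda>y. y \<otimes>\<^bsub>homology_group 5 (Q V4)\<^esub> y) ` carrier (homology_group 5 (Q V4))"
proof -
  let ?D = "orb ` Neg \<inter> orb ` Pos"
  let ?R = "relative_homology_group 5 (Q V4) (orb ` V3)" and ?H = "homology_group 5 (Q V4)"
  let ?j = "hom_induced 5 (Q V4) {} (Q V4) (orb ` V3) id" and ?i = "hom_induced 5 (Q B3) {} (Q V4) {} id"
  have D: "?D = orb ` (Neg \<inter> Pos)" by (rule cN.orb_Int)
  have B3V4: "B3 \<subseteq> V4" "Neg \<inter> Pos \<subseteq> V3" "Neg \<inter> Pos \<subseteq> B3" by (auto simp: set_defs)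
  \<comment> \<open>In \<open>V4\<close> the vector \<open>d\<close> may vanish, so scaling it
    through 0 joins the sign change to the identity. At \<open>d = 0\<close> the condition of
    \<open>B3\<close> still leaves \<open>a\<close>, \<open>b\<close> or \<open>c\<close> nonzero,
    and that of \<open>Neg \<inter> Pos\<close> leaves \<open>a\<close> or \<open>b\<close>
    nonzero.\<close>
  have "homotopic_with (\<lambda>f. f \<in> orb ` (Neg \<inter> Pos) \<rightarrow> orb ` V3) (Q B3) (Q V4) flip id"
  proof (rule homotopic_orb [OF invariant_sets(8) _ invariant_sets(6),
        where h = "\<lambda>(t, a, b, c, d). (a, b, c, (2 * t - 1) *\<^sub>R d)"])
    fix w assume "w \<in> B3"
    show "flip (orb w) = orb (case (0, w) of (t, a, b, c, d) \<Rightarrow> (a, b, c, (2 * t - 1) *\<^sub>R d))"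
      unfolding flip_orb by (cases w) (simp add: flip4_def)
    show "id (orb w) = orb (case (1, w) of (t, a, b, c, d) \<Rightarrow> (a, b, c, (2 * t - 1) *\<^sub>R d))"
      by (cases w) simp
  next
    fix t :: real and f w assume "f \<in> rot3"
    then show "orb (case (t, act f w) of (t, a, b, c, d) \<Rightarrow> (a, b, c, (2 * t - 1) *\<^sub>R d)) =
       orb (case (t, w) of (t, a, b, c, d) \<Rightarrow> (a, b, c, (2 * t - 1) *\<^sub>R d))"
      by (intro equivariant_orb) (auto simp: rot3_simps)
  qed (auto simp: case_prod_unfold set_defs intro!: continuous_intros)
  then have sY: "hom_induced 5 (Q B3) ?D (Q V4) (orb ` V3) flip = hom_induced 5 (Q B3) ?D (Q V4) (orb ` V3) id"
    unfolding D by (rule homology_homotopy_axiom)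
  have "continuous_map (Q (Neg \<union> Pos)) (Q (Neg \<union> Pos)) flip"
    by (rule continuous_flip) (auto simp: flip4_sets)
  moreover have "flip \<in> orb ` Pos \<rightarrow> orb ` Neg" "flip \<in> ?D \<rightarrow> ?D"
    unfolding D using flip4_sets by auto
  moreover have "?D \<subseteq> orb ` V3" unfolding D using B3V4 by blast
  ultimately have "(\<lambda>z. ?j (?i z)) ` carrier (homology_group 5 (Q B3)) = (\<lambda>y. y \<otimes>\<^bsub>?R\<^esub> y) ` carrier ?R"
    using cN.doubling [of 5 flip "Q V4" "orb ` V3"] minus_one_Pos_Neg sY phi_iso [of 5]
      continuous_map_Q_id [OF B3V4(1)]
    by (simp add: cover_unions Int_commute)
  also have "\<dots> = ?j ` (\<lambda>y. y \<otimes>\<^bsub>?H\<^esub> y) ` carrier ?H"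
  proof -
    have j: "?j \<in> iso ?H ?R" using rel_iso_V4 [of 5] by (simp add: un_reduced_homology_group)
    then have "carrier ?R = ?j ` carrier ?H" by (simp add: iso_def bij_betw_def)
    moreover have "?j y \<otimes>\<^bsub>?R\<^esub> ?j y = ?j (y \<otimes>\<^bsub>?H\<^esub> y)" if "y \<in> carrier ?H" for y
      using that by (simp add: hom_mult [OF hom_induced_hom])
    ultimately show ?thesis by (simp add: image_image)
  qed
  finally have "?j ` (?i ` carrier (homology_group 5 (Q B3))) = ?j ` (\<lambda>y. y \<otimes>\<^bsub>?H\<^esub> y) ` carrier ?H"
    by (simp add: image_image)
  moreover have "inj_on ?j (carrier ?H)" using rel_iso_V4 [of 5] by (simp add: un_reduced_homology_group iso_def bij_betw_def)
  moreover have "?i ` carrier (homology_group 5 (Q B3)) \<subseteq> carrier ?H"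
    by (auto simp: hom_induced_carrier)
  moreover have "(\<lambda>y. y \<otimes>\<^bsub>?H\<^esub> y) ` carrier ?H \<subseteq> carrier ?H"
    by (auto intro!: monoid.m_closed group.is_monoid)
  ultimately show ?thesis by (simp add: inj_on_image_eq_iff)
qed

text \<open>\<open>A3\<close> is acyclic, so this is the cone of a map from a space with the
  homology of the 6-sphere to one with that of the 5-sphere. No degrees interact: degree 5 comes
  from \<open>B3\<close>, and degree 7 is degree 6 of \<open>A3 \<inter> B3\<close> raised by
  one.\<close>

lemma C4_homology:
  shows "p \<noteq> 5 \<Longrightarrow> p \<noteq> 7 \<Longrightarrow> trivial_group (reduced_homology_group p (Q (U4 \<inter> V4)))"
    and "reduced_homology_group 5 (Q (U4 \<inter> V4)) \<cong> integer_group"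
    and "reduced_homology_group 7 (Q (U4 \<inter> V4)) \<cong> integer_group"
    and "hom_induced 5 (Q B3) {} (Q (U4 \<inter> V4)) {} id \<in> iso (reduced_homology_group 5 (Q B3)) (reduced_homology_group 5 (Q (U4 \<inter> V4)))"
proof -
  note s = sphere_like_A3_B3 [unfolded sphere_like_def] sphere_like_B3 [unfolded sphere_like_def]
  show "trivial_group (reduced_homology_group p (Q (U4 \<inter> V4)))" if "p \<noteq> 5" "p \<noteq> 7"
    using c3.trivial_cone [of p] s that by (simp add: cover_unions)
  show iso: "hom_induced 5 (Q B3) {} (Q (U4 \<inter> V4)) {} id \<in> iso (reduced_homology_group 5 (Q B3)) (reduced_homology_group 5 (Q (U4 \<inter> V4)))"
    using c3.inclusion_iso [of 5] s by (simp add: cover_unions)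
  show "reduced_homology_group 5 (Q (U4 \<inter> V4)) \<cong> integer_group"
    by (rule iso_trans [OF group.iso_sym [OF group_reduced_homology_group is_isoI [OF iso]]]) (use s in blast)
  have "reduced_homology_group 7 (Q (U4 \<inter> V4)) \<cong> reduced_homology_group 6 (Q (A3 \<inter> B3))"
    using c3.suspension_trivial [of 7] s by (simp add: cover_unions)
  then show "reduced_homology_group 7 (Q (U4 \<inter> V4)) \<cong> integer_group"
    by (rule iso_trans) (use s in blast)
qed

lemma image_C4_V4:
  "hom_induced 5 (Q (U4 \<inter> V4)) {} (Q V4) {} id ` carrier (homology_group 5 (Q (U4 \<inter> V4)))
    = (\<lambda>y. y \<otimes>\<^bsub>homology_group 5 (Q V4)\<^esub> y) ` carrier (homology_group 5 (Q V4))"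
proof -
  have sub: "B3 \<subseteq> U4 \<inter> V4" "U4 \<inter> V4 \<subseteq> V4" by (auto simp: set_defs)
  have "carrier (homology_group 5 (Q (U4 \<inter> V4))) = hom_induced 5 (Q B3) {} (Q (U4 \<inter> V4)) {} id ` carrier (homology_group 5 (Q B3))"
    using C4_homology(4) by (simp add: un_reduced_homology_group iso_def bij_betw_def)
  note eq = this
  have comp: "hom_induced 5 (Q (U4 \<inter> V4)) {} (Q V4) {} id (hom_induced 5 (Q B3) {} (Q (U4 \<inter> V4)) {} id x)
     = hom_induced 5 (Q B3) {} (Q V4) {} id x" for x
    using continuous_map_Q_id [OF sub(1)] continuous_map_Q_id [OF sub(2)]
    by (simp add: hom_induced_compose')
  show ?thesis
    unfolding eq image_image comp by (rule image_B3_V4)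
qed

text \<open>Generators turn \<open>i\<close> into multiplication by an integer \<open>c\<close>, and
  2 is a multiple of \<open>c\<close> because the image consists of the squares; so \<open>c\<close>
  is nonzero. Describing the image by squares avoids naming generators. For the second part,
  \<open>C\<close> and \<open>integer_mod_group 2\<close> are quotients of \<open>B\<close> by the
  same subgroup.\<close>

lemma doubling_hom:
  fixes A :: "'a monoid" and B :: "'b monoid"
  assumes A: "group A" "A \<cong> integer_group" and B: "group B" "B \<cong> integer_group" and i: "i \<in> hom A B"
    and im: "i ` carrier A = (\<lambda>y. y \<otimes>\<^bsub>B\<^esub> y) ` carrier B"
  shows "inj_on i (carrier A)"
    and "\<And>(C :: 'c monoid) j. group C \<Longrightarrow> j \<in> hom B C \<Longrightarrow> j ` carrier B = carrier C \<Longrightarrow> kernel B C j = i ` carrier A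
      \<Longrightarrow> C \<cong> integer_mod_group 2"
proof -
  obtain f where f: "f \<in> iso integer_group A"
    using group.iso_sym [OF A] by (auto simp: is_iso_def)
  obtain g where g: "g \<in> iso B integer_group"
    using B(2) by (auto simp: is_iso_def)
  have gm: "g (x \<otimes>\<^bsub>B\<^esub> y) = g x + g y" if "x \<in> carrier B" "y \<in> carrier B" for x y
    using that g by (simp add: iso_def hom_def)
  have gb: "bij_betw g (carrier B) UNIV" using g by (simp add: iso_def)
  define c where "c = g (i (f 1))"
  have "g \<circ> i \<circ> f \<in> hom integer_group integer_group"
    using f i g by (auto simp: iso_def intro!: Group.hom_compose)
  then have add: "g (i (f (m + n))) = g (i (f m)) + g (i (f n))" for m n
    by (simp add: hom_def)
  have c: "g (i (f n)) = n * c" for n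
  proof (induction n rule: int_induct [where k = 0])
    case base
    show ?case using add [of 0 0] by simp
  next
    case (step1 n)
    then show ?case using add [of n 1] by (simp add: c_def algebra_simps)
  next
    case (step2 n)
    then show ?case using add [of "n - 1" 1] by (simp add: c_def algebra_simps)
  qed
  obtain y where y: "y \<in> carrier B" "g y = 1"
    using gb by (metis UNIV_I bij_betw_iff_bijections)
  then have "y \<otimes>\<^bsub>B\<^esub> y \<in> i ` carrier A" using im by auto
  then obtain x where "x \<in> carrier A" "i x = y \<otimes>\<^bsub>B\<^esub> y" by auto
  moreover obtain n where "x = f n"
    using f \<open>x \<in> carrier A\<close> by (auto simp: iso_def bij_betw_def image_iff)
  ultimately have "n * c = 2" using c [of n] gm [of y y] y by simp
  then have "c \<noteq> 0" by auto
  show "inj_on i (carrier A)"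
  proof (rule inj_onI)
    fix x y assume xy: "x \<in> carrier A" "y \<in> carrier A" "i x = i y"
    have "carrier A = range f" using f by (simp add: iso_def bij_betw_def)
    then obtain m n where "x = f m" "y = f n" using xy by auto
    then have "m * c = n * c" using xy(3) by (metis c)
    then show "x = y" using \<open>c \<noteq> 0\<close> \<open>x = f m\<close> \<open>y = f n\<close> by simp
  qed
  fix C :: "'c monoid" and j assume C: "group C" and j: "j \<in> hom B C" "j ` carrier B = carrier C" "kernel B C j = i ` carrier A"
  \<comment> \<open>Parity read through the isomorphism \<open>g\<close>; its kernel is the set of
    squares.\<close>
  let ?q = "\<lambda>y. g y mod 2"
  have q: "?q \<in> hom B (integer_mod_group 2)"
    using gm by (auto simp: hom_def carrier_integer_mod_group mod_add_eq)
  interpret q: group_hom B "integer_mod_group 2" ?q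
    using B q by (simp add: group_hom_def group_hom_axioms_def group_integer_mod_group)
  interpret j: group_hom B C j
    using B C j by (simp add: group_hom_def group_hom_axioms_def)
  have "?q ` carrier B = carrier (integer_mod_group 2)"
  proof -
    have "g ` carrier B = UNIV" using gb by (simp add: bij_betw_def)
    have "?q ` carrier B = (\<lambda>n. n mod 2) ` (g ` carrier B)" by (simp add: image_image)
    also have "\<dots> = range (\<lambda>n::int. n mod 2)" unfolding \<open>g ` carrier B = UNIV\<close> ..
    also have "\<dots> = {0..<2}"
    proof
      show "{0..<2} \<subseteq> range (\<lambda>n::int. n mod 2)"
      proof
        fix n :: int assume "n \<in> {0..<2}"
        then have "n = n mod 2" by simp
        then show "n \<in> range (\<lambda>n::int. n mod 2)" by blast
      qed
    qed auto
    finally show ?thesis by (simp add: carrier_integer_mod_group)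
  qed
  then have 1: "B Mod kernel B (integer_mod_group 2) ?q \<cong> integer_mod_group 2" by (rule q.FactGroup_iso)
  have "kernel B (integer_mod_group 2) ?q = (\<lambda>y. y \<otimes>\<^bsub>B\<^esub> y) ` carrier B"
  proof
    show "(\<lambda>y. y \<otimes>\<^bsub>B\<^esub> y) ` carrier B \<subseteq> kernel B (integer_mod_group 2) ?q"
      using gm by (auto simp: kernel_def)
    show "kernel B (integer_mod_group 2) ?q \<subseteq> (\<lambda>y. y \<otimes>\<^bsub>B\<^esub> y) ` carrier B"
    proof
      fix z assume "z \<in> kernel B (integer_mod_group 2) ?q"
      then have z: "z \<in> carrier B" "g z mod 2 = 0" by (auto simp: kernel_def)
      obtain w where w: "w \<in> carrier B" "g w = g z div 2"
        using gb by (metis UNIV_I bij_betw_iff_bijections)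
      then have "g (w \<otimes>\<^bsub>B\<^esub> w) = g z" using gm [of w w] z by presburger
      then have "w \<otimes>\<^bsub>B\<^esub> w = z" using gb w z by (metis bij_betw_def inj_onD q.G.m_closed)
      then show "z \<in> (\<lambda>y. y \<otimes>\<^bsub>B\<^esub> y) ` carrier B" using w by auto
    qed
  qed
  then have "B Mod kernel B C j \<cong> integer_mod_group 2" using 1 im j by simp
  then show "C \<cong> integer_mod_group 2"
    using j.FactGroup_iso [OF j(2)] group.iso_sym [OF normal.factorgroup_is_group [OF j.normal_kernel]] iso_trans by metis
qed

text \<open>Since \<open>U4\<close> is acyclic, for \<open>p \<noteq> 0\<close> the group is that of
  \<open>V4\<close> relative to \<open>U4 \<inter> V4\<close>. In the exact sequence of this pair
  the only map between nontrivial reduced groups is the doubling in degree 5: its cokernel is H_5,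
  its trivial kernel makes H_6 vanish, and degree 7 of the intersection becomes H_8.\<close>

theorem homology_orbits:
  "homology_group 0 (Q (UNIV - {0})) \<cong> integer_group"
  "homology_group 8 (Q (UNIV - {0})) \<cong> integer_group"
  "homology_group 5 (Q (UNIV - {0})) \<cong> integer_mod_group 2"
  "p \<noteq> 0 \<Longrightarrow> p \<noteq> 5 \<Longrightarrow> p \<noteq> 8 \<Longrightarrow> trivial_group (homology_group p (Q (UNIV - {0})))"
proof -
  note V4 = sphere_like_V4 [unfolded sphere_like_def]
  note C4 = C4_homology(1-3)
  let ?C = "orb ` U4 \<inter> orb ` V4"
  let ?R = "\<lambda>p. relative_homology_group p (Q V4) ?C"
  let ?i = "hom_induced 5 (Q (U4 \<inter> V4)) {} (Q V4) {} id"
  let ?j = "hom_induced 5 (Q V4) {} (Q V4) ?C id"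
  have inv: "invariant (UNIV - {0})" unfolding cover_unions(6) [symmetric] by simp
  have rel: "homology_group p (Q (UNIV - {0})) \<cong> ?R p" if "p \<noteq> 0" for p
    using cX.iso_rel [of p] that by (simp add: cover_unions un_reduced_homology_group)
  have "path_connectedin euclidean (UNIV - {0 :: quad})"
    using path_connected_punctured_universe [of "0 :: quad"] by (simp add: Compl_eq_Diff_UNIV)
  then have "path_connected_space (Q (UNIV - {0}))"
    using path_connected_space_quotient_map_image [OF quotient_map_orb [OF inv]]
    by (simp add: path_connectedin_def)
  moreover have "UNIV - {0 :: quad} \<noteq> {}" using cX.ne cover_unions(6) by blast
  ultimately show "homology_group 0 (Q (UNIV - {0})) \<cong> integer_group"
    by (intro isomorphic_integer_zeroth_homology_group) auto
  have "reduced_homology_group 8 (Q (UNIV - {0})) \<cong> reduced_homology_group 7 (Q (U4 \<inter> V4))"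
    using cX.suspension_trivial [of 8] V4 by (simp add: cover_unions)
  then show "homology_group 8 (Q (UNIV - {0})) \<cong> integer_group"
    using iso_trans [OF _ C4(3)] by (simp add: un_reduced_homology_group)
  have H5: "reduced_homology_group 5 Y = homology_group 5 Y" for Y :: "quad set topology"
    by (simp add: un_reduced_homology_group)
  have iso: "homology_group 5 (Q (U4 \<inter> V4)) \<cong> integer_group" "homology_group 5 (Q V4) \<cong> integer_group"
    using C4(2) V4 by (simp_all add: H5)
  note dbl = doubling_hom [OF _ iso(1) _ iso(2) hom_induced_hom image_C4_V4, simplified]
  have ne: "topspace (Q V4) \<inter> ?C \<noteq> {}" using cX.ne cX.orb_Int by auto
  have e1: "exact_seq ([reduced_homology_group 4 (Q (U4 \<inter> V4)), ?R 5, homology_group 5 (Q V4)],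
     [hom_boundary 5 (Q V4) ?C, ?j])"
    using homology_exactness_reduced_1 [OF ne, of 5] by (simp add: cX.sub_eqs H5)
  have e3: "exact_seq ([?R 5, homology_group 5 (Q V4), homology_group 5 (Q (U4 \<inter> V4))], [?j, ?i])"
    using homology_exactness_axiom_3 [of 5 "Q V4" ?C] by (simp add: cX.sub_eqs)
  \<comment> \<open>Surjective because the next group in the sequence, in degree 4 of the
    intersection, is trivial.\<close>
  have "?j ` carrier (homology_group 5 (Q V4)) = carrier (?R 5)"
  proof -
    have "?j ` carrier (homology_group 5 (Q V4)) = kernel (?R 5) (reduced_homology_group 4 (Q (U4 \<inter> V4))) (hom_boundary 5 (Q V4) ?C)"
      using e1 by simp
    also have "\<dots> = carrier (?R 5)"
      using C4(1) [of 4] hom_boundary_reduced_hom [of 5 "Q V4" ?C]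
      by (auto simp: kernel_def trivial_group_def hom_def cX.sub_eqs)
    finally show ?thesis .
  qed
  moreover have "kernel (homology_group 5 (Q V4)) (?R 5) ?j = ?i ` carrier (homology_group 5 (Q (U4 \<inter> V4)))"
    using e3 by simp
  ultimately have "?R 5 \<cong> integer_mod_group 2"
    by (intro dbl(2)) (auto simp: hom_induced_hom)
  then show "homology_group 5 (Q (UNIV - {0})) \<cong> integer_mod_group 2"
    using iso_trans [OF rel [of 5]] by simp
  \<comment> \<open>In degree 6 the vanishing of neighbours does not suffice, since the intersection
    has homology in degree 5. Injectivity of the doubling makes the boundary trivial.\<close>
  have triv6: "trivial_group (?R 6)"
  proof -
    have e1: "exact_seq ([reduced_homology_group 5 (Q (U4 \<inter> V4)), ?R 6, reduced_homology_group 6 (Q V4)],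
       [hom_boundary 6 (Q V4) ?C, hom_induced 6 (Q V4) {} (Q V4) ?C id])"
      using homology_exactness_reduced_1 [OF ne, of 6] by (simp add: cX.sub_eqs)
    have e2: "exact_seq ([homology_group 5 (Q V4), homology_group 5 (Q (U4 \<inter> V4)), ?R 6],
       [?i, hom_boundary 6 (Q V4) ?C])"
      using homology_exactness_axiom_2 [of 6 "Q V4" ?C] by (simp add: cX.sub_eqs)
    have b: "hom_boundary 6 (Q V4) ?C x = \<one>\<^bsub>homology_group 5 (Q (U4 \<inter> V4))\<^esub>" if x: "x \<in> carrier (?R 6)" for x
    proof -
      have "hom_boundary 6 (Q V4) ?C x \<in> kernel (homology_group 5 (Q (U4 \<inter> V4))) (homology_group 5 (Q V4)) ?i"
        using e2 x by auto
      then have k: "hom_boundary 6 (Q V4) ?C x \<in> carrier (homology_group 5 (Q (U4 \<inter> V4)))"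
        "?i (hom_boundary 6 (Q V4) ?C x) = \<one>\<^bsub>homology_group 5 (Q V4)\<^esub>" by (auto simp: kernel_def)
      moreover have "?i \<one>\<^bsub>homology_group 5 (Q (U4 \<inter> V4))\<^esub> = \<one>\<^bsub>homology_group 5 (Q V4)\<^esub>"
        by (rule hom_one [OF hom_induced_hom]) auto
      ultimately show ?thesis
        using dbl(1) by (metis group.is_monoid group_relative_homology_group inj_onD monoid.one_closed)
    qed
    have "carrier (?R 6) = kernel (?R 6) (reduced_homology_group 5 (Q (U4 \<inter> V4))) (hom_boundary 6 (Q V4) ?C)"
      using b by (auto simp: kernel_def one_reduced_homology_group)
    also have "\<dots> = hom_induced 6 (Q V4) {} (Q V4) ?C id ` carrier (reduced_homology_group 6 (Q V4))"
      using e1 by simp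
    also have "\<dots> = {hom_induced 6 (Q V4) {} (Q V4) ?C id \<one>\<^bsub>reduced_homology_group 6 (Q V4)\<^esub>}"
      using V4 by (auto simp: trivial_group_def)
    finally obtain c where "carrier (?R 6) = {c}" by metis
    then show ?thesis
      by (metis group.is_monoid group.trivial_group_alt group_relative_homology_group order_refl)
  qed
  show "trivial_group (homology_group p (Q (UNIV - {0})))" if p: "p \<noteq> 0" "p \<noteq> 5" "p \<noteq> 8"
  proof (cases "p = 6")
    case True
    have "trivial_group (homology_group 6 (Q (UNIV - {0}))) = trivial_group (?R 6)"
      by (rule isomorphic_group_triviality [OF rel]) simp_all
    then show ?thesis using triv6 True by simp
  next
    case False
    then have "trivial_group (reduced_homology_group p (Q (UNIV - {0})))"
      using cX.trivial_cone [of p] V4 C4(1) [of "p - 1"] p by (simp add: cover_unions)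
    then show ?thesis using p by (simp add: un_reduced_homology_group)
  qed
qed

section \<open>Spinors and rotations\<close>

text \<open>The coordinates, in terms of Pauli matrices, of the trace-free part of the Hermitian
  matrix \<open>\<psi> \<psi>\<^sup>*\<close> with \<open>\<psi> = (x, y)\<close>.\<close>

definition spin :: "complex \<Rightarrow> complex \<Rightarrow> real^3" where
  "spin x y = vector [Re (x * cnj y), Im (x * cnj y), ((cmod x)\<^sup>2 - (cmod y)\<^sup>2) / 2]"

lemma spin_components [simp]: "spin x y $ 1 = Re (x * cnj y)" "spin x y $ 2 = Im (x * cnj y)"
  "spin x y $ 3 = ((cmod x)\<^sup>2 - (cmod y)\<^sup>2) / 2"
  by (simp_all add: spin_def)

lemma norm_spin: "norm (spin x y) = ((cmod x)\<^sup>2 + (cmod y)\<^sup>2) / 2"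
proof -
  have "(norm (spin x y))\<^sup>2 = (Re (x * cnj y))\<^sup>2 + (Im (x * cnj y))\<^sup>2 + (((cmod x)\<^sup>2 - (cmod y)\<^sup>2) / 2)\<^sup>2"
    by (simp add: norm_vec_def L2_set_def sum_3 sum_nonneg)
  also have "(Re (x * cnj y))\<^sup>2 + (Im (x * cnj y))\<^sup>2 = (cmod x)\<^sup>2 * (cmod y)\<^sup>2"
    unfolding cmod_power2 [symmetric] by (simp add: norm_mult power_mult_distrib)
  also have "\<dots> + (((cmod x)\<^sup>2 - (cmod y)\<^sup>2) / 2)\<^sup>2 = (((cmod x)\<^sup>2 + (cmod y)\<^sup>2) / 2)\<^sup>2"
    by (simp add: power2_eq_square field_simps)
  finally show ?thesis by (simp add: power2_eq_iff_nonneg)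
qed

text \<open>The norm and the third coordinate force the squared modulus of the first component to be
  \<open>norm w + w $ 3\<close>. It can be taken real, and the other two coordinates then determine
  the second component. Where this number is 0, the vector points down the third axis and the first
  component is 0.\<close>

lemma spin_surj:
  obtains x y where "spin x y = w"
proof (cases "norm w + w $ 3 = 0")
  case True
  have "(w $ 1)\<^sup>2 + (w $ 2)\<^sup>2 + (w $ 3)\<^sup>2 = (norm w)\<^sup>2"
    by (simp add: norm_vec_def L2_set_def sum_3 sum_nonneg)
  moreover have "w $ 3 = - norm w" using True by simp
  ultimately have "w $ 1 = 0" "w $ 2 = 0" by (simp_all add: sum_power2_eq_zero_iff)
  then have "spin 0 (complex_of_real (sqrt (2 * norm w))) = w"
    using \<open>w $ 3 = - norm w\<close> by (simp add: vec_eq_iff forall_3)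
  then show thesis by (rule that)
next
  case False
  have "\<bar>w $ 3\<bar> \<le> norm w" by (rule component_le_norm_cart)
  then have pos: "norm w + w $ 3 > 0" using False by linarith
  define r where "r = sqrt (norm w + w $ 3)"
  define c where "c = Complex (w $ 1) (w $ 2)"
  have r: "r > 0" "r\<^sup>2 = norm w + w $ 3" using pos by (simp_all add: r_def)
  have "(cmod c)\<^sup>2 = (w $ 1)\<^sup>2 + (w $ 2)\<^sup>2" by (simp add: c_def cmod_power2)
  also have "\<dots> = (norm w)\<^sup>2 - (w $ 3)\<^sup>2"
    by (simp add: norm_vec_def L2_set_def sum_3 sum_nonneg)
  also have "\<dots> = (norm w - w $ 3) * r\<^sup>2" unfolding r(2) by (simp add: power2_eq_square algebra_simps)
  finally have cc: "(cmod c)\<^sup>2 = (norm w - w $ 3) * r\<^sup>2" .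
  have cr: "(cmod c)\<^sup>2 / r\<^sup>2 = norm w - w $ 3" unfolding cc using r(1) by simp
  have "complex_of_real r * cnj (cnj c / complex_of_real r) = c" using r by simp
  moreover have "(cmod (complex_of_real r))\<^sup>2 - (cmod (cnj c / complex_of_real r))\<^sup>2 = 2 * w $ 3"
    using r cr by (simp add: norm_divide power_divide)
  ultimately have "spin (complex_of_real r) (cnj c / complex_of_real r) = w"
    by (simp add: vec_eq_iff forall_3 c_def)
  then show thesis by (rule that)
qed

text \<open>The norm and the third coordinate recover both moduli, and \<open>x * cnj y\<close>
  recovers the relative phase; only a common phase is lost. Vanishing components carry no phase and
  are treated separately.\<close>

lemma spin_eq_phase:
  assumes "spin x y = spin x' y'"
  obtains s where "cmod s = 1" "x' = s * x" "y' = s * y"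
proof -
  have c: "x * cnj y = x' * cnj y'"
    using assms by (metis complex_eqI spin_components(1,2))
  have "(cmod x)\<^sup>2 - (cmod y)\<^sup>2 = (cmod x')\<^sup>2 - (cmod y')\<^sup>2"
    using arg_cong [OF assms, of "\<lambda>w. w $ 3"] by simp
  moreover have "(cmod x)\<^sup>2 + (cmod y)\<^sup>2 = (cmod x')\<^sup>2 + (cmod y')\<^sup>2"
    using arg_cong [OF assms, of norm] by (simp add: norm_spin)
  ultimately have "(cmod x)\<^sup>2 = (cmod x')\<^sup>2" "(cmod y)\<^sup>2 = (cmod y')\<^sup>2" by linarith+
  then have n: "cmod x = cmod x'" "cmod y = cmod y'" by (simp_all add: power2_eq_iff_nonneg)
  show thesis
  proof (cases "x = 0")
    case True
    then have "x' = 0" using n by simp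
    show ?thesis
    proof (cases "y = 0")
      case True
      then show ?thesis using that [of 1] \<open>x = 0\<close> \<open>x' = 0\<close> n by simp
    next
      case False
      then have "y' \<noteq> 0" using n by auto
      then show ?thesis using that [of "y' / y"] False \<open>x = 0\<close> \<open>x' = 0\<close> n by (simp add: norm_divide)
    qed
  next
    case False
    define s where "s = x' / x"
    have "x' \<noteq> 0" using False n(1) by (metis norm_eq_zero)
    then have s: "cmod s = 1" "x' = s * x" using False n by (simp_all add: s_def norm_divide)
    then have "x * cnj y = x * (s * cnj y')" using c by (simp add: mult_ac)
    then have "cnj y = s * cnj y'" using False by simp
    then have "s * y = s * cnj s * y'" by (metis complex_cnj_cnj complex_cnj_mult mult.assoc)
    also have "s * cnj s = 1" using s(1) by (metis complex_norm_square mult_cancel_right1 norm_one of_real_1 power_one)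
    finally show ?thesis using that s by simp
  qed
qed

lemma spin_phase: "cmod s = 1 \<Longrightarrow> spin (s * x) (s * y) = spin x y"
proof -
  assume s: "cmod s = 1"
  then have "s * cnj s = 1" by (metis complex_norm_square of_real_1 power_one)
  have "s * x * cnj (s * y) = (s * cnj s) * (x * cnj y)" by (simp add: mult_ac)
  then have "s * x * cnj (s * y) = x * cnj y" using \<open>s * cnj s = 1\<close> by simp
  then show ?thesis by (simp only: spin_def norm_mult s mult_1)
qed

definition unitary2 :: "complex \<Rightarrow> complex \<Rightarrow> complex \<Rightarrow> complex \<Rightarrow> bool" where
  "unitary2 a b c d \<longleftrightarrow> (cmod a)\<^sup>2 + (cmod b)\<^sup>2 = 1 \<and> (cmod c)\<^sup>2 + (cmod d)\<^sup>2 = 1 \<and> a * cnj c + b * cnj d = 0"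

lemma frame_map:
  assumes "norm u = 1" "norm v = 1" "u \<bullet> v = 0" "cross3 u v = w"
  shows "\<exists>f \<in> rot3. \<forall>x. f x = x $ 1 *\<^sub>R u + x $ 2 *\<^sub>R v + x $ 3 *\<^sub>R w"
proof -
  obtain g where g: "g \<in> rot3" "g e1 = u" "g e2 = v" "g e3 = cross3 u v"
    by (rule rot3_to_frame [OF assms(1-3)])
  have "g x = x $ 1 *\<^sub>R u + x $ 2 *\<^sub>R v + x $ 3 *\<^sub>R w" for x
    by (subst basis3 [of x]) (simp only: rot3_simps(1,3) [OF g(1)] g assms(4))
  then show ?thesis using g(1) by blast
qed

lemma norm3: "norm w = 1 \<longleftrightarrow> (w $ 1)\<^sup>2 + (w $ 2)\<^sup>2 + (w $ 3)\<^sup>2 = 1" for w :: "real^3"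
  by (simp add: norm_vec_def L2_set_def sum_3)

text \<open>\<open>u\<close>, \<open>v\<close>, \<open>w\<close> are the columns of the image of the
  matrix under the double cover from SU(2) to SO(3). That they form an oriented orthonormal frame
  reduces to polynomial identities in which powers of the squared norm of \<open>(a, b)\<close>,
  equal to 1, factor out.\<close>

lemma rotation_SU2:
  assumes "(cmod a)\<^sup>2 + (cmod b)\<^sup>2 = 1"
  obtains f where "f \<in> rot3" "\<And>x y. spin (a * x + b * y) (- cnj b * x + cnj a * y) = f (spin x y)"
proof -
  obtain a1 a2 b1 b2 where ab: "a = Complex a1 a2" "b = Complex b1 b2" by (metis complex.exhaust)
  have n: "a1\<^sup>2 + a2\<^sup>2 + b1\<^sup>2 + b2\<^sup>2 = 1"
    using assms by (simp add: ab cmod_power2)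
  define u :: "real^3" where "u = vector [a1\<^sup>2 - a2\<^sup>2 - b1\<^sup>2 + b2\<^sup>2, 2 * a1 * a2 - 2 * b1 * b2, 2 * (a1 * b1 + a2 * b2)]"
  define v :: "real^3" where "v = vector [- 2 * a1 * a2 - 2 * b1 * b2, a1\<^sup>2 - a2\<^sup>2 + b1\<^sup>2 - b2\<^sup>2, 2 * (a1 * b2 - a2 * b1)]"
  define w :: "real^3" where "w = vector [- 2 * (a1 * b1 - a2 * b2), - 2 * (a1 * b2 + a2 * b1), a1\<^sup>2 + a2\<^sup>2 - b1\<^sup>2 - b2\<^sup>2]"
  have "(u $ 1)\<^sup>2 + (u $ 2)\<^sup>2 + (u $ 3)\<^sup>2 = (a1\<^sup>2 + a2\<^sup>2 + b1\<^sup>2 + b2\<^sup>2)\<^sup>2"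
    unfolding u_def vector_3 by (simp add: power2_eq_square algebra_simps)
  then have u: "norm u = 1" using n by (simp add: norm3)
  have "(v $ 1)\<^sup>2 + (v $ 2)\<^sup>2 + (v $ 3)\<^sup>2 = (a1\<^sup>2 + a2\<^sup>2 + b1\<^sup>2 + b2\<^sup>2)\<^sup>2"
    unfolding v_def vector_3 by (simp add: power2_eq_square algebra_simps)
  then have v: "norm v = 1" using n by (simp add: norm3)
  have "u $ 1 * v $ 1 + u $ 2 * v $ 2 + u $ 3 * v $ 3 = 0"
    unfolding u_def v_def vector_3 by (simp add: power2_eq_square algebra_simps)
  then have uv: "u \<bullet> v = 0" by (simp add: inner_vec_def sum_3)
  have "cross3 u v $ 1 = (a1\<^sup>2 + a2\<^sup>2 + b1\<^sup>2 + b2\<^sup>2) * w $ 1"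
    "cross3 u v $ 2 = (a1\<^sup>2 + a2\<^sup>2 + b1\<^sup>2 + b2\<^sup>2) * w $ 2"
    "cross3 u v $ 3 = (a1\<^sup>2 + a2\<^sup>2 + b1\<^sup>2 + b2\<^sup>2) * w $ 3"
    unfolding cross_components u_def v_def w_def vector_3 by (simp_all add: power2_eq_square algebra_simps)
  then have "cross3 u v = w" using n by (simp add: vec_eq_iff forall_3)
  then obtain f where f: "f \<in> rot3" "\<And>x. f x = x $ 1 *\<^sub>R u + x $ 2 *\<^sub>R v + x $ 3 *\<^sub>R w"
    using frame_map [OF u v uv] by blast
  have "spin (a * x + b * y) (- cnj b * x + cnj a * y) = f (spin x y)" for x y
  proof -
    obtain x1 x2 y1 y2 where xy: "x = Complex x1 x2" "y = Complex y1 y2" by (metis complex.exhaust)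
    show ?thesis
      unfolding f(2) vec_eq_iff forall_3
      by (simp add: ab xy u_def v_def w_def cmod_power2, intro conjI)
        (simp_all add: field_simps power2_eq_square)
  qed
  then show thesis using that f(1) by blast
qed

text \<open>The diagonal matrix with entries 1 and \<open>e\<close> turns vectors about the third
  axis. The images of \<open>e1\<close> and \<open>e3\<close> are recorded so that a given rotation
  about this axis can be recognised as one of these.\<close>

lemma rotation_phase:
  assumes "cmod e = 1"
  obtains f where "f \<in> rot3" "\<And>x y. spin x (e * y) = f (spin x y)"
    "f e1 = vector [Re e, - Im e, 0]" "f e3 = e3"
proof -
  obtain c s where e: "e = Complex c s" by (metis complex.exhaust)
  have n: "c\<^sup>2 + s\<^sup>2 = 1" using assms by (simp add: e cmod_def)
  define u :: "real^3" where "u = vector [c, - s, 0]"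
  define v :: "real^3" where "v = vector [s, c, 0]"
  have u: "norm u = 1" "norm v = 1" using n by (simp_all add: norm3 u_def v_def)
  have uv: "u \<bullet> v = 0" by (simp add: inner_vec_def sum_3 u_def v_def)
  have "cross3 u v = e3"
    using n by (simp add: vec_eq_iff forall_3 cross_components u_def v_def axis_def power2_eq_square)
  then obtain f where f: "f \<in> rot3" "\<And>x. f x = x $ 1 *\<^sub>R u + x $ 2 *\<^sub>R v + x $ 3 *\<^sub>R e3"
    using frame_map [OF u uv] by blast
  have "spin x (e * y) = f (spin x y)" for x y
  proof -
    obtain x1 x2 y1 y2 where xy: "x = Complex x1 x2" "y = Complex y1 y2" by (metis complex.exhaust)
    have "(cmod (e * y))\<^sup>2 = (cmod y)\<^sup>2" using assms by (simp add: norm_mult)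
    then show ?thesis
      unfolding f(2) vec_eq_iff forall_3
      by (simp add: e xy u_def v_def axis_def) (simp add: algebra_simps)
  qed
  moreover have "f e1 = vector [Re e, - Im e, 0]" "f e3 = e3"
    by (simp_all add: f(2) u_def e axis_def vec_eq_iff)
  ultimately show thesis using that f(1) by blast
qed

text \<open>\<open>e\<close> is the determinant; dividing the second row by it leaves a matrix in
  SU(2).\<close>

lemma unitary2_det:
  assumes "unitary2 a b c d"
  obtains e where "cmod e = 1" "c = - e * cnj b" "d = e * cnj a"
proof -
  have n: "a * cnj a + b * cnj b = 1" "c * cnj c + d * cnj d = 1" and o: "a * cnj c + b * cnj d = 0"
    using assms unfolding unitary2_def
    by (simp_all add: complex_norm_square [symmetric] flip: of_real_add of_real_power)
  have o': "cnj a * c + cnj b * d = 0"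
    using arg_cong [OF o, of cnj] by simp
  define e where "e = a * d - b * c"
  have "e * cnj a = d * (a * cnj a + b * cnj b) - b * (cnj a * c + cnj b * d)"
    by (simp add: e_def algebra_simps)
  then have d: "d = e * cnj a" using n o' by simp
  have "- e * cnj b = c * (a * cnj a + b * cnj b) - a * (cnj a * c + cnj b * d)"
    by (simp add: e_def algebra_simps)
  then have c: "c = - e * cnj b" using n o' by simp
  have "(cmod e)\<^sup>2 * ((cmod a)\<^sup>2 + (cmod b)\<^sup>2) = (cmod c)\<^sup>2 + (cmod d)\<^sup>2"
    unfolding c d by (simp add: norm_mult power_mult_distrib algebra_simps)
  then have "(cmod e)\<^sup>2 = 1" using assms by (simp add: unitary2_def)
  then have "cmod e = 1" using norm_ge_zero [of e] by (simp add: power2_eq_1_iff)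
  then show thesis using that c d by blast
qed

lemma unitary_imp_rot3:
  assumes "unitary2 a b c d"
  obtains f where "f \<in> rot3" "\<And>x y. spin (a * x + b * y) (c * x + d * y) = f (spin x y)"
proof -
  obtain e where e: "cmod e = 1" "c = - e * cnj b" "d = e * cnj a" by (rule unitary2_det [OF assms])
  have ab: "(cmod a)\<^sup>2 + (cmod b)\<^sup>2 = 1" using assms by (simp add: unitary2_def)
  obtain f where f: "f \<in> rot3" "\<And>x y. spin (a * x + b * y) (- cnj b * x + cnj a * y) = f (spin x y)"
    by (rule rotation_SU2 [OF ab]) (rule that)
  obtain g where g: "g \<in> rot3" "\<And>x y. spin x (e * y) = g (spin x y)"
    "g e1 = vector [Re e, - Im e, 0]" "g e3 = e3"
    by (rule rotation_phase [OF e(1)]) (rule that)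
  have "spin (a * x + b * y) (c * x + d * y) = (g \<circ> f) (spin x y)" for x y
  proof -
    have "c * x + d * y = e * (- cnj b * x + cnj a * y)" by (simp add: e algebra_simps)
    then show ?thesis using f g by simp
  qed
  then show thesis using that rot3_comp [OF g(1) f(1)] by blast
qed

text \<open>A spinor over \<open>f e3\<close> gives the first column of an element of SU(2) whose
  rotation \<open>g\<close> agrees with \<open>f\<close> on \<open>e3\<close>. Then \<open>f\<close>
  followed by the inverse of \<open>g\<close> fixes \<open>e3\<close>, so it turns about the third
  axis and comes from a phase.\<close>

lemma rot3_imp_unitary:
  assumes f: "f \<in> rot3"
  obtains a b c d where "unitary2 a b c d" "\<And>x y. spin (a * x + b * y) (c * x + d * y) = f (spin x y)"
proof -
  obtain x y where xy: "spin x y = f e3" by (rule spin_surj)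
  have "norm (spin x y) = 1" using rot3_simps(7) [OF f, of e3] xy by simp
  then have n: "(cmod x)\<^sup>2 + (cmod y)\<^sup>2 = 2" by (simp add: norm_spin)
  \<comment> \<open>For this \<open>r\<close> the spinor \<open>(r, 0)\<close> lies over
    \<open>e3\<close>; dividing by \<open>r\<close> makes the matrix send it to
    \<open>(x, y)\<close>.\<close>
  define r where "r = complex_of_real (sqrt 2)"
  have r: "r \<noteq> 0" "cnj r = r" "cmod r = sqrt 2" by (simp_all add: r_def)
  define a where "a = x / r"
  define b where "b = - cnj y / r"
  have ab: "(cmod a)\<^sup>2 + (cmod b)\<^sup>2 = 1"
    using n by (simp add: a_def b_def norm_divide power_divide r(3) add_divide_distrib [symmetric])
  obtain g where g: "g \<in> rot3" "\<And>x y. spin (a * x + b * y) (- cnj b * x + cnj a * y) = g (spin x y)"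
    by (rule rotation_SU2 [OF ab]) (rule that)
  have "spin r 0 = e3" by (simp add: vec_eq_iff forall_3 axis_def r(3))
  then have ge3: "g e3 = f e3" using g(2) [of r 0] xy r by (simp add: a_def b_def)
  define h where "h = inv_into UNIV g \<circ> f"
  have h: "h \<in> rot3" "g (h z) = f z" for z
    using rot3_inv [OF g(1)] f by (simp_all add: h_def rot3_comp)
  have he3: "h e3 = e3" using rot3_inv(2) [OF g(1), of e3] ge3 by (simp add: h_def)
  \<comment> \<open>The phase is read off from the image of \<open>e1\<close>, conjugated as in
    \<open>rotation_phase\<close>.\<close>
  define e where "e = Complex (h e1 $ 1) (- (h e1 $ 2))"
  have "h e1 \<bullet> e3 = 0" using rot3_simps(6) [OF h(1), of e1 e3] he3 by simp
  then have h3: "h e1 $ 3 = 0" by (simp add: inner_axis)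
  have "norm (h e1) = 1" using rot3_simps(7) [OF h(1), of e1] by simp
  then have "cmod e = 1" using h3 by (simp add: norm3 e_def cmod_def)
  then obtain k where k: "k \<in> rot3" "\<And>x y. spin x (e * y) = k (spin x y)"
    "k e1 = vector [Re e, - Im e, 0]" "k e3 = e3"
    by (rule rotation_phase) (rule that)
  have ke1: "k e1 = h e1" using h3 by (simp add: k(3) e_def vec_eq_iff forall_3)
  have ke2: "k e2 = h e2"
    using rot3_simps(8) [OF k(1), of e3 e1] rot3_simps(8) [OF h(1), of e3 e1] ke1 he3 k(4) by (simp add: cross_basis)
  have kh: "k z = h z" for z
    by (subst (1 2) basis3 [of z]) (simp only: rot3_simps(1,3) [OF k(1)] rot3_simps(1,3) [OF h(1)] ke1 ke2 k(4) he3)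
  have "spin (a * x + b * e * y) (- cnj b * x + cnj a * e * y) = f (spin x y)" for x y
    using g(2) [of x "e * y"] k(2) [of x y] kh h(2) by (simp add: mult.assoc)
  moreover have "unitary2 a (b * e) (- cnj b) (cnj a * e)"
  proof -
    have "e * cnj e = 1" using \<open>cmod e = 1\<close> by (metis complex_norm_square of_real_1 power_one)
    have "a * cnj (- cnj b) + b * e * cnj (cnj a * e) = a * b * (e * cnj e - 1)" by (simp add: algebra_simps)
    then have "a * cnj (- cnj b) + b * e * cnj (cnj a * e) = 0" unfolding \<open>e * cnj e = 1\<close> by simp
    then show ?thesis
      using ab \<open>cmod e = 1\<close> by (simp add: unitary2_def norm_mult add.commute)
  qed
  ultimately show thesis using that by blast
qed

section \<open>From planes to quadruples of vectors\<close>

lemma exhaust_5: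
  fixes x :: 5
  shows "x = 1 \<or> x = 2 \<or> x = 3 \<or> x = 4 \<or> x = 5"
proof (induct x)
  case (of_int z)
  then have "0 \<le> z" "z < 5" by simp_all
  then have "z = 0 \<or> z = 1 \<or> z = 2 \<or> z = 3 \<or> z = 4" by arith
  then show ?case by auto
qed

lemma UNIV_5: "UNIV = {1, 2, 3, 4, 5 :: 5}"
  using exhaust_5 by auto

lemma sum_5: "sum f (UNIV :: 5 set) = f 1 + f 2 + f 3 + f 4 + f 5"
  unfolding UNIV_5 by (simp add: ac_simps)

definition herm :: "complex^5 \<Rightarrow> complex^5 \<Rightarrow> complex" where
  "herm u v = (\<Sum>i\<in>UNIV. u $ i * cnj (v $ i))"

lemma herm_simps: "herm (u + u') v = herm u v + herm u' v" "herm u (v + v') = herm u v + herm u v'"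
  "herm (u - u') v = herm u v - herm u' v" "herm u (v - v') = herm u v - herm u v'"
  "herm (a *s u) v = a * herm u v" "herm u (a *s v) = cnj a * herm u v" "herm 0 v = 0" "herm u 0 = 0"
  by (simp_all add: herm_def algebra_simps sum.distrib sum_subtractf sum_distrib_left)

lemma herm_commute: "herm v u = cnj (herm u v)"
  by (simp add: herm_def mult.commute)

lemma herm_self: "herm u u = complex_of_real (\<Sum>i\<in>UNIV. (cmod (u $ i))\<^sup>2)"
  by (simp only: herm_def of_real_sum complex_norm_square)

lemma herm_self_norm: "herm u u = complex_of_real ((norm u)\<^sup>2)"
  unfolding herm_self by (simp add: norm_vec_def L2_set_def sum_nonneg)

definition frames :: "((complex^5) \<times> (complex^5)) set" where
  "frames = {(u, v). herm u u = 1 \<and> herm v v = 1 \<and> herm u v = 0}"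

definition independent_pairs :: "((complex^5) \<times> (complex^5)) set" where
  "independent_pairs = {(u, v). cindep2 u v}"

lemma stiefel25_top_of_set: "stiefel25 = top_of_set independent_pairs"
  by (simp add: stiefel25_def independent_pairs_def)

lemma frames_independent: "frames \<subseteq> independent_pairs"
proof
  fix z assume "z \<in> frames"
  then obtain u v where z: "z = (u, v)" "herm u u = 1" "herm v v = 1" "herm u v = 0"
    by (auto simp: frames_def)
  have "a = 0 \<and> b = 0" if "a *s u + b *s v = 0" for a b
  proof -
    have "herm (a *s u + b *s v) u = a" "herm (a *s u + b *s v) v = b"
      using z herm_commute [of v u] by (simp_all add: herm_simps)
    then show ?thesis unfolding that by (simp add: herm_simps)
  qed
  then show "z \<in> independent_pairs" by (auto simp: independent_pairs_def cindep2_def z)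
qed

definition gram_schmidt :: "(complex^5) \<times> (complex^5) \<Rightarrow> (complex^5) \<times> (complex^5)" where
  "gram_schmidt = (\<lambda>(u, v). let w = v - (herm v u / herm u u) *s u in
     (complex_of_real (1 / norm u) *s u, complex_of_real (1 / norm w) *s w))"

lemma continuous_on_smult [continuous_intros]:
  fixes f :: "'a::topological_space \<Rightarrow> complex" and g :: "'a \<Rightarrow> complex^'n"
  shows "continuous_on S f \<Longrightarrow> continuous_on S g \<Longrightarrow> continuous_on S (\<lambda>x. f x *s g x)"
  unfolding vector_scalar_mult_def by (intro continuous_intros)

lemma continuous_on_herm [continuous_intros]:
  "continuous_on S f \<Longrightarrow> continuous_on S g \<Longrightarrow> continuous_on S (\<lambda>x. herm (f x) (g x))"
  unfolding herm_def by (intro continuous_intros)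

lemma independent_nonzero:
  assumes "cindep2 u v" shows "u \<noteq> 0" "v - a *s u \<noteq> 0"
proof -
  have *: "\<And>a b. a *s u + b *s v = 0 \<Longrightarrow> a = 0 \<and> b = 0" using assms by (simp add: cindep2_def)
  show "u \<noteq> 0" using * [of 1 0] by auto
  have "v - a *s u = (- a) *s u + 1 *s v" by (simp add: vec_eq_iff)
  then show "v - a *s u \<noteq> 0" using * [of "- a" 1] by auto
qed

lemma continuous_gram_schmidt: "continuous_on independent_pairs gram_schmidt"
proof -
  have "continuous_on independent_pairs (\<lambda>z. (complex_of_real (1 / norm (fst z)) *s fst z,
     complex_of_real (1 / norm (snd z - (herm (snd z) (fst z) / herm (fst z) (fst z)) *s fst z)) *s
       (snd z - (herm (snd z) (fst z) / herm (fst z) (fst z)) *s fst z)))"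
    by (intro continuous_intros)
      (auto simp: independent_pairs_def herm_self_norm independent_nonzero dest: independent_nonzero)
  then show ?thesis by (simp add: gram_schmidt_def case_prod_unfold Let_def)
qed

lemma herm_normalize: "u \<noteq> 0 \<Longrightarrow> herm (complex_of_real (1 / norm u) *s u) (complex_of_real (1 / norm u) *s u) = 1"
  by (simp only: herm_simps) (simp add: herm_self_norm power2_eq_square)

lemma gram_schmidt_frames:
  assumes "cindep2 u v" shows "gram_schmidt (u, v) \<in> frames"
proof -
  define w where "w = v - (herm v u / herm u u) *s u"
  have nz: "u \<noteq> 0" "w \<noteq> 0" using independent_nonzero [OF assms] by (auto simp: w_def)
  then have "herm u u \<noteq> 0" by (simp add: herm_self_norm)
  then have "herm w u = 0" by (simp add: w_def herm_simps)
  then have "herm u w = 0" using herm_commute [of u w] by simp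
  then have "herm (complex_of_real (1 / norm u) *s u) (complex_of_real (1 / norm w) *s w) = 0"
    by (simp only: herm_simps mult_zero_right)
  moreover have "gram_schmidt (u, v) = (complex_of_real (1 / norm u) *s u, complex_of_real (1 / norm w) *s w)"
    unfolding gram_schmidt_def w_def by (simp add: Let_def)
  ultimately show ?thesis
    unfolding frames_def by (simp only: herm_normalize [OF nz(1)] herm_normalize [OF nz(2)] mem_Collect_eq case_prod_conv)
qed

lemma cplane_subset:
  assumes "u' \<in> cplane u v" "v' \<in> cplane u v" shows "cplane u' v' \<subseteq> cplane u v"
proof
  fix z assume "z \<in> cplane u' v'"
  then obtain x y where z: "z = x *s u' + y *s v'" by (auto simp: cplane_def)
  obtain a b c d where "u' = a *s u + b *s v" "v' = c *s u + d *s v"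
    using assms by (auto simp: cplane_def)
  then have eq: "z = (x * a + y * c) *s u + (x * b + y * d) *s v"
    by (simp add: z vec_eq_iff algebra_simps)
  show "z \<in> cplane u v" unfolding eq cplane_def by blast
qed

lemma in_cplane: "a *s u + b *s v \<in> cplane u v"
  by (auto simp: cplane_def)

lemma cplane_gram_schmidt:
  assumes "cindep2 u v" shows "(case gram_schmidt (u, v) of (u', v') \<Rightarrow> cplane u' v') = cplane u v"
proof -
  define k where "k = herm v u / herm u u"
  define w where "w = v - k *s u"
  have nz: "u \<noteq> 0" "w \<noteq> 0" using independent_nonzero [OF assms] by (auto simp: w_def)
  let ?u = "complex_of_real (1 / norm u) *s u" and ?w = "complex_of_real (1 / norm w) *s w"
  have "?u = complex_of_real (1 / norm u) *s u + 0 *s v" by (simp add: vec_eq_iff)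
  then have 1: "?u \<in> cplane u v" using in_cplane by metis
  have "?w = (- complex_of_real (1 / norm w) * k) *s u + complex_of_real (1 / norm w) *s v"
    by (simp add: w_def vec_eq_iff algebra_simps)
  then have 2: "?w \<in> cplane u v" using in_cplane by metis
  have "u = complex_of_real (norm u) *s ?u + 0 *s ?w" using nz by (simp add: vec_eq_iff)
  then have 3: "u \<in> cplane ?u ?w" using in_cplane by metis
  have "v = (k * complex_of_real (norm u)) *s ?u + complex_of_real (norm w) *s ?w"
    using nz by (simp add: vec_eq_iff) (simp add: w_def)
  then have 4: "v \<in> cplane ?u ?w" using in_cplane by metis
  have "cplane ?u ?w = cplane u v"
    using cplane_subset [OF 1 2] cplane_subset [OF 3 4] by (rule subset_antisym)
  then show ?thesis by (simp add: gram_schmidt_def Let_def w_def k_def)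
qed

definition torbit :: "(complex^5) \<times> (complex^5) \<Rightarrow> (complex^5) set set" where
  "torbit = (\<lambda>(u, v). Torbit (cplane u v))"

lemma torbit_gram_schmidt: "z \<in> independent_pairs \<Longrightarrow> torbit (gram_schmidt z) = torbit z"
proof -
  assume "z \<in> independent_pairs"
  then obtain u v where z: "z = (u, v)" "cindep2 u v" by (auto simp: independent_pairs_def)
  obtain u' v' where g: "gram_schmidt (u, v) = (u', v')" by fastforce
  show ?thesis using cplane_gram_schmidt [OF z(2)] by (simp add: z(1) g torbit_def)
qed

lemma quotient_map_torbit: "quotient_map (top_of_set independent_pairs) GrT_orbits torbit"
proof -
  have "quotient_map stiefel25 Gr25 (\<lambda>(u, v). cplane u v)"
    unfolding Gr25_def by (rule quotient_map_quotient_topology)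
  moreover have "quotient_map Gr25 GrT_orbits Torbit"
    unfolding GrT_orbits_def by (rule quotient_map_quotient_topology)
  ultimately have "quotient_map stiefel25 GrT_orbits (Torbit \<circ> (\<lambda>(u, v). cplane u v))"
    by (rule quotient_map_compose)
  moreover have "Torbit \<circ> (\<lambda>(u, v). cplane u v) = torbit" by (auto simp: torbit_def)
  ultimately show ?thesis by (simp add: stiefel25_top_of_set)
qed

text \<open>Gram-Schmidt does not change the plane, so \<open>torbit\<close> on all independent
  pairs factors through frames, where it is therefore still a quotient map. Frames are preferred
  because they form a compact set.\<close>

lemma quotient_map_frames_torbit: "quotient_map (top_of_set frames) GrT_orbits torbit"
proof (rule quotient_map_from_composition [of "top_of_set independent_pairs" _ gram_schmidt])
  show "continuous_map (top_of_set independent_pairs) (top_of_set frames) gram_schmidt"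
    using continuous_gram_schmidt gram_schmidt_frames by (auto simp: independent_pairs_def)
  have "continuous_map (top_of_set independent_pairs) GrT_orbits torbit"
    by (rule quotient_imp_continuous_map [OF quotient_map_torbit])
  from continuous_map_from_subtopology_mono [OF this frames_independent]
  show "continuous_map (top_of_set frames) GrT_orbits torbit" .
  show "quotient_map (top_of_set independent_pairs) GrT_orbits (torbit \<circ> gram_schmidt)"
    by (rule quotient_map_eq [OF quotient_map_torbit]) (simp add: torbit_gram_schmidt)
qed

text \<open>The last summand is the norm of the dropped fifth vector, which is minus the sum of the
  others.\<close>

definition S1 :: "quad set" where
  "S1 = {(a, b, c, d). norm a + norm b + norm c + norm d + norm (a + b + c + d) = 1}"

lemma invariant_S1: "invariant S1"
  by (auto simp: invariant_def S1_def rot3_simps(7) simp flip: rot3_simps(1))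

definition vectors :: "(complex^5) \<times> (complex^5) \<Rightarrow> quad" where
  "vectors = (\<lambda>(u, v). (spin (u $ 1) (v $ 1), spin (u $ 2) (v $ 2), spin (u $ 3) (v $ 3), spin (u $ 4) (v $ 4)))"

text \<open>The first two coordinates of the sum of spins are the real and imaginary parts of
  \<open>herm u v\<close>, and the third is half the difference of the squared norms of
  \<open>u\<close> and \<open>v\<close>; the sum of the norms is half their sum.\<close>

lemma frames_iff:
  "(u, v) \<in> frames \<longleftrightarrow> (\<Sum>i\<in>UNIV. spin (u $ i) (v $ i)) = 0 \<and> (\<Sum>i\<in>UNIV. norm (spin (u $ i) (v $ i))) = 1"
proof -
  let ?A = "\<Sum>i\<in>UNIV. (cmod (u $ i))\<^sup>2" and ?B = "\<Sum>i\<in>UNIV. (cmod (v $ i))\<^sup>2"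
  have "(\<Sum>i\<in>UNIV. norm (spin (u $ i) (v $ i))) = (?A + ?B) / 2"
    by (simp add: norm_spin sum.distrib add_divide_distrib sum_divide_distrib)
  moreover have "(\<Sum>i\<in>UNIV. spin (u $ i) (v $ i)) = vector [Re (herm u v), Im (herm u v), (?A - ?B) / 2]"
    by (simp add: vec_eq_iff forall_3 herm_def sum_subtractf diff_divide_distrib sum_divide_distrib del: complex_cnj_mult)
  moreover have "herm u u = 1 \<longleftrightarrow> ?A = 1" "herm v v = 1 \<longleftrightarrow> ?B = 1"
    unfolding herm_self by (simp_all del: of_real_sum)
  ultimately show ?thesis
    unfolding frames_def by (auto simp: vec_eq_iff forall_3 complex_eq_iff)
qed

lemma vectors_frames:
  assumes "(u, v) \<in> frames"
  shows "vectors (u, v) \<in> S1"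
    and "spin (u $ 5) (v $ 5) = - (spin (u $ 1) (v $ 1) + spin (u $ 2) (v $ 2) + spin (u $ 3) (v $ 3) + spin (u $ 4) (v $ 4))"
proof -
  let ?s = "\<lambda>i. spin (u $ i) (v $ i)"
  have 0: "?s 1 + ?s 2 + ?s 3 + ?s 4 + ?s 5 = 0"
    and 1: "norm (?s 1) + norm (?s 2) + norm (?s 3) + norm (?s 4) + norm (?s 5) = 1"
    using assms unfolding frames_iff sum_5 by auto
  show 5: "?s 5 = - (?s 1 + ?s 2 + ?s 3 + ?s 4)"
    using 0 by (rule minus_unique [symmetric])
  show "vectors (u, v) \<in> S1"
    using 1 unfolding 5 norm_minus_cancel by (simp add: vectors_def S1_def)
qed

text \<open>The five vectors, the last one determined by the others, are lifted separately;
  \<open>frames_iff\<close> makes the result orthonormal.\<close>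

lemma vectors_surj: "vectors ` frames = S1"
proof (intro equalityI subsetI)
  fix w assume w: "w \<in> S1"
  obtain a b c d where [simp]: "w = (a, b, c, d)" by (cases w)
  obtain f g where fg: "\<And>w. spin (f w) (g w) = w" by (metis spin_surj)
  define W :: "5 \<Rightarrow> real^3" where
    "W i = (if i = 1 then a else if i = 2 then b else if i = 3 then c else if i = 4 then d else - (a + b + c + d))" for i
  have W: "W 1 = a" "W 2 = b" "W 3 = c" "W 4 = d" "W 5 = - (a + b + c + d)" by (simp_all add: W_def)
  define u v :: "complex^5" where "u = (\<chi> i. f (W i))" and "v = (\<chi> i. g (W i))"
  have s: "spin (u $ i) (v $ i) = W i" for i by (simp add: u_def v_def fg)
  have "norm a + norm b + norm c + norm d + norm (a + b + c + d) = 1" using w by (simp add: S1_def)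
  then have "(u, v) \<in> frames"
    unfolding frames_iff s sum_5 W norm_minus_cancel by simp
  moreover have "vectors (u, v) = w" unfolding vectors_def by (simp add: s W)
  ultimately show "w \<in> vectors ` frames" by (metis image_eqI)
qed (use vectors_frames(1) in auto)

lemma compact_frames: "compact frames"
proof -
  have "frames = (\<lambda>z. (herm (fst z) (fst z), herm (snd z) (snd z), herm (fst z) (snd z))) -` {(1, 1, 0)}"
    by (auto simp: frames_def)
  moreover have "closed \<dots>"
    by (intro closed_vimage continuous_intros; simp)
  ultimately have "closed frames" by simp
  have "norm z \<le> 2" if "z \<in> frames" for z
  proof -
    obtain u v where z: "z = (u, v)" "herm u u = 1" "herm v v = 1" using \<open>z \<in> frames\<close> by (auto simp: frames_def)
    then have "(norm u)\<^sup>2 = 1" "(norm v)\<^sup>2 = 1" unfolding herm_self_norm by (metis of_real_eq_1_iff)+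
    then have "norm u = 1" "norm v = 1" by (simp_all add: power2_eq_1_iff) (metis norm_ge_zero neg_0_le_iff_le not_one_le_zero)+
    then show ?thesis using norm_Pair_le [of u v] z by simp
  qed
  then have "bounded frames" unfolding bounded_iff by blast
  then show ?thesis using \<open>closed frames\<close> compact_eq_bounded_closed by blast
qed

lemma continuous_on_spin [continuous_intros]:
  fixes f g :: "'a::topological_space \<Rightarrow> complex"
  assumes "continuous_on S f" "continuous_on S g"
  shows "continuous_on S (\<lambda>x. spin (f x) (g x))"
proof -
  have "spin x y = Re (x * cnj y) *\<^sub>R e1 + Im (x * cnj y) *\<^sub>R e2 + (((cmod x)\<^sup>2 - (cmod y)\<^sup>2) / 2) *\<^sub>R e3" for x y
    by (subst basis3 [of "spin x y"]) (simp only: spin_components)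
  then show ?thesis using assms by (auto intro!: continuous_intros)
qed

text \<open>A continuous surjection from a compact space to a Hausdorff space is closed, hence a
  quotient map; no continuous choice of spinors is involved.\<close>

lemma quotient_map_vectors: "quotient_map (top_of_set frames) (Q S1) (orb \<circ> vectors)"
proof (rule quotient_map_compose [OF _ quotient_map_orb [OF invariant_S1]])
  have c: "continuous_on frames vectors"
    unfolding vectors_def case_prod_unfold by (intro continuous_intros)
  show "quotient_map (top_of_set frames) (top_of_set S1) vectors"
  proof (rule continuous_closed_imp_quotient_map)
    show cm: "continuous_map (top_of_set frames) (top_of_set S1) vectors"
      using c vectors_surj by auto
    show "closed_map (top_of_set frames) (top_of_set S1) vectors"
      by (intro continuous_imp_closed_map cm) (simp_all add: compact_space_subtopology compact_frames Hausdorff_space_subtopology)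
    show "vectors ` topspace (top_of_set frames) = topspace (top_of_set S1)"
      using vectors_surj by simp
  qed
qed

section \<open>Torus orbits compared with rotation orbits\<close>

definition smul :: "complex^5 \<Rightarrow> complex^5 \<Rightarrow> complex^5" where
  "smul s z = (\<chi> i. s $ i * z $ i)"

lemma tact_cplane: "tact s (cplane u v) = cplane (smul s u) (smul s v)"
proof -
  have "smul s (a *s u + b *s v) = a *s smul s u + b *s smul s v" for a b
    by (simp add: smul_def vec_eq_iff algebra_simps)
  moreover have "tact s P = smul s ` P" for P by (simp add: tact_def smul_def)
  ultimately show ?thesis unfolding cplane_def by (auto simp: image_iff) metis+
qed

lemma smul_smul: "smul s (smul t z) = smul (smul s t) z"
  by (simp add: smul_def vec_eq_iff mult.assoc)

lemma torusT_mult: "s \<in> torusT \<Longrightarrow> t \<in> torusT \<Longrightarrow> smul s t \<in> torusT"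
  by (simp add: torusT_def smul_def norm_mult prod.distrib)

lemma torusT_one: "1 \<in> torusT" by (simp add: torusT_def)

lemma torusT_inverse:
  assumes "s \<in> torusT" obtains t where "t \<in> torusT" "smul s t = 1" "smul t s = 1"
proof
  let ?t = "\<chi> i. cnj (s $ i)"
  have c: "s $ i * cnj (s $ i) = 1" for i
    using assms by (metis (mono_tags, lifting) complex_norm_square mem_Collect_eq of_real_1 power_one torusT_def)
  have "(\<Prod>i\<in>UNIV. cnj (s $ i)) = cnj (\<Prod>i\<in>UNIV. s $ i)" by (rule cnj_prod [symmetric])
  also have "\<dots> = 1" using assms by (simp add: torusT_def)
  finally show "?t \<in> torusT" using assms by (simp add: torusT_def)
  show "smul s ?t = 1" "smul ?t s = 1" using c by (simp_all add: smul_def vec_eq_iff mult.commute)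
qed

lemma smul_one [simp]: "smul 1 z = z" by (simp add: smul_def vec_eq_iff)

lemma Torbit_eq_iff: "Torbit (cplane u v) = Torbit (cplane u' v') \<longleftrightarrow>
   (\<exists>s \<in> torusT. cplane u' v' = cplane (smul s u) (smul s v))"
proof
  assume eq: "Torbit (cplane u v) = Torbit (cplane u' v')"
  have "cplane u' v' = tact 1 (cplane u' v')" by (simp add: tact_cplane)
  then have "cplane u' v' \<in> Torbit (cplane u' v')" using torusT_one unfolding Torbit_def by blast
  then show "\<exists>s \<in> torusT. cplane u' v' = cplane (smul s u) (smul s v)"
    unfolding eq [symmetric] by (auto simp: Torbit_def tact_cplane)
next
  assume "\<exists>s \<in> torusT. cplane u' v' = cplane (smul s u) (smul s v)"
  then obtain s where s: "s \<in> torusT" "cplane u' v' = cplane (smul s u) (smul s v)" by blast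
  obtain t where t: "t \<in> torusT" "smul s t = 1" "smul t s = 1" by (rule torusT_inverse [OF s(1)])
  have T: "tact r (cplane u' v') = tact (smul r s) (cplane u v)" for r
    unfolding s(2) tact_cplane by (simp add: smul_smul)
  have "tact r (cplane u v) = tact (smul r t) (cplane u' v')" for r
  proof -
    have "smul (smul r t) s = smul r (smul t s)" by (rule smul_smul [symmetric])
    also have "\<dots> = r" unfolding t(3) by (simp add: smul_def vec_eq_iff)
    finally show ?thesis unfolding T by simp
  qed
  note T' = this
  show "Torbit (cplane u v) = Torbit (cplane u' v')"
    unfolding Torbit_def
  proof (intro equalityI subsetI; elim CollectE exE conjE)
    fix P r assume "P = tact r (cplane u v)" "r \<in> torusT"
    then have "P = tact (smul r t) (cplane u' v')" "smul r t \<in> torusT"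
      using T' [of r] torusT_mult [OF _ t(1)] by simp_all
    then show "P \<in> {tact s (cplane u' v') |s. s \<in> torusT}" by blast
  next
    fix P r assume "P = tact r (cplane u' v')" "r \<in> torusT"
    then have "P = tact (smul r s) (cplane u v)" "smul r s \<in> torusT"
      using T [of r] torusT_mult [OF _ s(1)] by simp_all
    then show "P \<in> {tact s (cplane u v) |s. s \<in> torusT}" by blast
  qed
qed

lemma unitary_frame:
  assumes "unitary2 a b c d" "(u, v) \<in> frames"
  defines "u' \<equiv> a *s u + b *s v" and "v' \<equiv> c *s u + d *s v"
  shows "(u', v') \<in> frames" "cplane u' v' = cplane u v"
proof -
  have n: "a * cnj a + b * cnj b = 1" "c * cnj c + d * cnj d = 1" and o: "a * cnj c + b * cnj d = 0"
    using assms(1) unfolding unitary2_def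
    by (simp_all add: complex_norm_square [symmetric] flip: of_real_add of_real_power)
  have h: "herm u u = 1" "herm v v = 1" "herm u v = 0" "herm v u = 0"
    using assms(2) herm_commute [of v u] by (simp_all add: frames_def)
  show "(u', v') \<in> frames"
    using n o by (simp add: frames_def u'_def v'_def herm_simps h mult.commute)
  obtain e where e: "cmod e = 1" "c = - e * cnj b" "d = e * cnj a" by (rule unitary2_det [OF assms(1)])
  have ee: "e * cnj e = 1" using e(1) by (metis complex_norm_square of_real_1 power_one)
  \<comment> \<open>The columns of the matrix are orthonormal too, deduced from the rows by way of
    the determinant \<open>e\<close>; this expresses \<open>u\<close> and \<open>v\<close> through
    the new frame.\<close>
  have "cnj a * a + cnj c * c = a * cnj a + (e * cnj e) * (b * cnj b)"
    "cnj a * b + cnj c * d = cnj a * b - (e * cnj e) * (cnj a * b)"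
    "cnj b * a + cnj d * c = cnj b * a - (e * cnj e) * (cnj b * a)"
    "cnj b * b + cnj d * d = b * cnj b + (e * cnj e) * (a * cnj a)"
    unfolding e by (simp_all add: algebra_simps)
  then have k: "cnj a * a + cnj c * c = 1" "cnj a * b + cnj c * d = 0" "cnj b * a + cnj d * c = 0" "cnj b * b + cnj d * d = 1"
    using n unfolding ee by (simp_all add: add.commute)
  have "cnj a *s u' + cnj c *s v' = (cnj a * a + cnj c * c) *s u + (cnj a * b + cnj c * d) *s v"
    "cnj b *s u' + cnj d *s v' = (cnj b * a + cnj d * c) *s u + (cnj b * b + cnj d * d) *s v"
    by (simp_all add: u'_def v'_def vec_eq_iff algebra_simps)
  then have "u = cnj a *s u' + cnj c *s v'" "v = cnj b *s u' + cnj d *s v'"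
    unfolding k by (simp_all add: vec_eq_iff)
  then have "u \<in> cplane u' v'" "v \<in> cplane u' v'" using in_cplane by metis+
  moreover have "u' \<in> cplane u v" "v' \<in> cplane u v" unfolding u'_def v'_def by (rule in_cplane)+
  ultimately show "cplane u' v' = cplane u v" by (meson cplane_subset subset_antisym)
qed

text \<open>Expanding the second frame in the first turns its orthonormality into the relations for
  the coefficients.\<close>

lemma same_plane_unitary:
  assumes "(u, v) \<in> frames" "(u', v') \<in> frames" "cplane u' v' = cplane u v"
  obtains a b c d where "unitary2 a b c d" "u' = a *s u + b *s v" "v' = c *s u + d *s v"
proof -
  have "u' = 1 *s u' + 0 *s v'" "v' = 0 *s u' + 1 *s v'" by (simp_all add: vec_eq_iff)
  then have "u' \<in> cplane u v" "v' \<in> cplane u v" unfolding assms(3) [symmetric] using in_cplane by metis+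
  then obtain a b c d where uv: "u' = a *s u + b *s v" "v' = c *s u + d *s v" by (auto simp: cplane_def)
  have h: "herm u u = 1" "herm v v = 1" "herm u v = 0" "herm v u = 0"
    using assms(1) herm_commute [of v u] by (simp_all add: frames_def)
  have "herm u' u' = 1" "herm v' v' = 1" "herm u' v' = 0" using assms(2) by (simp_all add: frames_def)
  then have "a * cnj a + b * cnj b = 1" "c * cnj c + d * cnj d = 1" "a * cnj c + b * cnj d = 0"
    by (simp_all add: uv herm_simps h mult.commute)
  then have "unitary2 a b c d"
    unfolding unitary2_def by (simp_all add: complex_norm_square [symmetric] flip: of_real_add of_real_power)
  then show thesis using that uv by blast
qed

lemma fifth_root:
  assumes "cmod p = 1" obtains r where "cmod r = 1" "r ^ 5 = p"
proof
  show "cmod (cis (Arg p / 5)) = 1" by simp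
  have "p \<noteq> 0" using assms by auto
  then have "p = cis (Arg p)" using assms by (simp add: cis_Arg sgn_div_norm)
  have "cis (Arg p / 5) ^ 5 = cis (Arg p)" unfolding Complex.DeMoivre by simp
  then show "cis (Arg p / 5) ^ 5 = p" using \<open>p = cis (Arg p)\<close> by (rule trans [OF _ sym])
qed

text \<open>A torus element changes each column by a phase, which \<open>spin\<close> does not see,
  and a change of frame within a plane is unitary, hence acts as a rotation. Conversely a rotation
  lifts to a unitary change of frame, after which equal spins leave one phase per column.\<close>

lemma same_fibres:
  assumes "(u, v) \<in> frames" "(u', v') \<in> frames"
  shows "torbit (u, v) = torbit (u', v') \<longleftrightarrow> orb (vectors (u, v)) = orb (vectors (u', v'))"
proof
  assume "torbit (u, v) = torbit (u', v')"
  then obtain s where s: "s \<in> torusT" "cplane u' v' = cplane (smul s u) (smul s v)"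
    by (auto simp: torbit_def Torbit_eq_iff)
  have sp: "spin (smul s u $ i) (smul s v $ i) = spin (u $ i) (v $ i)" for i
    using s(1) by (simp add: smul_def spin_phase torusT_def)
  then have "(smul s u, smul s v) \<in> frames" using assms(1) unfolding frames_iff by simp
  from same_plane_unitary [OF this assms(2) s(2)] obtain a b c d where
    ab: "unitary2 a b c d" "u' = a *s smul s u + b *s smul s v" "v' = c *s smul s u + d *s smul s v" .
  obtain f where f: "f \<in> rot3" "\<And>x y. spin (a * x + b * y) (c * x + d * y) = f (spin x y)"
    by (rule unitary_imp_rot3 [OF ab(1)]) (rule that)
  have "spin (u' $ i) (v' $ i) = f (spin (u $ i) (v $ i))" for i
    using f(2) sp by (simp add: ab)
  then show "orb (vectors (u, v)) = orb (vectors (u', v'))"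
    unfolding orb_eq_iff using f(1) by (auto simp: vectors_def)
next
  assume "orb (vectors (u, v)) = orb (vectors (u', v'))"
  then obtain f where f: "f \<in> rot3" "vectors (u', v') = act f (vectors (u, v))" by (auto simp: orb_eq_iff)
  then have "spin (u' $ i) (v' $ i) = f (spin (u $ i) (v $ i))" if "i \<noteq> 5" for i
    using exhaust_5 [of i] that by (auto simp: vectors_def)
  \<comment> \<open>The quadruple omits the fifth vector; it follows because the five vectors sum to
    0.\<close>
  moreover have "spin (u' $ 5) (v' $ 5) = f (spin (u $ 5) (v $ 5))"
    unfolding vectors_frames(2) [OF assms(1)] vectors_frames(2) [OF assms(2)]
    using f by (simp add: vectors_def rot3_simps)
  ultimately have sf: "spin (u' $ i) (v' $ i) = f (spin (u $ i) (v $ i))" for i by metis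
  obtain a b c d where ab: "unitary2 a b c d" "\<And>x y. spin (a * x + b * y) (c * x + d * y) = f (spin x y)"
    by (rule rot3_imp_unitary [OF f(1)]) (rule that)
  define p q where "p = a *s u + b *s v" and "q = c *s u + d *s v"
  have pq: "(p, q) \<in> frames" "cplane p q = cplane u v"
    using unitary_frame [OF ab(1) assms(1)] by (simp_all add: p_def q_def)
  have "spin (p $ i) (q $ i) = spin (u' $ i) (v' $ i)" for i
    using ab(2) sf by (simp add: p_def q_def)
  then have "\<exists>s. cmod s = 1 \<and> u' $ i = s * p $ i \<and> v' $ i = s * q $ i" for i
    using spin_eq_phase by metis
  then obtain s where s: "\<And>i. cmod (s i) = 1" "\<And>i. u' $ i = s i * p $ i" "\<And>i. v' $ i = s i * q $ i"
    by metis
  have "cmod (inverse (\<Prod>i\<in>UNIV. s i)) = 1" using s(1) by (simp add: prod_norm [symmetric] norm_inverse)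
  \<comment> \<open>The phases need not multiply to 1. A common factor \<open>r\<close> enters the
    product five times and corrects it, while scalars preserve the plane.\<close>
  then obtain r where r: "cmod r = 1" "r ^ 5 = inverse (\<Prod>i\<in>UNIV. s i)" by (rule fifth_root)
  have "(\<Prod>i\<in>UNIV. s i) \<noteq> 0" using s(1) by (metis norm_eq_zero prod_zero_iff finite zero_neq_one)
  then have t: "(\<chi> i. r * s i) \<in> torusT" (is "?t \<in> _")
    using r s(1) by (simp add: torusT_def norm_mult prod.distrib)
  have "smul ?t p = r *s u'" "smul ?t q = r *s v'"
    by (simp_all add: smul_def vec_eq_iff s mult.assoc)
  moreover have "cplane (r *s u') (r *s v') = cplane u' v'"
  proof -
    have "unitary2 r 0 0 r" using r(1) by (simp add: unitary2_def)
    from unitary_frame(2) [OF this assms(2)] show ?thesis by (simp add: vec_eq_iff)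
  qed
  ultimately have "cplane u' v' = cplane (smul ?t p) (smul ?t q)" by simp
  then have "Torbit (cplane p q) = Torbit (cplane u' v')" unfolding Torbit_eq_iff using t by blast
  then show "torbit (u, v) = torbit (u', v')" by (simp add: torbit_def pq)
qed

text \<open>Each quotient map is constant on the fibres of the other, so both descend, and the
  descended maps are mutually inverse.\<close>

lemma homeomorphic_quotients:
  assumes f: "quotient_map X Y f" and g: "quotient_map X Z g"
    and eq: "\<And>x y. x \<in> topspace X \<Longrightarrow> y \<in> topspace X \<Longrightarrow> f x = f y \<longleftrightarrow> g x = g y"
  shows "Y homeomorphic_space Z"
proof -
  obtain h where h: "continuous_map Y Z h" "\<And>x. x \<in> topspace X \<Longrightarrow> h (f x) = g x"
    using quotient_map_lift_exists [OF f quotient_imp_continuous_map [OF g]] eq by metis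
  obtain k where k: "continuous_map Z Y k" "\<And>x. x \<in> topspace X \<Longrightarrow> k (g x) = f x"
    using quotient_map_lift_exists [OF g quotient_imp_continuous_map [OF f]] eq by metis
  have "k (h y) = y" if "y \<in> topspace Y" for y
    using that h k quotient_imp_surjective_map [OF f] by (metis imageE)
  moreover have "h (k z) = z" if "z \<in> topspace Z" for z
    using that h k quotient_imp_surjective_map [OF g] by (metis imageE)
  ultimately show ?thesis
    unfolding homeomorphic_space_def homeomorphic_maps_def using h(1) k(1) by blast
qed

lemma homeomorphic_GrT: "GrT_orbits homeomorphic_space Q S1"
proof (rule homeomorphic_quotients [OF quotient_map_frames_torbit quotient_map_vectors])
  fix x y assume xy: "x \<in> topspace (top_of_set frames)" "y \<in> topspace (top_of_set frames)"
  obtain u v u' v' where eq: "x = (u, v)" "y = (u', v')" by (cases x, cases y)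
  show "torbit x = torbit y \<longleftrightarrow> (orb \<circ> vectors) x = (orb \<circ> vectors) y"
    unfolding eq comp_apply by (rule same_fibres) (use xy eq in simp_all)
qed

text \<open>Radial rescaling by \<open>m\<close>, which is invariant under rotations, homogeneous of
  degree 1 and positive away from 0, retracts the nonzero quadruples onto the level set.\<close>

lemma homotopy_equivalent_S1: "Q S1 homotopy_equivalent_space Q (UNIV - {0})"
proof -
  define m :: "quad \<Rightarrow> real" where "m = (\<lambda>(a, b, c, d). norm a + norm b + norm c + norm d + norm (a + b + c + d))"
  have S1: "S1 = {w. m w = 1}" by (auto simp: S1_def m_def)
  have m_scale: "m (r *\<^sub>R w) = \<bar>r\<bar> * m w" for r w
    by (cases w) (simp add: m_def algebra_simps flip: scaleR_add_right)
  have m_act: "m (act f w) = m w" if "f \<in> rot3" for f w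
    using that by (cases w) (simp add: m_def rot3_simps(7) flip: rot3_simps(1))
  have m_pos: "m w > 0" if "w \<noteq> 0" for w
  proof -
    obtain a b c d where w: "w = (a, b, c, d)" by (cases w)
    have "m w \<ge> norm a" "m w \<ge> norm b" "m w \<ge> norm c" "m w \<ge> norm d" by (simp_all add: m_def w)
    moreover have "a \<noteq> 0 \<or> b \<noteq> 0 \<or> c \<noteq> 0 \<or> d \<noteq> 0" using that by (auto simp: w zero_prod_def)
    ultimately show ?thesis by (metis linorder_not_le norm_le_zero_iff order_trans)
  qed
  have "continuous_on UNIV m" unfolding m_def case_prod_unfold by (intro continuous_intros)
  then have m_cont: "continuous_on S (\<lambda>x. m (k x))" if "continuous_on S k" for S :: "'z::topological_space set" and k
    using continuous_on_compose2 [of UNIV m S k] that by simp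
  have act_scale: "act f (r *\<^sub>R w) = r *\<^sub>R act f w" "act f (w + w') = act f w + act f w'" if "f \<in> rot3" for f r w w'
    using that by (cases w; cases w'; simp add: rot3_simps)+
  have inv: "invariant (UNIV - {0})"
    using act_scale(1) [of _ 0 0] rot3_simps(9) by (auto simp: invariant_def zero_prod_def)
  let ?g = "\<lambda>w. (1 / m w) *\<^sub>R w" and ?h = "\<lambda>(t, w). ((1 - t) + t / m w) *\<^sub>R w"
  have gS: "?g w \<in> S1" if "w \<in> UNIV - {0}" for w
    using m_pos [of w] that by (simp add: S1 m_scale)
  have sub: "S1 \<subseteq> UNIV - {0}"
    using m_scale [of 0 0] by (auto simp: S1)
  have hT: "?h (t, w) \<in> UNIV - {0}" if "t \<in> {0..1}" "w \<in> UNIV - {0}" for t w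
  proof -
    have "(1 - t) + t / m w > 0"
      using that m_pos [of w] by (cases "t = 0") (auto simp: add_nonneg_pos)
    then show ?thesis using that by simp
  qed
  have hS: "?h (t, w) \<in> S1" if "w \<in> S1" for t w using that by (simp add: S1)
  have he: "?h (t, act f w) = act f (?h (t, w))" if "f \<in> rot3" for t f w
    using that by (simp add: act_scale m_act)
  have ge: "?g (act f w) = act f (?g w)" if "f \<in> rot3" for f w
    using that by (simp add: act_scale m_act)
  have gc: "continuous_on (UNIV - {0}) ?g"
    by (intro continuous_intros m_cont) (use m_pos in force)
  have hc: "continuous_on ({0..1} \<times> (UNIV - {0})) ?h"
    unfolding case_prod_unfold by (intro continuous_intros m_cont) (use m_pos in force)
  have 1: "continuous_map (Q S1) (Q (UNIV - {0})) id" using sub by (rule continuous_map_Q_id)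
  have 2: "continuous_map (Q (UNIV - {0})) (Q S1) (orb_map ?g)"
    by (rule continuous_orb_map [OF inv invariant_S1 gc gS ge])
  have "homotopic_with (\<lambda>_. True) (Q S1) (Q S1) id (orb_map ?g)"
    by (rule homotopic_orb_eq [OF invariant_S1 invariant_S1 continuous_on_subset [OF hc] hS he])
      (use sub orb_map_orb [of ?g, OF ge] in auto)
  moreover have "homotopic_with (\<lambda>_. True) (Q (UNIV - {0})) (Q (UNIV - {0})) id (orb_map ?g)"
    by (rule homotopic_orb_eq [OF inv inv hc hT he])
      (use orb_map_orb [of ?g, OF ge] in auto)
  ultimately show ?thesis
    unfolding homotopy_equivalent_space_def using 1 2
    by (intro exI [of _ id] exI [of _ "orb_map ?g"]) (simp add: homotopic_with_symD)
qed

lemma homotopy_equivalent_GrT: "GrT_orbits homotopy_equivalent_space Q (UNIV - {0})"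
  using homeomorphic_imp_homotopy_equivalent_space [OF homeomorphic_GrT] homotopy_equivalent_S1
  by (rule homotopy_eqv_trans)

theorem theorem1:
  shows "\<forall>i::int.
     (if i = 0 \<or> i = 8 then homology_group i GrT_orbits \<cong> integer_group
      else if i = 5 then homology_group i GrT_orbits \<cong> integer_mod_group 2
      else trivial_group (homology_group i GrT_orbits))"
proof -
  have iso: "homology_group i GrT_orbits \<cong> homology_group i (Q (UNIV - {0}))" for i
    by (rule homotopy_equivalent_space_imp_isomorphic_homology_groups [OF homotopy_equivalent_GrT])
  have "trivial_group (homology_group i GrT_orbits)" if "i \<noteq> 0" "i \<noteq> 5" "i \<noteq> 8" for i
    using isomorphic_group_triviality [OF iso [of i]] homology_orbits(4) [OF that] by simp
  moreover have "homology_group 0 GrT_orbits \<cong> integer_group" "homology_group 8 GrT_orbits \<cong> integer_group"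
    "homology_group 5 GrT_orbits \<cong> integer_mod_group 2"
    by (rule iso_trans [OF iso]; rule homology_orbits)+
  ultimately show ?thesis by auto
qed

end
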